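(* Let $k$ be an algebraically closed field, let $X\subset\mathbb{P}^n$, $Y\subset\mathbb{P}^m$, $Z\subset\mathbb{P}^s$ be non-degenerate irreducible projective varieties over $k$ with homogeneous coordinate rings $A=k[\mathbf{x}]/\mathfrak{a}$, $B=k[\mathbf{y}]/\mathfrak{b}$, $S=k[\mathbf{z}]/\mathfrak{c}$, where $\mathbf{x}=(x_0,\dots,x_n)$, $\mathbf{y}=(y_0,\dots,y_m)$, $\mathbf{z}=(z_0,\dots,z_s)$. Let $\mathcal{F}:X\times Y\dashrightarrow Z$ be a rational map defined by bihomogeneous elements $f_0,\dots,f_s\in R=A\otimes_k B$ of the same bidegree, not all zero. Let $\Psi_{\mathbf{x}}$ and $\Psi_{\mathbf{y}}$ be an $\mathbf{x}$-partial and a $\mathbf{y}$-partial Jacobian dual matrix of $\mathcal{F}$. Then $\mathcal{F}$ is birational with image $Z$ if and only if $\operatorname{rank}_S(\Psi_{\mathbf{x}}\otimes_{k[\mathbf{z}]}S)=n$ and $\operatorname{rank}_S(\Psi_{\mathbf{y}}\otimes_{k[\mathbf{z}]}S)=m$. In addition, in this case, both halves $Z\dashrightarrow X$ and $Z\dashrightarrow Y$ of the expression of the inverse of $\mathcal{F}$ are given by the (signed) ordered maximal minors of an $n\times(n+1)$ submatrix of $\Psi_{\mathbf{x}}$ and of an $m\times(m+1)$ submatrix of $\Psi_{\mathbf{y}}$, respectively.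
   Context: Non-degenerate means not contained in a hyperplane of the ambient projective space. $R=A\otimes_k B\simeq k[\mathbf{x},\mathbf{y}]/(\mathfrak{a},\mathfrak{b})$, bigraded by the degrees in $\mathbf{x}$ and $\mathbf{y}$. $\mathcal{F}$ is birational with image $Z$ if it is dominant onto $Z$ and admits an inverse rational map with image $X\times_k Y$; the inverse is given by a pair of rational maps $Z\dashrightarrow X$ and $Z\dashrightarrow Y$, each defined by forms in $S$ of one fixed degree. Let $I=(f_0,\dots,f_s)\subset R$, with Rees algebra $\mathcal{R}_R(I)=R[f_0t,\dots,f_st]$. Let $\mathcal{J}\subset k[\mathbf{x},\mathbf{y},\mathbf{z}]$ be the ideal generated by the polynomials, homogeneous in $\mathbf{z}$ with bihomogeneous coefficients in $k[\mathbf{x},\mathbf{y}]$, that vanish modulo $(\mathfrak{a},\mathfrak{b})$ upon substituting $z_i\mapsto f_i$; thus $\mathcal{R}_R(I)\simeq k[\mathbf{x},\mathbf{y},\mathbf{z}]/(\mathfrak{a},\mathfrak{b},\mathcal{J})$ via $z_i\mapsto f_it$. Let $\mathcal{J}_{(1,0,* )}$ (resp. $\mathcal{J}_{(0,1,* )}$) be the set of elements of $\mathcal{J}$ of degree $1$ in $\mathbf{x}$ and $0$ in $\mathbf{y}$ (resp. $0$ in $\mathbf{x}$ and $1$ in $\mathbf{y}$) and of arbitrary degree in $\mathbf{z}$. Each form in $\mathcal{J}_{(1,0,* )}$ has a unique expression $\sum_{i=0}^n Q_i(\mathbf{z})x_i$ with $Q_i\in k[\mathbf{z}]$ homogeneous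 of the same degree. An $\mathbf{x}$-partial Jacobian dual matrix $\Psi_{\mathbf{x}}$ is the matrix with entries in $k[\mathbf{z}]$ whose rows are the coefficient vectors $(Q_0,\dots,Q_n)$ (i.e. the $\mathbf{x}$-derivatives) of the members of a minimal set of generating forms of the ideal $(\mathcal{J}_{(1,0,* )})$. The $\mathbf{y}$-partial Jacobian dual matrix $\Psi_{\mathbf{y}}$ is defined in the same way from $\mathcal{J}_{(0,1,* )}$. $\Psi\otimes_{k[\mathbf{z}]}S$ denotes the matrix obtained by reducing entries modulo $\mathfrak{c}$; ranks over the domain $S$ are ranks over its fraction field. *)

theory Defs
  imports
    "HOL-Computational_Algebra.Polynomial"
    "HOL-Library.Poly_Mapping"
    "HOL-Algebra.QuotRing"
    "Jordan_Normal_Form.Determinant"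
    "Jordan_Normal_Form.DL_Submatrix"
begin

section \<open>Polynomials in three blocks of variables\<close>

text \<open>
  All polynomials live in one type, whose variables are the \<open>x\<^sub>i = (Bx, i)\<close>,
  \<open>y\<^sub>i = (By, i)\<close> and \<open>z\<^sub>i = (Bz, i)\<close> for all natural \<open>i\<close>. The polynomial ring over
  a finite set \<open>V\<close> of variables is the subring \<open>polys V\<close>.
\<close>

datatype block = Bx | By | Bz

type_synonym var = "block \<times> nat"
type_synonym 'k mpoly = "(var \<Rightarrow>\<^sub>0 nat) \<Rightarrow>\<^sub>0 'k"

definition xs :: "nat \<Rightarrow> var set" where "xs n = {Bx} \<times> {..n}"
definition ys :: "nat \<Rightarrow> var set" where "ys m = {By} \<times> {..m}"
definition zs :: "nat \<Rightarrow> var set" where "zs s = {Bz} \<times> {..s}"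

definition Const :: "'k::comm_ring_1 \<Rightarrow> 'k mpoly" where
  "Const c = Poly_Mapping.single 0 c"

definition Var :: "var \<Rightarrow> 'k::comm_ring_1 mpoly" where
  "Var v = Poly_Mapping.single (Poly_Mapping.single v 1) 1"

definition polys :: "var set \<Rightarrow> 'k::comm_ring_1 mpoly set" where
  "polys V = {p. \<forall>\<mu>\<in>Poly_Mapping.keys p. Poly_Mapping.keys \<mu> \<subseteq> V}"

definition poly_ring :: "var set \<Rightarrow> 'k::comm_ring_1 mpoly ring" where
  "poly_ring V = \<lparr>carrier = polys V, monoid.mult = (*), one = 1, zero = 0, add = (+)\<rparr>"

definition poly_eval :: "(var \<Rightarrow> 'k::comm_ring_1) \<Rightarrow> 'k mpoly \<Rightarrow> 'k" where
  "poly_eval u p = (\<Sum>\<mu>\<in>Poly_Mapping.keys p. Poly_Mapping.lookup p \<mu> *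
     (\<Prod>v\<in>Poly_Mapping.keys \<mu>. u v ^ Poly_Mapping.lookup \<mu> v))"

definition poly_subst :: "(var \<Rightarrow> 'k::comm_ring_1 mpoly) \<Rightarrow> 'k mpoly \<Rightarrow> 'k mpoly" where
  "poly_subst \<sigma> p = (\<Sum>\<mu>\<in>Poly_Mapping.keys p. Const (Poly_Mapping.lookup p \<mu>) *
     (\<Prod>v\<in>Poly_Mapping.keys \<mu>. \<sigma> v ^ Poly_Mapping.lookup \<mu> v))"

text \<open>Only the variables in \<open>B\<close> count for the degree; the zero polynomial is homogeneous of
  every degree.\<close>

definition homogeneous_in :: "var set \<Rightarrow> nat \<Rightarrow> 'k::comm_ring_1 mpoly \<Rightarrow> bool" where
  "homogeneous_in B d p \<longleftrightarrow>
     (\<forall>\<mu>\<in>Poly_Mapping.keys p. (\<Sum>v\<in>Poly_Mapping.keys \<mu> \<inter> B. Poly_Mapping.lookup \<mu> v) = d)"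


section \<open>Projective varieties\<close>

text \<open>
  The homogeneous coordinates of a point are indexed by the variables themselves: the projective
  space with coordinates \<open>B\<close> consists of the classes, up to nonzero scalars, of the nonzero
  functions on variables that are supported in \<open>B\<close>. So \<open>proj_space (xs n)\<close> is \<open>\<P>\<^sup>n\<close>.
\<close>

type_synonym 'k coord_vec = "var \<Rightarrow> 'k"
type_synonym 'k point = "(var \<Rightarrow> 'k) set"

definition coord_vecs :: "var set \<Rightarrow> 'k::field coord_vec set" where
  "coord_vecs B = {u. (\<exists>v. u v \<noteq> 0) \<and> (\<forall>v. v \<notin> B \<longrightarrow> u v = 0)}"

definition proj_rel :: "var set \<Rightarrow> ('k::field coord_vec \<times> 'k coord_vec) set" where
  "proj_rel B = {(u, w). u \<in> coord_vecs B \<and> w \<in> coord_vecs B \<and>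
                         (\<exists>c. c \<noteq> 0 \<and> w = (\<lambda>v. c * u v))}"

definition proj_space :: "var set \<Rightarrow> 'k::field point set" where
  "proj_space B = coord_vecs B // proj_rel B"

definition proj_point :: "var set \<Rightarrow> 'k::field coord_vec \<Rightarrow> 'k point" where
  "proj_point B u = proj_rel B `` {u}"

definition zero_locus :: "var set \<Rightarrow> 'k::field mpoly set \<Rightarrow> 'k point set" where
  "zero_locus B T = {P \<in> proj_space B. \<forall>u\<in>P. \<forall>p\<in>T. poly_eval u p = 0}"

definition proj_closed :: "var set \<Rightarrow> 'k::field point set \<Rightarrow> bool" where
  "proj_closed B W \<longleftrightarrow>
     (\<exists>T. T \<subseteq> polys B \<and> (\<forall>p\<in>T. \<exists>d. homogeneous_in B d p) \<and> W = zero_locus B T)"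

definition proj_closure :: "var set \<Rightarrow> 'k::field point set \<Rightarrow> 'k point set" where
  "proj_closure B W = \<Inter>{C. proj_closed B C \<and> W \<subseteq> C}"

definition irreducible_variety :: "var set \<Rightarrow> 'k::field point set \<Rightarrow> bool" where
  "irreducible_variety B W \<longleftrightarrow> proj_closed B W \<and> W \<noteq> {} \<and>
     (\<forall>C D. proj_closed B C \<longrightarrow> proj_closed B D \<longrightarrow> W \<subseteq> C \<union> D \<longrightarrow> W \<subseteq> C \<or> W \<subseteq> D)"

definition nondegenerate :: "var set \<Rightarrow> 'k::field point set \<Rightarrow> bool" where
  "nondegenerate B W \<longleftrightarrow>
     \<not> (\<exists>l\<in>polys B. l \<noteq> 0 \<and> homogeneous_in B 1 l \<and> W \<subseteq> zero_locus B {l})"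

text \<open>Vanishing is required on all coordinate vectors of a point, so over an infinite field this is
  the homogeneous ideal generated by the forms that vanish on \<open>W\<close>.\<close>

definition vanishing_ideal :: "var set \<Rightarrow> 'k::field point set \<Rightarrow> 'k mpoly set" where
  "vanishing_ideal B W = {p \<in> polys B. \<forall>P\<in>W. \<forall>u\<in>P. poly_eval u p = 0}"

definition coord_ring :: "var set \<Rightarrow> 'k::field point set \<Rightarrow> 'k mpoly set ring" where
  "coord_ring B W = poly_ring B Quot vanishing_ideal B W"

text \<open>The kernel of \<open>k[x, y] \<rightarrow> A \<otimes> B\<close>; elements of \<open>A \<otimes> B\<close> are given by polynomials in
  \<open>k[x, y]\<close> modulo this ideal.\<close>

definition product_ideal ::
  "nat \<Rightarrow> nat \<Rightarrow> 'k::field point set \<Rightarrow> 'k point set \<Rightarrow> 'k mpoly set" where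
  "product_ideal n m X Y =
     Idl\<^bsub>poly_ring (xs n \<union> ys m)\<^esub> (vanishing_ideal (xs n) X \<union> vanishing_ideal (ys m) Y)"

definition biproj_closed :: "nat \<Rightarrow> nat \<Rightarrow> ('k::field point \<times> 'k point) set \<Rightarrow> bool" where
  "biproj_closed n m W \<longleftrightarrow>
     (\<exists>T. T \<subseteq> polys (xs n \<union> ys m) \<and>
          (\<forall>p\<in>T. \<exists>d e. homogeneous_in (xs n) d p \<and> homogeneous_in (ys m) e p) \<and>
          W = {(P, Q) \<in> proj_space (xs n) \<times> proj_space (ys m).
                 \<forall>u\<in>P. \<forall>w\<in>Q. \<forall>p\<in>T. poly_eval (\<lambda>v. u v + w v) p = 0})"

definition biproj_closure ::
  "nat \<Rightarrow> nat \<Rightarrow> ('k::field point \<times> 'k point) set \<Rightarrow> ('k point \<times> 'k point) set" where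
  "biproj_closure n m W = \<Inter>{C. biproj_closed n m C \<and> W \<subseteq> C}"


section \<open>Rational maps\<close>

text \<open>
  A rational map is given by a tuple \<open>g\<^sub>0, g\<^sub>1, \<dots>\<close> of (bi)homogeneous polynomials of the same
  (bi)degree, representing elements of the coordinate ring that are not all zero. It sends the point
  with coordinates \<open>u\<close> to the point with coordinates \<open>tuple_value C g u\<close>, whenever this is not the
  zero vector; \<open>C\<close> is the set of coordinates of the target. A pair of points with coordinates \<open>u\<close>
  and \<open>w\<close> has bihomogeneous coordinates \<open>\<lambda>v. u v + w v\<close>, as the supports are disjoint.
\<close>

definition tuple_value ::
  "var set \<Rightarrow> (nat \<Rightarrow> 'k::field mpoly) \<Rightarrow> 'k coord_vec \<Rightarrow> 'k coord_vec" where
  "tuple_value C g u = (\<lambda>v. if v \<in> C then poly_eval u (g (snd v)) else 0)"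

definition tuple_defined ::
  "var set \<Rightarrow> (nat \<Rightarrow> 'k::field mpoly) \<Rightarrow> 'k coord_vec \<Rightarrow> bool" where
  "tuple_defined C g u \<longleftrightarrow> (\<exists>v. tuple_value C g u v \<noteq> 0)"

definition rational_map ::
  "var set \<Rightarrow> 'k::field point set \<Rightarrow> var set \<Rightarrow> 'k point set \<Rightarrow> (nat \<Rightarrow> 'k mpoly) \<Rightarrow> bool" where
  "rational_map B Z C W g \<longleftrightarrow>
     (\<exists>d. \<forall>v\<in>C. g (snd v) \<in> polys B \<and> homogeneous_in B d (g (snd v))) \<and>
     (\<exists>v\<in>C. g (snd v) \<notin> vanishing_ideal B Z) \<and>
     (\<forall>P\<in>Z. \<forall>u\<in>P. tuple_defined C g u \<longrightarrow> proj_point C (tuple_value C g u) \<in> W)"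

definition product_rational_map ::
  "nat \<Rightarrow> nat \<Rightarrow> nat \<Rightarrow> 'k::field point set \<Rightarrow> 'k point set \<Rightarrow> 'k point set \<Rightarrow>
     (nat \<Rightarrow> 'k mpoly) \<Rightarrow> bool" where
  "product_rational_map n m s X Y Z f \<longleftrightarrow>
     (\<exists>d e. \<forall>i\<le>s. f i \<in> polys (xs n \<union> ys m) \<and>
        homogeneous_in (xs n) d (f i) \<and> homogeneous_in (ys m) e (f i)) \<and>
     (\<exists>i\<le>s. f i \<notin> product_ideal n m X Y) \<and>
     (\<forall>P\<in>X. \<forall>u\<in>P. \<forall>Q\<in>Y. \<forall>w\<in>Q. tuple_defined (zs s) f (\<lambda>v. u v + w v) \<longrightarrow>
        proj_point (zs s) (tuple_value (zs s) f (\<lambda>v. u v + w v)) \<in> Z)"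

definition dominant ::
  "nat \<Rightarrow> 'k::field point set \<Rightarrow> 'k point set \<Rightarrow> 'k point set \<Rightarrow> (nat \<Rightarrow> 'k mpoly) \<Rightarrow> bool" where
  "dominant s X Y Z f \<longleftrightarrow>
     proj_closure (zs s)
       {proj_point (zs s) (tuple_value (zs s) f (\<lambda>v. u v + w v)) | P Q u w.
          P \<in> X \<and> u \<in> P \<and> Q \<in> Y \<and> w \<in> Q \<and> tuple_defined (zs s) f (\<lambda>v. u v + w v)} = Z"

text \<open>
  Rational maps are equal if they agree wherever both given expressions are defined. The two
  composites below are defined on nonempty open sets when \<open>f\<close> is dominant onto \<open>Z\<close>, because the
  image of \<open>(g, h)\<close> is required to be dense in \<open>X \<times> Y\<close>.
\<close>

definition inverse_pair ::
  "nat \<Rightarrow> nat \<Rightarrow> nat \<Rightarrow> 'k::field point set \<Rightarrow> 'k point set \<Rightarrow> 'k point set \<Rightarrow>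
     (nat \<Rightarrow> 'k mpoly) \<Rightarrow> (nat \<Rightarrow> 'k mpoly) \<Rightarrow> (nat \<Rightarrow> 'k mpoly) \<Rightarrow> bool" where
  "inverse_pair n m s X Y Z f g h \<longleftrightarrow>
     rational_map (zs s) Z (xs n) X g \<and> rational_map (zs s) Z (ys m) Y h \<and>
     biproj_closure n m
       {(proj_point (xs n) (tuple_value (xs n) g t), proj_point (ys m) (tuple_value (ys m) h t)) | t.
          t \<in> \<Union>Z \<and> tuple_defined (xs n) g t \<and> tuple_defined (ys m) h t} = X \<times> Y \<and>
     (\<forall>P\<in>X. \<forall>u\<in>P. \<forall>Q\<in>Y. \<forall>w\<in>Q.
        let t = tuple_value (zs s) f (\<lambda>v. u v + w v) in
          tuple_defined (zs s) f (\<lambda>v. u v + w v) \<longrightarrow>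
          tuple_defined (xs n) g t \<longrightarrow> tuple_defined (ys m) h t \<longrightarrow>
          proj_point (xs n) (tuple_value (xs n) g t) = P \<and>
          proj_point (ys m) (tuple_value (ys m) h t) = Q) \<and>
     (\<forall>T\<in>Z. \<forall>t\<in>T.
        let p = (\<lambda>v. tuple_value (xs n) g t v + tuple_value (ys m) h t v) in
          tuple_defined (xs n) g t \<longrightarrow> tuple_defined (ys m) h t \<longrightarrow>
          tuple_defined (zs s) f p \<longrightarrow>
          proj_point (zs s) (tuple_value (zs s) f p) = T)"

definition birational ::
  "nat \<Rightarrow> nat \<Rightarrow> nat \<Rightarrow> 'k::field point set \<Rightarrow> 'k point set \<Rightarrow> 'k point set \<Rightarrow>
     (nat \<Rightarrow> 'k mpoly) \<Rightarrow> bool" where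
  "birational n m s X Y Z f \<longleftrightarrow>
     dominant s X Y Z f \<and> (\<exists>g h. inverse_pair n m s X Y Z f g h)"


section \<open>Partial Jacobian dual matrices\<close>

definition rees_ideal ::
  "nat \<Rightarrow> nat \<Rightarrow> nat \<Rightarrow> 'k::field point set \<Rightarrow> 'k point set \<Rightarrow> (nat \<Rightarrow> 'k mpoly) \<Rightarrow> 'k mpoly set"
  where
  "rees_ideal n m s X Y f =
     Idl\<^bsub>poly_ring (xs n \<union> ys m \<union> zs s)\<^esub>
       {p \<in> polys (xs n \<union> ys m \<union> zs s).
          (\<exists>a b c. homogeneous_in (xs n) a p \<and> homogeneous_in (ys m) b p \<and>
                   homogeneous_in (zs s) c p) \<and>
          poly_subst (\<lambda>v. if v \<in> zs s then f (snd v) else Var v) p \<in> product_ideal n m X Y}"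

definition rees_ideal_part ::
  "nat \<Rightarrow> nat \<Rightarrow> nat \<Rightarrow> 'k::field point set \<Rightarrow> 'k point set \<Rightarrow> (nat \<Rightarrow> 'k mpoly) \<Rightarrow>
     nat \<Rightarrow> nat \<Rightarrow> 'k mpoly set" where
  "rees_ideal_part n m s X Y f a b =
     {p \<in> rees_ideal n m s X Y f. homogeneous_in (xs n) a p \<and> homogeneous_in (ys m) b p}"

text \<open>A set of generators of an ideal generated by homogeneous elements is minimal if no proper
  subset generates the ideal.\<close>

definition minimal_form_generators ::
  "var set \<Rightarrow> var set \<Rightarrow> 'k::field mpoly set \<Rightarrow> 'k mpoly set \<Rightarrow> bool" where
  "minimal_form_generators V C J G \<longleftrightarrow>
     G \<subseteq> {p \<in> J. \<exists>d. homogeneous_in C d p} \<and>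
     Idl\<^bsub>poly_ring V\<^esub> G = Idl\<^bsub>poly_ring V\<^esub> J \<and>
     (\<forall>G'. G' \<subset> G \<longrightarrow> Idl\<^bsub>poly_ring V\<^esub> G' \<noteq> Idl\<^bsub>poly_ring V\<^esub> J)"

text \<open>The rows of \<open>\<Psi>\<close> are the coefficient vectors of the generators, written as
  \<open>Q\<^sub>0 v\<^sub>0 + \<dots> + Q\<^sub>N v\<^sub>N\<close> with \<open>v\<close> the variables of the block \<open>b\<close>.\<close>

definition coefficient_matrix ::
  "block \<Rightarrow> nat \<Rightarrow> var set \<Rightarrow> 'k::field mpoly list \<Rightarrow> 'k mpoly mat \<Rightarrow> bool" where
  "coefficient_matrix b N C ps \<Psi> \<longleftrightarrow>
     \<Psi> \<in> carrier_mat (length ps) (N + 1) \<and> elements_mat \<Psi> \<subseteq> polys C \<and>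
     (\<forall>i<length ps. ps ! i = (\<Sum>j\<le>N. \<Psi> $$ (i, j) * Var (b, j)))"

definition x_partial_jacobian_dual ::
  "nat \<Rightarrow> nat \<Rightarrow> nat \<Rightarrow> 'k::field point set \<Rightarrow> 'k point set \<Rightarrow> (nat \<Rightarrow> 'k mpoly) \<Rightarrow>
     'k mpoly mat \<Rightarrow> bool" where
  "x_partial_jacobian_dual n m s X Y f \<Psi> \<longleftrightarrow>
     (\<exists>ps. distinct ps \<and>
        minimal_form_generators (xs n \<union> ys m \<union> zs s) (zs s)
          (rees_ideal_part n m s X Y f 1 0) (set ps) \<and>
        coefficient_matrix Bx n (zs s) ps \<Psi>)"

definition y_partial_jacobian_dual ::
  "nat \<Rightarrow> nat \<Rightarrow> nat \<Rightarrow> 'k::field point set \<Rightarrow> 'k point set \<Rightarrow> (nat \<Rightarrow> 'k mpoly) \<Rightarrow>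
     'k mpoly mat \<Rightarrow> bool" where
  "y_partial_jacobian_dual n m s X Y f \<Psi> \<longleftrightarrow>
     (\<exists>ps. distinct ps \<and>
        minimal_form_generators (xs n \<union> ys m \<union> zs s) (zs s)
          (rees_ideal_part n m s X Y f 0 1) (set ps) \<and>
        coefficient_matrix By m (zs s) ps \<Psi>)"

definition signed_minor :: "'a::comm_ring_1 mat \<Rightarrow> nat set \<Rightarrow> nat \<Rightarrow> 'a" where
  "signed_minor \<Psi> I j = (-1) ^ j * det (submatrix \<Psi> I (- {j}))"


section \<open>Rank over an integral domain\<close>

definition frac_rel :: "('a, 'b) ring_scheme \<Rightarrow> (('a \<times> 'a) \<times> ('a \<times> 'a)) set" where
  "frac_rel D =
     {((a, b), (a', b')). a \<in> carrier D \<and> b \<in> carrier D - {\<zero>\<^bsub>D\<^esub>} \<and>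
        a' \<in> carrier D \<and> b' \<in> carrier D - {\<zero>\<^bsub>D\<^esub>} \<and> a \<otimes>\<^bsub>D\<^esub> b' = a' \<otimes>\<^bsub>D\<^esub> b}"

definition frac_of :: "('a, 'b) ring_scheme \<Rightarrow> 'a \<Rightarrow> 'a \<Rightarrow> ('a \<times> 'a) set" where
  "frac_of D a b = frac_rel D `` {(a, b)}"

definition frac_field :: "('a, 'b) ring_scheme \<Rightarrow> ('a \<times> 'a) set ring" where
  "frac_field D =
     \<lparr>carrier = (carrier D \<times> (carrier D - {\<zero>\<^bsub>D\<^esub>})) // frac_rel D,
      monoid.mult = (\<lambda>p q. \<Union>(a, b)\<in>p. \<Union>(c, d)\<in>q. frac_of D (a \<otimes>\<^bsub>D\<^esub> c) (b \<otimes>\<^bsub>D\<^esub> d)),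
      one = frac_of D \<one>\<^bsub>D\<^esub> \<one>\<^bsub>D\<^esub>,
      zero = frac_of D \<zero>\<^bsub>D\<^esub> \<one>\<^bsub>D\<^esub>,
      add = (\<lambda>p q. \<Union>(a, b)\<in>p. \<Union>(c, d)\<in>q.
               frac_of D (a \<otimes>\<^bsub>D\<^esub> d \<oplus>\<^bsub>D\<^esub> c \<otimes>\<^bsub>D\<^esub> b) (b \<otimes>\<^bsub>D\<^esub> d))\<rparr>"

definition rows_independent :: "('a, 'b) ring_scheme \<Rightarrow> 'a mat \<Rightarrow> nat set \<Rightarrow> bool" where
  "rows_independent K M I \<longleftrightarrow>
     (\<forall>a\<in>I \<rightarrow> carrier K.
        (\<forall>j<dim_col M. (\<Oplus>\<^bsub>K\<^esub>i\<in>I. a i \<otimes>\<^bsub>K\<^esub> M $$ (i, j)) = \<zero>\<^bsub>K\<^esub>) \<longrightarrow> (\<forall>i\<in>I. a i = \<zero>\<^bsub>K\<^esub>))"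

definition row_rank :: "('a, 'b) ring_scheme \<Rightarrow> 'a mat \<Rightarrow> nat" where
  "row_rank K M = Max {card I | I. I \<subseteq> {..<dim_row M} \<and> rows_independent K M I}"

definition rank_over_domain :: "('a, 'b) ring_scheme \<Rightarrow> 'a mat \<Rightarrow> nat" where
  "rank_over_domain D M = row_rank (frac_field D) (map_mat (\<lambda>a. frac_of D a \<one>\<^bsub>D\<^esub>) M)"

definition reduce_mat ::
  "var set \<Rightarrow> 'k::field point set \<Rightarrow> 'k mpoly mat \<Rightarrow> 'k mpoly set mat" where
  "reduce_mat B W \<Psi> = map_mat (\<lambda>p. vanishing_ideal B W +>\<^bsub>poly_ring B\<^esub> p) \<Psi>"

end

theory Submission
  imports Defs
begin

text \<open>
  Everything is tested on points. A polynomial in \<open>x\<close>, \<open>y\<close> lies in the ideal defining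
  \<open>A \<otimes> B\<close> iff it vanishes on the cone over \<open>X \<times> Y\<close>, and the cones over \<open>Z\<close> and \<open>X \<times> Y\<close> are
  irreducible, so a rank over \<open>S\<close> is the generic rank on the cone over \<open>Z\<close>. On the graph of the map
  the rows of \<open>\<Psi>\<^sub>x\<close> annihilate \<open>x\<close>, and at each \<open>t\<close> every form \<open>\<Sum> Q\<^sub>j(z) x\<^sub>j\<close> that vanishes on
  the graph depends on the rows of \<open>\<Psi>\<^sub>x(t)\<close>.

  If the map is not dominant, a form \<open>q\<close> that vanishes on the image but not on \<open>Z\<close> gives the relations
  \<open>q x\<^sub>0, \<dots>, q x\<^sub>n\<close>, and the rank is \<open>n + 1\<close>. If it is dominant, the rank is at most \<open>n\<close>, since
  \<open>x \<noteq> 0\<close> is in the kernel. When the rank is \<open>n\<close>, the kernel is spanned by the maximal minors of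
  \<open>n\<close> independent rows, which therefore recover \<open>x\<close> from the image point. Conversely a half \<open>g\<close> of an
  inverse gives the relations \<open>g\<^sub>j x\<^sub>i - g\<^sub>i x\<^sub>j\<close>, of rank \<open>n\<close>.
\<close>

section \<open>Evaluation and substitution\<close>

text \<open>What is known about \<open>\<Psi>\<close> concerns its kernel: a relation of the graph
  is tested against vectors \<open>v\<close> killed by the rows at a point \<open>t\<close>. This
  makes columns independent, whereas the rank counts independent rows; a nonvanishing minor converts
  one into the other. The rank is measured on the cone over \<open>Z\<close>, but the geometry is
  known at image points. Each row is homogeneous of its own degree, so a minor is a form, and for a
  dominant map a form that is nonzero somewhere on \<open>Z\<close> is nonzero at some image point.
  Minors thus carry independence from \<open>Z\<close> to the graph. Identities between rational
  maps hold only where all expressions are defined. They are written as polynomial identities on the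
  cone over \<open>X \<times> Y\<close> and multiplied by polynomials whose nonvanishing ensures
  definedness; irreducibility of the cone then cancels these factors. The factors and identities are
  arbitrary polynomials, while varieties are cut out by forms; the gap is bridged by restricting
  polynomials to lines through the origin, over a field that is infinite because it is algebraically
  closed.\<close>

lemma prod_power_keys:
  fixes u :: "var \<Rightarrow> 'a::comm_semiring_1"
  assumes "finite A" "Poly_Mapping.keys \<mu> \<subseteq> A"
  shows "(\<Prod>v\<in>Poly_Mapping.keys \<mu>. u v ^ Poly_Mapping.lookup \<mu> v) = (\<Prod>v\<in>A. u v ^ Poly_Mapping.lookup \<mu> v)"
  by (rule prod.mono_neutral_left) (use assms in \<open>auto simp: in_keys_iff\<close>)

lemma prod_power_keys_add:
  fixes u :: "var \<Rightarrow> 'a::comm_semiring_1"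
  shows "(\<Prod>v\<in>Poly_Mapping.keys (\<mu> + \<nu>). u v ^ Poly_Mapping.lookup (\<mu> + \<nu>) v) =
    (\<Prod>v\<in>Poly_Mapping.keys \<mu>. u v ^ Poly_Mapping.lookup \<mu> v) * (\<Prod>v\<in>Poly_Mapping.keys \<nu>. u v ^ Poly_Mapping.lookup \<nu> v)"
proof -
  let ?A = "Poly_Mapping.keys \<mu> \<union> Poly_Mapping.keys \<nu>"
  have "(\<Prod>v\<in>Poly_Mapping.keys (\<mu> + \<nu>). u v ^ Poly_Mapping.lookup (\<mu> + \<nu>) v) = (\<Prod>v\<in>?A. u v ^ Poly_Mapping.lookup (\<mu> + \<nu>) v)"
    by (rule prod_power_keys) (auto simp: keys_add)
  also have "\<dots> = (\<Prod>v\<in>?A. u v ^ Poly_Mapping.lookup \<mu> v) * (\<Prod>v\<in>?A. u v ^ Poly_Mapping.lookup \<nu> v)"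
    by (simp add: lookup_add power_add prod.distrib)
  finally show ?thesis
    using prod_power_keys[of ?A \<mu> u] prod_power_keys[of ?A \<nu> u] by simp
qed

lemma poly_mapping_sum_single: "(\<Sum>\<mu>\<in>Poly_Mapping.keys p. Poly_Mapping.single \<mu> (Poly_Mapping.lookup p \<mu>)) = p"
  by (rule poly_mapping_eqI)
     (auto simp: lookup_sum lookup_single when_def in_keys_iff sum.delta' cong: if_cong)

text \<open>A common form of \<open>poly_eval\<close> and \<open>poly_subst\<close>, with
  coefficient map the identity or \<open>Const\<close>, so that the homomorphism laws are proved
  once for both.\<close>

definition insertion :: "('k \<Rightarrow> 'a) \<Rightarrow> (var \<Rightarrow> 'a) \<Rightarrow> 'k::comm_ring_1 mpoly \<Rightarrow> 'a::comm_ring_1" where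
  "insertion \<phi> u p = (\<Sum>\<mu>\<in>Poly_Mapping.keys p. \<phi> (Poly_Mapping.lookup p \<mu>) * (\<Prod>v\<in>Poly_Mapping.keys \<mu>. u v ^ Poly_Mapping.lookup \<mu> v))"

context comm_ring_hom
begin

lemma insertion_superset:
  assumes "finite A" "Poly_Mapping.keys p \<subseteq> A"
  shows "insertion hom u p = (\<Sum>\<mu>\<in>A. hom (Poly_Mapping.lookup p \<mu>) * (\<Prod>v\<in>Poly_Mapping.keys \<mu>. u v ^ Poly_Mapping.lookup \<mu> v))"
  unfolding insertion_def
  by (rule sum.mono_neutral_left) (use assms in \<open>auto simp: in_keys_iff\<close>)

lemma insertion_zero: "insertion hom u 0 = 0"
  by (simp add: insertion_def)

lemma insertion_single:
  "insertion hom u (Poly_Mapping.single \<mu> c) = hom c * (\<Prod>v\<in>Poly_Mapping.keys \<mu>. u v ^ Poly_Mapping.lookup \<mu> v)"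
  by (subst insertion_superset[of "{\<mu>}"]) auto

lemma insertion_add: "insertion hom u (p + q) = insertion hom u p + insertion hom u q"
proof -
  let ?A = "Poly_Mapping.keys p \<union> Poly_Mapping.keys q"
  have "Poly_Mapping.keys (p + q) \<subseteq> ?A" by (rule keys_add)
  then show ?thesis
    by (simp add: insertion_superset[of ?A] lookup_add hom_add distrib_right sum.distrib)
qed

lemma insertion_sum: "insertion hom u (\<Sum>i\<in>I. p i) = (\<Sum>i\<in>I. insertion hom u (p i))"
  by (induction I rule: infinite_finite_induct) (auto simp: insertion_zero insertion_add)

lemma insertion_mult: "insertion hom u (p * q) = insertion hom u p * insertion hom u q"
proof -
  let ?s = "\<lambda>p \<mu>. Poly_Mapping.single \<mu> (Poly_Mapping.lookup p \<mu>)"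
  have "p * q = (\<Sum>\<mu>\<in>Poly_Mapping.keys p. \<Sum>\<nu>\<in>Poly_Mapping.keys q. ?s p \<mu> * ?s q \<nu>)"
    by (simp only: sum_product [symmetric] poly_mapping_sum_single)
  also have "insertion hom u \<dots> = (\<Sum>\<mu>\<in>Poly_Mapping.keys p. \<Sum>\<nu>\<in>Poly_Mapping.keys q. insertion hom u (?s p \<mu>) * insertion hom u (?s q \<nu>))"
    unfolding insertion_sum
    by (intro sum.cong refl)
       (simp add: mult_single insertion_single prod_power_keys_add hom_mult mult_ac)
  also have "\<dots> = insertion hom u (\<Sum>\<mu>\<in>Poly_Mapping.keys p. ?s p \<mu>) * insertion hom u (\<Sum>\<mu>\<in>Poly_Mapping.keys q. ?s q \<mu>)"
    by (simp only: sum_product insertion_sum)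
  finally show ?thesis by (simp only: poly_mapping_sum_single)
qed

lemma insertion_comm_ring_hom: "comm_ring_hom (insertion hom u)"
proof
  show "insertion hom u 1 = 1"
    using insertion_single[of u 0 1] by simp
qed (simp_all add: insertion_zero insertion_add insertion_mult)

end

lemma id_comm_ring_hom: "comm_ring_hom (\<lambda>x. x)"
  by unfold_locales auto

lemma Const_comm_ring_hom: "comm_ring_hom Const"
  by unfold_locales (auto simp: Const_def single_add mult_single)

lemma poly_eval_insertion: "poly_eval u = insertion (\<lambda>x. x) u"
  by (simp add: poly_eval_def insertion_def fun_eq_iff)

lemma poly_subst_insertion: "poly_subst \<sigma> = insertion Const \<sigma>"
  by (simp add: poly_subst_def insertion_def fun_eq_iff)

interpretation poly_eval: comm_ring_hom "poly_eval u" for u :: "var \<Rightarrow> 'k::comm_ring_1"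
  unfolding poly_eval_insertion
  by (rule comm_ring_hom.insertion_comm_ring_hom[OF id_comm_ring_hom])

interpretation poly_subst: comm_ring_hom "poly_subst \<sigma>" for \<sigma> :: "var \<Rightarrow> 'k::comm_ring_1 mpoly"
  unfolding poly_subst_insertion
  by (rule comm_ring_hom.insertion_comm_ring_hom[OF Const_comm_ring_hom])

lemma poly_eval_single:
  "poly_eval u (Poly_Mapping.single \<mu> c) = c * (\<Prod>v\<in>Poly_Mapping.keys \<mu>. u v ^ Poly_Mapping.lookup \<mu> v)"
  unfolding poly_eval_insertion by (rule comm_ring_hom.insertion_single[OF id_comm_ring_hom])

lemma poly_eval_Const [simp]: "poly_eval u (Const c) = c"
  by (simp add: Const_def poly_eval_single)

lemma poly_eval_Var [simp]: "poly_eval u (Var v) = u v"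
  by (simp add: Var_def poly_eval_single)

lemma poly_eval_subst: "poly_eval u (poly_subst \<sigma> p) = poly_eval (\<lambda>v. poly_eval u (\<sigma> v)) p"
  by (simp add: poly_subst_def poly_eval.hom_sum poly_eval.hom_mult poly_eval.hom_prod
      poly_eval.hom_power poly_eval_def[of "\<lambda>v. poly_eval u (\<sigma> v)"])

lemma poly_eval_cong:
  assumes "p \<in> polys V" "\<And>v. v \<in> V \<Longrightarrow> u v = w v"
  shows "poly_eval u p = poly_eval w p"
  unfolding poly_eval_def
  by (intro sum.cong prod.cong refl arg_cong2[where f = "(*)"] arg_cong2[where f = "(^)"])
     (use assms in \<open>auto simp: polys_def\<close>)

section \<open>Polynomials in a set of variables\<close>

lemma polys_mono: "V \<subseteq> W \<Longrightarrow> polys V \<subseteq> polys W"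
  by (auto simp: polys_def)

lemma polys_zero [simp]: "0 \<in> polys V" and polys_one [simp]: "1 \<in> polys V"
  and polys_Const [simp]: "Const c \<in> polys V"
  by (auto simp: polys_def Const_def)

lemma polys_Var: "v \<in> V \<Longrightarrow> Var v \<in> polys V"
  by (auto simp: polys_def Var_def)

lemma polys_add: "p \<in> polys V \<Longrightarrow> q \<in> polys V \<Longrightarrow> p + q \<in> polys V"
  using keys_add[of p q] by (auto simp: polys_def)

lemma polys_mult:
  assumes "p \<in> polys V" "q \<in> polys V"
  shows "p * q \<in> polys V"
  unfolding polys_def
proof (rule CollectI, rule ballI)
  fix \<mu> assume "\<mu> \<in> Poly_Mapping.keys (p * q)"
  then obtain \<alpha> \<beta> where "\<mu> = \<alpha> + \<beta>" "\<alpha> \<in> Poly_Mapping.keys p" "\<beta> \<in> Poly_Mapping.keys q"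
    using keys_mult[of p q] by blast
  moreover from this have "Poly_Mapping.keys \<alpha> \<subseteq> V" "Poly_Mapping.keys \<beta> \<subseteq> V"
    using assms by (auto simp: polys_def)
  ultimately show "Poly_Mapping.keys \<mu> \<subseteq> V"
    using keys_add[of \<alpha> \<beta>] by blast
qed

lemma polys_uminus: "p \<in> polys V \<Longrightarrow> - p \<in> polys V"
  by (auto simp: polys_def)

lemma polys_diff: "p \<in> polys V \<Longrightarrow> q \<in> polys V \<Longrightarrow> p - q \<in> polys V"
  for p :: "'k::comm_ring_1 mpoly"
  using polys_add[of p V "- q"] polys_uminus by force

lemma polys_sum: "(\<And>i. i \<in> I \<Longrightarrow> p i \<in> polys V) \<Longrightarrow> (\<Sum>i\<in>I. p i) \<in> polys V"
  by (induction I rule: infinite_finite_induct) (auto intro: polys_add)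

lemma polys_prod: "(\<And>i. i \<in> I \<Longrightarrow> p i \<in> polys V) \<Longrightarrow> (\<Prod>i\<in>I. p i) \<in> polys V"
  by (induction I rule: infinite_finite_induct) (auto intro: polys_mult)

lemma polys_power: "p \<in> polys V \<Longrightarrow> p ^ k \<in> polys V"
  by (induction k) (auto intro: polys_mult)

lemma polys_subst:
  assumes "p \<in> polys V" "\<And>v. v \<in> V \<Longrightarrow> \<sigma> v \<in> polys W"
  shows "poly_subst \<sigma> p \<in> polys W"
  unfolding poly_subst_def
proof (intro polys_sum polys_mult polys_Const polys_prod polys_power)
  fix \<mu> v assume "\<mu> \<in> Poly_Mapping.keys p" "v \<in> Poly_Mapping.keys \<mu>"
  then show "\<sigma> v \<in> polys W" using assms(1) by (intro assms(2)) (auto simp: polys_def)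
qed

lemma polys_signof: "signof \<pi> \<in> polys V"
  by (simp add: sign_def polys_uminus)

lemma polys_det:
  assumes "A \<in> carrier_mat k k" "\<And>i j. i < k \<Longrightarrow> j < k \<Longrightarrow> A $$ (i, j) \<in> polys V"
  shows "det A \<in> polys V"
  unfolding det_def'[OF assms(1)]
proof (intro polys_sum polys_mult polys_prod polys_signof)
  fix \<pi> i assume "\<pi> \<in> {\<pi>. \<pi> permutes {0..<k}}" "i \<in> {0..<k}"
  then show "A $$ (i, \<pi> i) \<in> polys V"
    using permutes_in_image[of \<pi> "{0..<k}" i] by (intro assms(2)) auto
qed

text \<open>Sends the variables outside \<open>V\<close> to 0. Statements about cones quantify over
  polynomials in all variables, whereas ideals live in \<open>polys V\<close>; on vectors supported
  in \<open>V\<close> the restriction has the same values.\<close>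

definition restrict_vars :: "var set \<Rightarrow> 'k::comm_ring_1 mpoly \<Rightarrow> 'k mpoly" where
  "restrict_vars V = poly_subst (\<lambda>v. if v \<in> V then Var v else 0)"

lemma restrict_vars_polys: "restrict_vars V p \<in> polys V"
  unfolding restrict_vars_def by (rule polys_subst[of _ UNIV]) (auto simp: polys_def[of UNIV] polys_Var)

lemma poly_eval_restrict_vars:
  "(\<And>v. v \<notin> V \<Longrightarrow> u v = 0) \<Longrightarrow> poly_eval u (restrict_vars V p) = poly_eval u p"
  unfolding restrict_vars_def poly_eval_subst
  by (rule arg_cong[where f = "\<lambda>u. poly_eval u p"]) auto

lemma poly_ring_simps [simp]:
  "carrier (poly_ring V) = polys V" "x \<otimes>\<^bsub>poly_ring V\<^esub> y = x * y" "\<one>\<^bsub>poly_ring V\<^esub> = 1"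
  "\<zero>\<^bsub>poly_ring V\<^esub> = 0" "x \<oplus>\<^bsub>poly_ring V\<^esub> y = x + y"
  by (simp_all add: poly_ring_def)

lemma poly_ring_cring: "cring (poly_ring V :: 'k::comm_ring_1 mpoly ring)"
proof (rule cringI)
  show "abelian_group (poly_ring V :: 'k mpoly ring)"
    by (rule abelian_groupI) (auto simp: polys_add add_ac intro: bexI[of _ "- _"] polys_uminus)
  show "comm_monoid (poly_ring V :: 'k mpoly ring)"
    by (rule comm_monoidI) (auto simp: polys_mult mult_ac)
qed (auto simp: distrib_right)

lemma poly_ring_a_inv: "p \<in> polys V \<Longrightarrow> \<ominus>\<^bsub>poly_ring V\<^esub> p = - p"
  for p :: "'k::comm_ring_1 mpoly"
proof -
  interpret cring "poly_ring V :: 'k mpoly ring" by (rule poly_ring_cring)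
  show "p \<in> polys V \<Longrightarrow> \<ominus>\<^bsub>poly_ring V\<^esub> p = - p"
    using minus_equality[of "- p" p] by (simp add: polys_uminus)
qed

lemma poly_ring_finsum:
  fixes p :: "'i \<Rightarrow> 'k::comm_ring_1 mpoly"
  assumes "finite I" "\<And>i. i \<in> I \<Longrightarrow> p i \<in> polys V"
  shows "(\<Oplus>\<^bsub>poly_ring V\<^esub>i\<in>I. p i) = (\<Sum>i\<in>I. p i)"
proof -
  interpret cring "poly_ring V :: 'k mpoly ring" by (rule poly_ring_cring)
  show ?thesis using assms
    by (induction I) (auto simp: finsum_insert Pi_def)
qed

lemma poly_ring_idealI:
  fixes I :: "'k::comm_ring_1 mpoly set"
  assumes "I \<subseteq> polys V" "0 \<in> I" "\<And>p q. p \<in> I \<Longrightarrow> q \<in> I \<Longrightarrow> p + q \<in> I"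
    "\<And>p q. p \<in> I \<Longrightarrow> q \<in> polys V \<Longrightarrow> q * p \<in> I"
  shows "ideal I (poly_ring V)"
proof -
  interpret cring "poly_ring V :: 'k mpoly ring" by (rule poly_ring_cring)
  have neg: "- p \<in> I" if "p \<in> I" for p
    using assms(4)[OF that, of "- 1"] polys_uminus[OF polys_one, of V] by simp
  show ?thesis
  proof (rule idealI[OF ring_axioms])
    show "subgroup I (add_monoid (poly_ring V))"
    proof (rule add.subgroupI)
      show "\<ominus>\<^bsub>poly_ring V\<^esub> a \<in> I" if "a \<in> I" for a
        using poly_ring_a_inv[of a V] neg[OF that] that assms(1) by auto
    qed (use assms in auto)
  qed (use assms in \<open>auto simp: mult.commute\<close>)
qed

lemma vanishing_ideal_of_points:
  fixes T :: "'k::comm_ring_1 coord_vec set"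
  shows "ideal {p \<in> polys V. \<forall>t\<in>T. poly_eval t p = 0} (poly_ring V)"
  by (rule poly_ring_idealI)
     (auto intro: polys_add polys_mult simp: poly_eval.hom_add poly_eval.hom_mult)

text \<open>The polynomials vanishing on \<open>T\<close> form an ideal containing \<open>G\<close>,
  hence contain the ideal generated by \<open>G\<close>. This is how ideal membership is read off on
  points.\<close>

lemma genideal_vanishes:
  fixes G :: "'k::comm_ring_1 mpoly set"
  assumes "p \<in> Idl\<^bsub>poly_ring V\<^esub> G" "G \<subseteq> polys V" "\<And>q t. q \<in> G \<Longrightarrow> t \<in> T \<Longrightarrow> poly_eval t q = 0"
  shows "p \<in> polys V" "t \<in> T \<Longrightarrow> poly_eval t p = 0"
proof -
  interpret cring "poly_ring V :: 'k mpoly ring" by (rule poly_ring_cring)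
  have "Idl\<^bsub>poly_ring V\<^esub> G \<subseteq> {p \<in> polys V. \<forall>t\<in>T. poly_eval t p = 0}"
    by (rule genideal_minimal[OF vanishing_ideal_of_points]) (use assms in auto)
  with assms(1) show "p \<in> polys V" "t \<in> T \<Longrightarrow> poly_eval t p = 0" by auto
qed

lemma mem_genideal:
  fixes G :: "'k::comm_ring_1 mpoly set"
  assumes "G \<subseteq> polys V" "p \<in> G"
  shows "p \<in> Idl\<^bsub>poly_ring V\<^esub> G"
proof -
  interpret cring "poly_ring V :: 'k mpoly ring" by (rule poly_ring_cring)
  show ?thesis using genideal_self[of G] assms by auto
qed

text \<open>Variables are pairs of a block and an index; without this the simplifier would split
  every quantifier over variables into two.\<close>

declare split_paired_All [simp del] split_paired_Ex [simp del]

section \<open>Homogeneity\<close>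

definition block_degree :: "var set \<Rightarrow> (var \<Rightarrow>\<^sub>0 nat) \<Rightarrow> nat" where
  "block_degree B \<mu> = (\<Sum>v\<in>Poly_Mapping.keys \<mu> \<inter> B. Poly_Mapping.lookup \<mu> v)"

lemma homogeneous_in_iff:
  "homogeneous_in B d p \<longleftrightarrow> (\<forall>\<mu>\<in>Poly_Mapping.keys p. block_degree B \<mu> = d)"
  by (simp add: homogeneous_in_def block_degree_def)

lemma block_degree_superset:
  assumes "finite A" "Poly_Mapping.keys \<mu> \<subseteq> A"
  shows "block_degree B \<mu> = (\<Sum>v\<in>A \<inter> B. Poly_Mapping.lookup \<mu> v)"
  unfolding block_degree_def
  by (rule sum.mono_neutral_left) (use assms in \<open>auto simp: in_keys_iff\<close>)

lemma block_degree_add: "block_degree B (\<mu> + \<nu>) = block_degree B \<mu> + block_degree B \<nu>"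
proof -
  let ?A = "Poly_Mapping.keys \<mu> \<union> Poly_Mapping.keys \<nu>"
  have "Poly_Mapping.keys (\<mu> + \<nu>) \<subseteq> ?A" by (rule keys_add)
  then show ?thesis
    by (simp add: block_degree_superset[of ?A] lookup_add sum.distrib)
qed

lemma homogeneous_in_zero [simp]: "homogeneous_in B d 0"
  by (simp add: homogeneous_in_def)

lemma homogeneous_in_Const [simp]: "homogeneous_in B 0 (Const c)"
  by (simp add: homogeneous_in_def Const_def)

lemma homogeneous_in_one [simp]: "homogeneous_in B 0 1"
  by (simp add: homogeneous_in_def)

lemma homogeneous_in_Var: "homogeneous_in B (if v \<in> B then 1 else 0) (Var v)"
  by (simp add: homogeneous_in_def Var_def)

lemma homogeneous_in_add:
  "homogeneous_in B d p \<Longrightarrow> homogeneous_in B d q \<Longrightarrow> homogeneous_in B d (p + q)"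
  using keys_add[of p q] by (auto simp: homogeneous_in_iff)

lemma homogeneous_in_uminus: "homogeneous_in B d p \<Longrightarrow> homogeneous_in B d (- p)"
  by (auto simp: homogeneous_in_iff)

lemma homogeneous_in_diff:
  "homogeneous_in B d p \<Longrightarrow> homogeneous_in B d q \<Longrightarrow> homogeneous_in B d (p - q)"
  for p :: "'k::comm_ring_1 mpoly"
  using homogeneous_in_add[of B d p "- q"] homogeneous_in_uminus by force

lemma homogeneous_in_mult:
  assumes "homogeneous_in B d p" "homogeneous_in B e q"
  shows "homogeneous_in B (d + e) (p * q)"
  unfolding homogeneous_in_iff
proof
  fix \<mu> assume "\<mu> \<in> Poly_Mapping.keys (p * q)"
  then obtain \<alpha> \<beta> where "\<mu> = \<alpha> + \<beta>" "\<alpha> \<in> Poly_Mapping.keys p" "\<beta> \<in> Poly_Mapping.keys q"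
    using keys_mult[of p q] by blast
  with assms show "block_degree B \<mu> = d + e"
    by (simp add: block_degree_add homogeneous_in_iff)
qed

lemma homogeneous_in_sum:
  "(\<And>i. i \<in> I \<Longrightarrow> homogeneous_in B d (p i)) \<Longrightarrow> homogeneous_in B d (\<Sum>i\<in>I. p i)"
  by (induction I rule: infinite_finite_induct) (auto intro: homogeneous_in_add)

lemma homogeneous_in_prod:
  "(\<And>i. i \<in> I \<Longrightarrow> homogeneous_in B (d i) (p i)) \<Longrightarrow> homogeneous_in B (\<Sum>i\<in>I. d i) (\<Prod>i\<in>I. p i)"
  by (induction I rule: infinite_finite_induct) (auto intro: homogeneous_in_mult)

lemma homogeneous_in_power:
  "homogeneous_in B d p \<Longrightarrow> homogeneous_in B (d * k) (p ^ k)"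
  by (induction k) (auto intro: homogeneous_in_mult)

text \<open>A weighted degree count: \<open>wt v\<close> is the degree of what replaces
  \<open>v\<close>. The three substitution rules that follow are choices of weights: one constant,
  one constant per block, or the indicator of \<open>C\<close>.\<close>

lemma homogeneous_in_subst:
  assumes "p \<in> polys V" "\<And>v. v \<in> V \<Longrightarrow> homogeneous_in C (wt v) (\<sigma> v)"
    and "\<And>\<mu>. \<mu> \<in> Poly_Mapping.keys p \<Longrightarrow>
      (\<Sum>v\<in>Poly_Mapping.keys \<mu>. wt v * Poly_Mapping.lookup \<mu> v) = d"
  shows "homogeneous_in C d (poly_subst \<sigma> p)"
  unfolding poly_subst_def
proof (rule homogeneous_in_sum)
  fix \<mu> assume \<mu>: "\<mu> \<in> Poly_Mapping.keys p"
  then have "homogeneous_in C (\<Sum>v\<in>Poly_Mapping.keys \<mu>. wt v * Poly_Mapping.lookup \<mu> v)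
      (\<Prod>v\<in>Poly_Mapping.keys \<mu>. \<sigma> v ^ Poly_Mapping.lookup \<mu> v)"
    using assms(1) by (intro homogeneous_in_prod homogeneous_in_power assms(2)) (auto simp: polys_def)
  from homogeneous_in_mult[OF homogeneous_in_Const this] \<mu>
  show "homogeneous_in C d (Const (Poly_Mapping.lookup p \<mu>) *
      (\<Prod>v\<in>Poly_Mapping.keys \<mu>. \<sigma> v ^ Poly_Mapping.lookup \<mu> v))"
    by (simp add: assms(3))
qed

lemma homogeneous_in_subst_forms:
  assumes "p \<in> polys B" "homogeneous_in B d p" "\<And>v. v \<in> B \<Longrightarrow> homogeneous_in C e (\<sigma> v)"
  shows "homogeneous_in C (e * d) (poly_subst \<sigma> p)"
proof (rule homogeneous_in_subst[OF assms(1,3)])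
  fix \<mu> assume "\<mu> \<in> Poly_Mapping.keys p"
  moreover from this have "Poly_Mapping.keys \<mu> \<inter> B = Poly_Mapping.keys \<mu>"
    using assms(1) by (auto simp: polys_def)
  ultimately show "(\<Sum>v\<in>Poly_Mapping.keys \<mu>. e * Poly_Mapping.lookup \<mu> v) = e * d"
    using assms(2) by (auto simp: homogeneous_in_def simp flip: sum_distrib_left)
qed

lemma homogeneous_in_subst_two_blocks:
  assumes "p \<in> polys (B1 \<union> B2)" "B1 \<inter> B2 = {}" "homogeneous_in B1 d1 p" "homogeneous_in B2 d2 p"
    and "\<And>v. v \<in> B1 \<Longrightarrow> homogeneous_in C e1 (\<sigma> v)" "\<And>v. v \<in> B2 \<Longrightarrow> homogeneous_in C e2 (\<sigma> v)"
  shows "homogeneous_in C (e1 * d1 + e2 * d2) (poly_subst \<sigma> p)"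
proof (rule homogeneous_in_subst[OF assms(1), where wt = "\<lambda>v. if v \<in> B1 then e1 else e2"])
  fix \<mu> assume \<mu>: "\<mu> \<in> Poly_Mapping.keys p"
  let ?l = "Poly_Mapping.lookup \<mu>" and ?K = "Poly_Mapping.keys \<mu>"
  have K: "?K = (?K \<inter> B1) \<union> (?K \<inter> B2)"
    using assms(1) \<mu> by (auto simp: polys_def)
  have "(\<Sum>v\<in>?K. (if v \<in> B1 then e1 else e2) * ?l v) =
      (\<Sum>v\<in>?K \<inter> B1. (if v \<in> B1 then e1 else e2) * ?l v) +
      (\<Sum>v\<in>?K \<inter> B2. (if v \<in> B1 then e1 else e2) * ?l v)"
    by (subst K, rule sum.union_disjoint) (use assms(2) in auto)
  also have "\<dots> = (\<Sum>v\<in>?K \<inter> B1. e1 * ?l v) + (\<Sum>v\<in>?K \<inter> B2. e2 * ?l v)"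
    by (intro arg_cong2[where f = "(+)"] sum.cong) (use assms(2) in auto)
  also have "\<dots> = e1 * d1 + e2 * d2"
    using assms(3,4) \<mu> by (simp add: homogeneous_in_def flip: sum_distrib_left)
  finally show "(\<Sum>v\<in>?K. (if v \<in> B1 then e1 else e2) * ?l v) = e1 * d1 + e2 * d2" .
qed (use assms(5,6) in auto)

lemma homogeneous_in_subst_keep:
  assumes "homogeneous_in C d p" "\<And>v. homogeneous_in C (if v \<in> C then 1 else 0) (\<sigma> v)"
  shows "homogeneous_in C d (poly_subst \<sigma> p)"
proof (rule homogeneous_in_subst[of _ UNIV, OF _ assms(2)])
  fix \<mu> assume \<mu>: "\<mu> \<in> Poly_Mapping.keys p"
  have "(\<Sum>v\<in>Poly_Mapping.keys \<mu>. (if v \<in> C then 1 else 0) * Poly_Mapping.lookup \<mu> v) =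
      (\<Sum>v\<in>Poly_Mapping.keys \<mu> \<inter> C. Poly_Mapping.lookup \<mu> v)"
    by (simp add: sum.inter_restrict if_distrib[of "\<lambda>x. x * _"] cong: if_cong)
  with assms(1) \<mu>
  show "(\<Sum>v\<in>Poly_Mapping.keys \<mu>. (if v \<in> C then 1 else 0) * Poly_Mapping.lookup \<mu> v) = d"
    by (simp add: homogeneous_in_def)
qed (simp add: polys_def)

text \<open>The degree of an entry depends on its row alone, and each Leibniz term takes one entry
  from every row, so all terms have the same degree.\<close>

lemma homogeneous_in_det:
  assumes "A \<in> carrier_mat k k" "\<And>i j. i < k \<Longrightarrow> j < k \<Longrightarrow> homogeneous_in B (d i) (A $$ (i, j))"
  shows "homogeneous_in B (\<Sum>i<k. d i) (det A)"
  unfolding det_def'[OF assms(1)]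
proof (rule homogeneous_in_sum)
  fix \<pi> assume \<pi>: "\<pi> \<in> {\<pi>. \<pi> permutes {0..<k}}"
  have "homogeneous_in B (\<Sum>i = 0..<k. d i) (\<Prod>i = 0..<k. A $$ (i, \<pi> i))"
    by (rule homogeneous_in_prod, rule assms(2))
       (use \<pi> permutes_in_image[of \<pi> "{0..<k}"] in auto)
  then show "homogeneous_in B (\<Sum>i<k. d i) (signof \<pi> * (\<Prod>i = 0..<k. A $$ (i, \<pi> i)))"
    by (simp add: sign_def homogeneous_in_uminus atLeast0LessThan)
qed

lemma poly_eval_scale:
  assumes "p \<in> polys B" "homogeneous_in B d p"
  shows "poly_eval (\<lambda>v. c * u v) p = c ^ d * poly_eval u p"
  unfolding poly_eval_def sum_distrib_left
proof (rule sum.cong[OF refl])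
  fix \<mu> assume "\<mu> \<in> Poly_Mapping.keys p"
  moreover from this have "Poly_Mapping.keys \<mu> \<inter> B = Poly_Mapping.keys \<mu>"
    using assms(1) by (auto simp: polys_def)
  ultimately have "(\<Sum>v\<in>Poly_Mapping.keys \<mu>. Poly_Mapping.lookup \<mu> v) = d"
    using assms(2) by (auto simp: homogeneous_in_def)
  then show "Poly_Mapping.lookup p \<mu> * (\<Prod>v\<in>Poly_Mapping.keys \<mu>. (c * u v) ^ Poly_Mapping.lookup \<mu> v) =
      c ^ d * (Poly_Mapping.lookup p \<mu> * (\<Prod>v\<in>Poly_Mapping.keys \<mu>. u v ^ Poly_Mapping.lookup \<mu> v))"
    by (simp add: power_mult_distrib prod.distrib flip: power_sum)
qed

lemma poly_eval_scale_two_blocks: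
  assumes "p \<in> polys (B1 \<union> B2)" "B1 \<inter> B2 = {}" "homogeneous_in B1 d1 p" "homogeneous_in B2 d2 p"
  shows "poly_eval (\<lambda>v. (if v \<in> B1 then c1 else c2) * u v) p = c1 ^ d1 * c2 ^ d2 * poly_eval u p"
  unfolding poly_eval_def sum_distrib_left
proof (rule sum.cong[OF refl])
  fix \<mu> assume \<mu>: "\<mu> \<in> Poly_Mapping.keys p"
  let ?l = "Poly_Mapping.lookup \<mu>" and ?K = "Poly_Mapping.keys \<mu>"
  have K: "?K = (?K \<inter> B1) \<union> (?K \<inter> B2)"
    using assms(1) \<mu> by (auto simp: polys_def)
  have "(\<Prod>v\<in>?K. (if v \<in> B1 then c1 else c2) ^ ?l v) =
      (\<Prod>v\<in>?K \<inter> B1. (if v \<in> B1 then c1 else c2) ^ ?l v) *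
      (\<Prod>v\<in>?K \<inter> B2. (if v \<in> B1 then c1 else c2) ^ ?l v)"
    by (subst K, rule prod.union_disjoint) (use assms(2) in auto)
  also have "\<dots> = (\<Prod>v\<in>?K \<inter> B1. c1 ^ ?l v) * (\<Prod>v\<in>?K \<inter> B2. c2 ^ ?l v)"
    by (intro arg_cong2[where f = "(*)"] prod.cong) (use assms(2) in auto)
  also have "\<dots> = c1 ^ d1 * c2 ^ d2"
    using assms(3,4) \<mu> by (simp add: homogeneous_in_def flip: power_sum)
  finally show "Poly_Mapping.lookup p \<mu> * (\<Prod>v\<in>?K. ((if v \<in> B1 then c1 else c2) * u v) ^ ?l v) =
      c1 ^ d1 * c2 ^ d2 * (Poly_Mapping.lookup p \<mu> * (\<Prod>v\<in>?K. u v ^ ?l v))"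
    by (simp add: power_mult_distrib prod.distrib)
qed

section \<open>Homogeneous components and restriction to lines through the origin\<close>

definition homogeneous_part :: "var set \<Rightarrow> nat \<Rightarrow> 'k::comm_ring_1 mpoly \<Rightarrow> 'k mpoly" where
  "homogeneous_part B d p =
    (\<Sum>\<mu> | \<mu> \<in> Poly_Mapping.keys p \<and> block_degree B \<mu> = d. Poly_Mapping.single \<mu> (Poly_Mapping.lookup p \<mu>))"

lemma homogeneous_part_homogeneous: "homogeneous_in B d (homogeneous_part B d p)"
  unfolding homogeneous_part_def
  by (rule homogeneous_in_sum) (auto simp: homogeneous_in_iff)

lemma homogeneous_part_polys: "p \<in> polys V \<Longrightarrow> homogeneous_part B d p \<in> polys V"
  unfolding homogeneous_part_def
  by (rule polys_sum) (auto simp: polys_def)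

text \<open>The restriction of \<open>p\<close> to the line through \<open>0\<close> and \<open>u\<close>.\<close>

definition line_poly :: "var set \<Rightarrow> (var \<Rightarrow> 'k) \<Rightarrow> 'k::comm_ring_1 mpoly \<Rightarrow> 'k poly" where
  "line_poly B u p = (\<Sum>\<mu>\<in>Poly_Mapping.keys p.
     monom (poly_eval u (Poly_Mapping.single \<mu> (Poly_Mapping.lookup p \<mu>))) (block_degree B \<mu>))"

lemma coeff_line_poly: "coeff (line_poly B u p) d = poly_eval u (homogeneous_part B d p)"
  unfolding line_poly_def homogeneous_part_def
  by (simp add: coeff_sum poly_eval.hom_sum sum.inter_filter [symmetric] cong: if_cong)

lemma poly_line_poly:
  assumes "p \<in> polys B"
  shows "poly (line_poly B u p) c = poly_eval (\<lambda>v. c * u v) p"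
  unfolding line_poly_def poly_sum
proof -
  have "(\<Sum>\<mu>\<in>Poly_Mapping.keys p.
      poly (monom (poly_eval u (Poly_Mapping.single \<mu> (Poly_Mapping.lookup p \<mu>))) (block_degree B \<mu>)) c) =
    (\<Sum>\<mu>\<in>Poly_Mapping.keys p. poly_eval (\<lambda>v. c * u v) (Poly_Mapping.single \<mu> (Poly_Mapping.lookup p \<mu>)))"
  proof (rule sum.cong[OF refl])
    fix \<mu> assume \<mu>: "\<mu> \<in> Poly_Mapping.keys p"
    let ?s = "Poly_Mapping.single \<mu> (Poly_Mapping.lookup p \<mu>)"
    have "?s \<in> polys B" "homogeneous_in B (block_degree B \<mu>) ?s"
      using assms \<mu> by (auto simp: polys_def homogeneous_in_iff)
    from poly_eval_scale[OF this] show "poly (monom (poly_eval u ?s) (block_degree B \<mu>)) c =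
        poly_eval (\<lambda>v. c * u v) ?s"
      by (simp add: poly_monom mult.commute)
  qed
  also have "\<dots> = poly_eval (\<lambda>v. c * u v) p"
    by (simp only: poly_eval.hom_sum [symmetric] poly_mapping_sum_single)
  finally show "(\<Sum>\<mu>\<in>Poly_Mapping.keys p.
      poly (monom (poly_eval u (Poly_Mapping.single \<mu> (Poly_Mapping.lookup p \<mu>))) (block_degree B \<mu>)) c) =
    poly_eval (\<lambda>v. c * u v) p" .
qed

section \<open>Projective points\<close>

lemma proj_rel_iff:
  "(u, w) \<in> proj_rel B \<longleftrightarrow> u \<in> coord_vecs B \<and> (\<exists>c. c \<noteq> 0 \<and> w = (\<lambda>v. c * u v))"
  by (auto simp: proj_rel_def coord_vecs_def)

lemma equiv_proj_rel: "equiv (coord_vecs B) (proj_rel B)"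
proof (rule equivI)
  show "proj_rel B \<subseteq> coord_vecs B \<times> coord_vecs B"
    by (auto simp: proj_rel_def)
  show "refl_on (coord_vecs B) (proj_rel B)"
    by (auto simp: refl_on_def proj_rel_iff intro: exI[of _ 1])
  show "sym (proj_rel B)"
  proof (rule symI)
    fix u w assume a: "(u, w) \<in> proj_rel B"
    then obtain c where "c \<noteq> 0" "w = (\<lambda>v. c * u v)" by (auto simp: proj_rel_def)
    then have "u = (\<lambda>v. inverse c * w v)" "inverse c \<noteq> 0" by (auto simp: fun_eq_iff)
    with a show "(w, u) \<in> proj_rel B" unfolding proj_rel_def by blast
  qed
  show "trans (proj_rel B)"
    by (rule transI) (auto simp: proj_rel_iff mult.assoc [symmetric]  intro: exI[of _ "_ * _"])
qed

lemma mem_proj_point: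
  "w \<in> proj_point B u \<longleftrightarrow> u \<in> coord_vecs B \<and> (\<exists>c. c \<noteq> 0 \<and> w = (\<lambda>v. c * u v))"
  by (auto simp: proj_point_def proj_rel_iff)

lemma proj_point_self: "u \<in> coord_vecs B \<Longrightarrow> u \<in> proj_point B u"
  by (auto simp: mem_proj_point intro: exI[of _ 1])

lemma proj_point_in_space: "u \<in> coord_vecs B \<Longrightarrow> proj_point B u \<in> proj_space B"
  by (auto simp: proj_point_def proj_space_def intro: quotientI)

lemma proj_point_eq_iff:
  "u \<in> coord_vecs B \<Longrightarrow> w \<in> coord_vecs B \<Longrightarrow>
    proj_point B u = proj_point B w \<longleftrightarrow> (\<exists>c. c \<noteq> 0 \<and> w = (\<lambda>v. c * u v))"
  unfolding proj_point_def by (simp add: eq_equiv_class_iff[OF equiv_proj_rel] proj_rel_iff)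

lemma proj_space_memD:
  assumes "P \<in> proj_space B" "u \<in> P"
  shows "u \<in> coord_vecs B" "P = proj_point B u"
proof -
  from assms(1) obtain w where w: "w \<in> coord_vecs B" "P = proj_rel B `` {w}"
    by (auto simp: proj_space_def elim: quotientE)
  with assms(2) have "(w, u) \<in> proj_rel B" by auto
  with w equiv_class_eq[OF equiv_proj_rel this]
  show "u \<in> coord_vecs B" "P = proj_point B u"
    by (auto simp: proj_point_def proj_rel_def)
qed

lemma proj_space_nonempty:
  assumes "P \<in> proj_space B"
  obtains u where "u \<in> P" "u \<in> coord_vecs B" "P = proj_point B u"
proof -
  from assms obtain w where "w \<in> coord_vecs B" "P = proj_point B w"
    by (auto simp: proj_space_def proj_point_def elim: quotientE)
  with that proj_point_self show thesis by blast
qed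

lemma coord_vecs_zero: "u \<in> coord_vecs B \<Longrightarrow> v \<notin> B \<Longrightarrow> u v = 0"
  by (auto simp: coord_vecs_def)

text \<open>Forms are multiplied by a power of the scalar under scaling, so a single representative
  decides, although \<open>zero_locus\<close> tests all of them.\<close>

lemma proj_point_in_zero_locus:
  assumes "u \<in> coord_vecs B" "T \<subseteq> polys B" "\<And>p. p \<in> T \<Longrightarrow> \<exists>d. homogeneous_in B d p"
  shows "proj_point B u \<in> zero_locus B T \<longleftrightarrow> (\<forall>p\<in>T. poly_eval u p = 0)"
proof
  assume "proj_point B u \<in> zero_locus B T"
  with proj_point_self[OF assms(1)] show "\<forall>p\<in>T. poly_eval u p = 0"
    by (auto simp: zero_locus_def)
next
  assume z: "\<forall>p\<in>T. poly_eval u p = 0"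
  have "poly_eval (\<lambda>v. c * u v) p = 0" if p: "p \<in> T" for p c
  proof -
    from assms(3)[OF p] obtain d where "homogeneous_in B d p" by blast
    with p assms(2) z show ?thesis by (subst poly_eval_scale[of p B d]) auto
  qed
  with assms(1) proj_point_in_space[OF assms(1)]
  show "proj_point B u \<in> zero_locus B T"
    by (auto simp: zero_locus_def mem_proj_point)
qed

lemma proj_closed_subset: "proj_closed B W \<Longrightarrow> W \<subseteq> proj_space B"
  by (auto simp: proj_closed_def zero_locus_def)

section \<open>Irreducible cones\<close>

definition vanishes :: "'k::comm_ring_1 coord_vec set \<Rightarrow> 'k mpoly \<Rightarrow> bool" where
  "vanishes T p \<longleftrightarrow> (\<forall>t\<in>T. poly_eval t p = 0)"

text \<open>Primality of the vanishing ideal, but tested on arbitrary polynomials: they need neither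
  be homogeneous nor be confined to the coordinates of the cone.\<close>

definition irreducible_cone :: "'k::comm_ring_1 coord_vec set \<Rightarrow> bool" where
  "irreducible_cone T \<longleftrightarrow> T \<noteq> {} \<and> (\<forall>p q. vanishes T (p * q) \<longrightarrow> vanishes T p \<or> vanishes T q)"

text \<open>The shape in which irreducibility is applied: an identity \<open>q = 0\<close> known at
  the points where \<open>p\<close> is nonzero holds on all of \<open>T\<close>, provided that
  \<open>p\<close> does not vanish identically.\<close>

lemma irreducible_coneD:
  "irreducible_cone T \<Longrightarrow> (\<And>t. t \<in> T \<Longrightarrow> poly_eval t p * poly_eval t q = 0) \<Longrightarrow>
    vanishes T p \<or> vanishes T q"
  unfolding irreducible_cone_def
  by (metis poly_eval.hom_mult vanishes_def)

lemma not_vanishesE: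
  assumes "\<not> vanishes T p" obtains t where "t \<in> T" "poly_eval t p \<noteq> 0"
  using assms by (auto simp: vanishes_def)

lemma vanishing_ideal_eq:
  "vanishing_ideal B W = {p \<in> polys B. vanishes (\<Union>W) p}"
  by (auto simp: vanishing_ideal_def vanishes_def)

text \<open>Over a finite field, 1 plus the product of all \<open>X - a\<close> is a nonconstant
  polynomial without a root.\<close>

lemma infinite_alg_closed_field: "infinite (UNIV :: 'k::alg_closed_field set)"
proof
  assume fin: "finite (UNIV :: 'k set)"
  define p :: "'k poly" where "p = 1 + (\<Prod>a\<in>UNIV. [:- a, 1:])"
  have "degree (\<Prod>a\<in>UNIV. [:- a, 1 :: 'k:]) = card (UNIV :: 'k set)"
    by (subst degree_prod_eq_sum_degree) auto
  moreover have "card (UNIV :: 'k set) > 0"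
    using fin by (simp add: card_gt_0_iff)
  ultimately have "degree p > 0"
    unfolding p_def by (subst degree_add_eq_right) auto
  then obtain x where "poly p x = 0"
    using alg_closed_imp_poly_has_root by blast
  moreover have "poly (\<Prod>a\<in>UNIV. [:- a, 1:]) x = 0"
    unfolding poly_prod using fin by (intro prod_zero bexI[of _ x]) auto
  ultimately show False by (simp add: p_def)
qed

text \<open>If \<open>p * q\<close> vanishes on the cone, then on each line of the cone the product
  of two univariate polynomials has infinitely many roots, so one of them is zero. Each point thus
  lies in one of two closed sets, and irreducibility of \<open>W\<close> puts all points into one of
  them.\<close>

lemma irreducible_variety_cone:
  fixes W :: "'k::alg_closed_field point set"
  assumes "irreducible_variety B W"
  shows "irreducible_cone (\<Union>W)"
proof -
  have closed: "proj_closed B W" and ne: "W \<noteq> {}"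
    and irr: "\<And>C D. proj_closed B C \<Longrightarrow> proj_closed B D \<Longrightarrow> W \<subseteq> C \<union> D \<Longrightarrow> W \<subseteq> C \<or> W \<subseteq> D"
    using assms by (auto simp: irreducible_variety_def)
  note sub = proj_closed_subset[OF closed]
  have supp: "u v = 0" if "u \<in> \<Union>W" "v \<notin> B" for u v
    using that sub proj_space_memD(1) coord_vecs_zero by (metis UnionE subsetD)
  \<comment> \<open>The locus where every homogeneous component of \<open>p\<close> vanishes, that
    is, the closed set of points whose line through the origin lies in the zero set of
    \<open>p\<close>.\<close>
  define L where "L p = zero_locus B {homogeneous_part B d p | d. True}" for p :: "'k mpoly"
  have L_closed: "proj_closed B (L p)" if "p \<in> polys B" for p
    unfolding proj_closed_def L_def
    by (rule exI[of _ "{homogeneous_part B d p | d. True}"])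
       (use that homogeneous_part_homogeneous homogeneous_part_polys in blast)
  have L_iff: "proj_point B u \<in> L p \<longleftrightarrow> line_poly B u p = 0" if "u \<in> coord_vecs B" "p \<in> polys B" for u p
    unfolding L_def using that homogeneous_part_homogeneous homogeneous_part_polys
    by (subst proj_point_in_zero_locus) (auto simp: poly_eq_iff coeff_line_poly)
  have main: "vanishes (\<Union>W) p \<or> vanishes (\<Union>W) q"
    if pq: "p \<in> polys B" "q \<in> polys B" "vanishes (\<Union>W) (p * q)" for p q
  proof -
    have "W \<subseteq> L p \<union> L q"
    proof
      fix P assume P: "P \<in> W"
      then obtain u where u: "u \<in> P" "u \<in> coord_vecs B" "P = proj_point B u"
        using sub proj_space_nonempty by blast
      have "poly (line_poly B u p * line_poly B u q) c = 0" if "c \<noteq> 0" for c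
      proof -
        have "(\<lambda>v. c * u v) \<in> P" using u that by (auto simp: mem_proj_point)
        with P have "poly_eval (\<lambda>v. c * u v) (p * q) = 0"
          using pq(3) by (auto simp: vanishes_def)
        then show ?thesis by (simp add: poly_line_poly pq poly_eval.hom_mult)
      qed
      \<comment> \<open>The origin is excluded because \<open>P\<close> contains only nonzero
        multiples of \<open>u\<close>; infinitely many roots remain.\<close>
      then have "UNIV - {0} \<subseteq> {c. poly (line_poly B u p * line_poly B u q) c = 0}" by auto
      then have "infinite {c. poly (line_poly B u p * line_poly B u q) c = 0}"
        using infinite_alg_closed_field by (metis finite_Diff2 finite.emptyI finite_insert finite_subset)
      then have "line_poly B u p * line_poly B u q = 0"
        using poly_roots_finite by blast
      then show "P \<in> L p \<union> L q" using L_iff u pq by auto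
    qed
    moreover have "vanishes (\<Union>W) r" if "W \<subseteq> L r" "r \<in> polys B" for r
      unfolding vanishes_def
    proof
      fix t assume "t \<in> \<Union>W"
      then obtain P where P: "P \<in> W" "t \<in> P" by blast
      then have "line_poly B t r = 0"
        using that sub L_iff proj_space_memD by (metis subsetD)
      then show "poly_eval t r = 0"
        using poly_line_poly[OF that(2), of t 1] by simp
    qed
    ultimately show ?thesis using irr[OF L_closed L_closed] pq by blast
  qed
  have restr: "vanishes (\<Union>W) (restrict_vars B p) \<longleftrightarrow> vanishes (\<Union>W) p" for p
    unfolding vanishes_def by (intro ball_cong refl) (simp add: poly_eval_restrict_vars supp)
  have "vanishes (\<Union>W) p \<or> vanishes (\<Union>W) q" if "vanishes (\<Union>W) (p * q)" for p q
  proof -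
    have "vanishes (\<Union>W) (restrict_vars B p * restrict_vars B q)"
      using that restr[of "p * q"] by (simp add: restrict_vars_def poly_subst.hom_mult)
    then show ?thesis using main restrict_vars_polys restr by metis
  qed
  moreover have "\<Union>W \<noteq> {}"
    using ne sub proj_space_nonempty by (metis Union_iff ex_in_conv subsetD)
  ultimately show ?thesis by (auto simp: irreducible_cone_def)
qed

section \<open>The cone over the product and the ideal of the tensor product\<close>

lemma prod_Var_power:
  "(\<Prod>v\<in>A. Var v ^ Poly_Mapping.lookup \<mu> v) =
    Poly_Mapping.single (\<Sum>v\<in>A. Poly_Mapping.single v (Poly_Mapping.lookup \<mu> v)) (1::'k::comm_ring_1)"
proof -
  have pow: "Var v ^ k = Poly_Mapping.single (Poly_Mapping.single v k) (1::'k)" for v k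
    by (induction k) (auto simp: Var_def mult_single simp flip: single_add)
  show ?thesis
    by (induction A rule: infinite_finite_induct) (auto simp: pow mult_single)
qed

lemma poly_subst_Var: "poly_subst Var p = p"
proof -
  have "(\<Sum>v\<in>Poly_Mapping.keys \<mu>. Poly_Mapping.single v (Poly_Mapping.lookup \<mu> v)) = \<mu>"
    for \<mu> :: "var \<Rightarrow>\<^sub>0 nat"
    by (rule poly_mapping_eqI)
       (auto simp: lookup_sum lookup_single when_def in_keys_iff sum.delta' cong: if_cong)
  then show ?thesis
    by (simp add: poly_subst_def prod_Var_power Const_def mult_single poly_mapping_sum_single)
qed

text \<open>For cones over \<open>X\<close> and \<open>Y\<close> the supports are disjoint, so the
  pointwise sum is just the pair of coordinate vectors and this is the cone over
  \<open>X \<times> Y\<close>.\<close>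

definition sum_cone :: "'k::comm_ring_1 coord_vec set \<Rightarrow> 'k coord_vec set \<Rightarrow> 'k coord_vec set" where
  "sum_cone T U = {\<lambda>v. u v + w v | u w. u \<in> T \<and> w \<in> U}"

definition translate :: "(var \<Rightarrow> 'k::comm_ring_1) \<Rightarrow> 'k mpoly \<Rightarrow> 'k mpoly" where
  "translate u = poly_subst (\<lambda>v. Const (u v) + Var v)"

lemma poly_eval_translate: "poly_eval w (translate u p) = poly_eval (\<lambda>v. u v + w v) p"
  by (simp add: translate_def poly_eval_subst poly_eval.hom_add)

text \<open>Let \<open>p\<close> be nonzero at \<open>(u1, w1)\<close> and \<open>q\<close> at
  \<open>(u2, w2)\<close>. Irreducibility of \<open>U\<close> provides one \<open>w\<close> that
  works for \<open>p\<close> with \<open>u1\<close> and for \<open>q\<close> with \<open>u2\<close>;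
  with this \<open>w\<close> fixed, irreducibility of \<open>T\<close> provides one \<open>u\<close>
  that works for both.\<close>

lemma irreducible_cone_sum:
  fixes T U :: "'k::idom coord_vec set"
  assumes T: "irreducible_cone T" and U: "irreducible_cone U"
  shows "irreducible_cone (sum_cone T U)"
  unfolding irreducible_cone_def
proof (intro conjI allI impI)
  show "sum_cone T U \<noteq> {}"
    using T U by (auto simp: irreducible_cone_def sum_cone_def)
  fix p q :: "'k mpoly" assume pq: "vanishes (sum_cone T U) (p * q)"
  show "vanishes (sum_cone T U) p \<or> vanishes (sum_cone T U) q"
  proof (rule ccontr)
    assume "\<not> ?thesis"
    then obtain u1 w1 u2 w2 where 1: "u1 \<in> T" "w1 \<in> U" "poly_eval (\<lambda>v. u1 v + w1 v) p \<noteq> 0"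
      and 2: "u2 \<in> T" "w2 \<in> U" "poly_eval (\<lambda>v. u2 v + w2 v) q \<noteq> 0"
      by (fastforce simp: vanishes_def sum_cone_def)
    have "\<not> vanishes U (translate u1 p)" "\<not> vanishes U (translate u2 q)"
      using 1 2 by (auto simp: vanishes_def poly_eval_translate)
    then obtain w where w: "w \<in> U" "poly_eval (\<lambda>v. u1 v + w v) p \<noteq> 0" "poly_eval (\<lambda>v. u2 v + w v) q \<noteq> 0"
      using irreducible_coneD[OF U, of "translate u1 p" "translate u2 q"]
      by (auto simp: poly_eval_translate)
    then have "\<not> vanishes T (translate w p)" "\<not> vanishes T (translate w q)"
      using 1 2 by (auto simp: vanishes_def poly_eval_translate add.commute)
    then obtain u where u: "u \<in> T" "poly_eval (\<lambda>v. u v + w v) p \<noteq> 0" "poly_eval (\<lambda>v. u v + w v) q \<noteq> 0"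
      using irreducible_coneD[OF T, of "translate w p" "translate w q"]
      by (auto simp: poly_eval_translate add.commute)
    have "poly_eval (\<lambda>v. u v + w v) (p * q) = 0"
      using pq u(1) w(1) by (auto simp: vanishes_def sum_cone_def)
    with u show False by (simp add: poly_eval.hom_mult)
  qed
qed

text \<open>The hard direction is linear algebra over the field: if a finite sum of products of a
  function on \<open>X\<close> and a function on \<open>Y\<close> is the zero function, then the
  tensor that it represents is zero. With it, the conditions modulo the ideal in the definitions of
  the rational map and of the Rees ideal become conditions on points.\<close>

lemma mem_product_ideal_iff:
  fixes X Y :: "'k::field point set"
  assumes X: "X \<subseteq> proj_space (xs n)" and Y: "Y \<subseteq> proj_space (ys m)"
  shows "p \<in> product_ideal n m X Y \<longleftrightarrow>
    p \<in> polys (xs n \<union> ys m) \<and> vanishes (sum_cone (\<Union>X) (\<Union>Y)) p"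
proof -
  let ?R = "poly_ring (xs n \<union> ys m) :: 'k mpoly ring"
  let ?G = "vanishing_ideal (xs n) X \<union> vanishing_ideal (ys m) Y"
  let ?E = "sum_cone (\<Union>X) (\<Union>Y)"
  have suppX: "u v = 0" if "u \<in> \<Union>X" "v \<notin> xs n" for u v
    using that X proj_space_memD(1) coord_vecs_zero by (metis UnionE subsetD)
  have suppY: "w v = 0" if "w \<in> \<Union>Y" "v \<notin> ys m" for w v
    using that Y proj_space_memD(1) coord_vecs_zero by (metis UnionE subsetD)
  have evX: "poly_eval (\<lambda>v. u v + w v) a = poly_eval u a"
    if "u \<in> \<Union>X" "w \<in> \<Union>Y" "a \<in> polys (xs n)" for u w a
    by (rule poly_eval_cong[OF that(3)]) (use suppY[OF that(2)] in \<open>auto simp: xs_def ys_def\<close>)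
  have evY: "poly_eval (\<lambda>v. u v + w v) a = poly_eval w a"
    if "u \<in> \<Union>X" "w \<in> \<Union>Y" "a \<in> polys (ys m)" for u w a
    by (rule poly_eval_cong[OF that(3)]) (use suppX[OF that(1)] in \<open>auto simp: xs_def ys_def\<close>)
  interpret R: cring ?R by (rule poly_ring_cring)
  have GV: "?G \<subseteq> polys (xs n \<union> ys m)"
    using polys_mono[of "xs n" "xs n \<union> ys m"] polys_mono[of "ys m" "xs n \<union> ys m"]
    by (auto simp: vanishing_ideal_def)
  interpret J: ideal "product_ideal n m X Y" ?R
    unfolding product_ideal_def by (rule R.genideal_ideal) (use GV in simp)
  have Jadd: "p + q \<in> product_ideal n m X Y" if "p \<in> product_ideal n m X Y" "q \<in> product_ideal n m X Y" for p q
    using J.a_closed[OF that] by simp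
  have J0: "0 \<in> product_ideal n m X Y" using J.zero_closed by simp
  have Jsum: "(\<Sum>i\<in>I. p i) \<in> product_ideal n m X Y"
    if "\<And>i. i \<in> I \<Longrightarrow> p i \<in> product_ideal n m X Y" for I and p :: "'i \<Rightarrow> 'k mpoly"
    using that by (induction I rule: infinite_finite_induct) (auto intro: Jadd J0)
  have Jmult: "p * q \<in> product_ideal n m X Y"
    if "p \<in> product_ideal n m X Y" "q \<in> polys (xs n \<union> ys m)" for p q
    using J.I_r_closed[OF that(1), of q] that(2) by simp
  have GJ: "g \<in> product_ideal n m X Y" if "g \<in> ?G" for g
    unfolding product_ideal_def by (rule mem_genideal[OF GV that])
  have dir1: "p \<in> polys (xs n \<union> ys m) \<and> vanishes ?E p" if "p \<in> product_ideal n m X Y" for p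
  proof -
    have "poly_eval t q = 0" if "q \<in> ?G" "t \<in> ?E" for q t
      using that evX evY unfolding sum_cone_def vanishing_ideal_def by fastforce
    from genideal_vanishes[OF that[unfolded product_ideal_def] GV this]
    show ?thesis by (auto simp: vanishes_def)
  qed
  text \<open>Writing \<open>p\<close> as a sum of products \<open>a\<^sub>i(x) b\<^sub>i(y)\<close>, fix a point \<open>u\<close> of \<open>X\<close> with
    \<open>a\<^sub>j(u) \<noteq> 0\<close>. The polynomial \<open>p(u, y)\<close> in the ideal of \<open>Y\<close> expresses \<open>b\<^sub>j\<close> by the other
    \<open>b\<^sub>i\<close>, which shortens the sum.\<close>
  have sums: "(\<Sum>i\<in>I. a i * b i) \<in> product_ideal n m X Y"
    if "finite I" "\<And>i. i \<in> I \<Longrightarrow> a i \<in> polys (xs n)" "\<And>i. i \<in> I \<Longrightarrow> b i \<in> polys (ys m)"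
      "vanishes ?E (\<Sum>i\<in>I. a i * b i)" for I :: "(var \<Rightarrow>\<^sub>0 nat) set" and a b
    using that
  proof (induction "card I" arbitrary: I a b rule: less_induct)
    case less
    show ?case
    proof (cases "\<forall>i\<in>I. a i \<in> vanishing_ideal (xs n) X")
      case True
      then show ?thesis
        using polys_mono[of "ys m" "xs n \<union> ys m"] less.prems
        by (intro Jsum Jmult GJ) auto
    next
      case False
      then obtain j u where j: "j \<in> I" and u: "u \<in> \<Union>X" "poly_eval u (a j) \<noteq> 0"
        using less.prems(2) by (auto simp: vanishing_ideal_def)
      define c where "c i = poly_eval u (a i) / poly_eval u (a j)" for i
      define \<beta> where "\<beta> = (\<Sum>i\<in>I. Const (c i) * b i)"
      \<comment> \<open>Subtracting \<open>c i\<close> times \<open>a j\<close> makes the new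
        coefficient at \<open>j\<close> zero, because \<open>c j = 1\<close>. What is subtracted
        adds up to \<open>\<beta> * a j\<close>, which is in the ideal.\<close>
      define a' where "a' i = a i - Const (c i) * a j" for i
      have "\<beta> \<in> polys (ys m)"
        unfolding \<beta>_def using less.prems(3) by (intro polys_sum polys_mult polys_Const)
      moreover have "poly_eval w \<beta> = 0" if w: "w \<in> \<Union>Y" for w
      proof -
        have "0 = poly_eval (\<lambda>v. u v + w v) (\<Sum>i\<in>I. a i * b i)"
          using less.prems(4) u(1) w by (auto simp: vanishes_def sum_cone_def)
        also have "\<dots> = (\<Sum>i\<in>I. poly_eval u (a i) * poly_eval w (b i))"
          using less.prems(2,3) evX[OF u(1) w] evY[OF u(1) w]
          by (simp add: poly_eval.hom_sum poly_eval.hom_mult)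
        also have "\<dots> = poly_eval u (a j) * poly_eval w \<beta>"
          using u(2) by (simp add: \<beta>_def c_def poly_eval.hom_sum poly_eval.hom_mult sum_distrib_left)
        finally show ?thesis using u(2) by simp
      qed
      ultimately have "\<beta> \<in> product_ideal n m X Y"
        by (intro GJ) (auto simp: vanishing_ideal_def)
      then have \<beta>J: "\<beta> * a j \<in> product_ideal n m X Y"
        using less.prems(2)[OF j] polys_mono[of "xs n" "xs n \<union> ys m"] by (intro Jmult) auto
      have "c j = 1" using u(2) by (simp add: c_def)
      then have a'j: "a' j = 0"
        using poly_subst.hom_one by (simp add: a'_def Const_def)
      have split: "(\<Sum>i\<in>I. a i * b i) = \<beta> * a j + (\<Sum>i\<in>I - {j}. a' i * b i)"
      proof -
        have "(\<Sum>i\<in>I. a i * b i) = (\<Sum>i\<in>I. Const (c i) * b i * a j + a' i * b i)"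
          by (rule sum.cong) (auto simp: a'_def algebra_simps)
        also have "\<dots> = \<beta> * a j + (\<Sum>i\<in>I. a' i * b i)"
          by (simp add: sum.distrib \<beta>_def sum_distrib_right)
        also have "(\<Sum>i\<in>I. a' i * b i) = (\<Sum>i\<in>I - {j}. a' i * b i)"
          using less.prems(1) j a'j by (simp add: sum.remove)
        finally show ?thesis .
      qed
      have "(\<Sum>i\<in>I - {j}. a' i * b i) \<in> product_ideal n m X Y"
      proof (rule less.hyps)
        show "card (I - {j}) < card I" using less.prems(1) j by (rule card_Diff1_less)
        have "vanishes ?E (\<beta> * a j)" using dir1[OF \<beta>J] by simp
        then show "vanishes ?E (\<Sum>i\<in>I - {j}. a' i * b i)"
          using less.prems(4) unfolding split by (simp add: vanishes_def poly_eval.hom_add)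
      qed (use less.prems j in \<open>auto simp: a'_def intro!: polys_diff polys_mult\<close>)
      then show ?thesis unfolding split by (rule Jadd[OF \<beta>J])
    qed
  qed
  have "p \<in> product_ideal n m X Y" if p: "p \<in> polys (xs n \<union> ys m)" "vanishes ?E p"
  proof -
    \<comment> \<open>Each monomial splits into its \<open>x\<close> part and its \<open>y\<close>
      part; the scalar goes with the \<open>x\<close> part.\<close>
    define a where "a \<mu> = Const (Poly_Mapping.lookup p \<mu>) *
      (\<Prod>v\<in>Poly_Mapping.keys \<mu> \<inter> xs n. Var v ^ Poly_Mapping.lookup \<mu> v)" for \<mu>
    define b where "b \<mu> = (\<Prod>v\<in>Poly_Mapping.keys \<mu> \<inter> ys m. Var v ^ Poly_Mapping.lookup \<mu> v :: 'k mpoly)" for \<mu>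
    have "a \<mu> * b \<mu> = Const (Poly_Mapping.lookup p \<mu>) *
        (\<Prod>v\<in>Poly_Mapping.keys \<mu>. Var v ^ Poly_Mapping.lookup \<mu> v)" if "\<mu> \<in> Poly_Mapping.keys p" for \<mu>
    proof -
      have K: "Poly_Mapping.keys \<mu> = (Poly_Mapping.keys \<mu> \<inter> xs n) \<union> (Poly_Mapping.keys \<mu> \<inter> ys m)"
        using p(1) that by (auto simp: polys_def)
      have "(\<Prod>v\<in>Poly_Mapping.keys \<mu>. Var v ^ Poly_Mapping.lookup \<mu> v :: 'k mpoly) =
          (\<Prod>v\<in>Poly_Mapping.keys \<mu> \<inter> xs n. Var v ^ Poly_Mapping.lookup \<mu> v) * b \<mu>"
        unfolding b_def by (subst K, rule prod.union_disjoint) (auto simp: xs_def ys_def)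
      then show ?thesis by (simp add: a_def mult.assoc)
    qed
    then have p_eq: "p = (\<Sum>\<mu>\<in>Poly_Mapping.keys p. a \<mu> * b \<mu>)"
      using poly_subst_Var[of p] by (simp add: poly_subst_def)
    have "(\<Sum>\<mu>\<in>Poly_Mapping.keys p. a \<mu> * b \<mu>) \<in> product_ideal n m X Y"
      by (rule sums) (use p p_eq in \<open>auto simp: a_def b_def intro!: polys_mult polys_prod polys_power polys_Var\<close>)
    then show ?thesis using p_eq by simp
  qed
  with dir1 show ?thesis by blast
qed

section \<open>Independence over the field of fractions\<close>

lemma rows_independentD:
  "rows_independent K M I \<Longrightarrow> a \<in> I \<rightarrow> carrier K \<Longrightarrow>
    \<forall>j<dim_col M. (\<Oplus>\<^bsub>K\<^esub>i\<in>I. a i \<otimes>\<^bsub>K\<^esub> M $$ (i, j)) = \<zero>\<^bsub>K\<^esub> \<Longrightarrow> i \<in> I \<Longrightarrow> a i = \<zero>\<^bsub>K\<^esub>"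
  by (simp add: rows_independent_def)

section \<open>Arithmetic of fractions\<close>

context domain
begin

lemma frac_rel_iff:
  "((a, b), (c, d)) \<in> frac_rel R \<longleftrightarrow>
    a \<in> carrier R \<and> b \<in> carrier R - {\<zero>} \<and> c \<in> carrier R \<and> d \<in> carrier R - {\<zero>} \<and> a \<otimes> d = c \<otimes> b"
  by (simp add: frac_rel_def)

text \<open>Transitivity cancels the denominator \<open>d\<close> of the middle fraction, which is
  possible because \<open>d\<close> is nonzero in a domain.\<close>

lemma equiv_frac_rel: "equiv (carrier R \<times> (carrier R - {\<zero>})) (frac_rel R)"
proof (rule equivI)
  show "frac_rel R \<subseteq> (carrier R \<times> (carrier R - {\<zero>})) \<times> (carrier R \<times> (carrier R - {\<zero>}))"
    by (auto simp: frac_rel_def)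
  show "refl_on (carrier R \<times> (carrier R - {\<zero>})) (frac_rel R)"
    by (auto simp: refl_on_def frac_rel_iff)
  show "sym (frac_rel R)"
    by (rule symI) (auto simp: frac_rel_def)
  show "trans (frac_rel R)"
  proof (rule transI)
    fix p q r assume pq: "(p, q) \<in> frac_rel R" and qr: "(q, r) \<in> frac_rel R"
    obtain a b c d e f where p: "p = (a, b)" and q: "q = (c, d)" and r: "r = (e, f)"
      by (cases p, cases q, cases r)
    have cl: "a \<in> carrier R" "b \<in> carrier R" "c \<in> carrier R" "d \<in> carrier R" "e \<in> carrier R" "f \<in> carrier R"
      and nz: "d \<noteq> \<zero>" and eq: "a \<otimes> d = c \<otimes> b" "c \<otimes> f = e \<otimes> d"
      using pq qr by (auto simp: p q r frac_rel_iff)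
    have "d \<otimes> (a \<otimes> f) = (a \<otimes> d) \<otimes> f" using cl by (simp add: m_ac)
    also have "\<dots> = b \<otimes> (c \<otimes> f)" using cl eq(1) by (simp add: m_ac)
    also have "\<dots> = d \<otimes> (e \<otimes> b)" using cl eq(2) by (simp add: m_ac)
    finally have "a \<otimes> f = e \<otimes> b" using cl nz by (simp add: m_lcancel)
    with pq qr show "(p, r) \<in> frac_rel R" by (simp add: p q r frac_rel_iff)
  qed
qed

lemma frac_of_eq_iff:
  assumes "a \<in> carrier R" "b \<in> carrier R - {\<zero>}" "c \<in> carrier R" "d \<in> carrier R - {\<zero>}"
  shows "frac_of R a b = frac_of R c d \<longleftrightarrow> a \<otimes> d = c \<otimes> b"
  unfolding frac_of_def using eq_equiv_class_iff[OF equiv_frac_rel, of "(a, b)" "(c, d)"] assms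
  by (simp add: frac_rel_iff)

lemma frac_of_mem_iff:
  assumes "a \<in> carrier R" "b \<in> carrier R - {\<zero>}"
  shows "(c, d) \<in> frac_of R a b \<longleftrightarrow> c \<in> carrier R \<and> d \<in> carrier R - {\<zero>} \<and> a \<otimes> d = c \<otimes> b"
  using assms by (auto simp: frac_of_def frac_rel_iff)

lemma frac_of_self: "a \<in> carrier R \<Longrightarrow> b \<in> carrier R - {\<zero>} \<Longrightarrow> (a, b) \<in> frac_of R a b"
  by (simp add: frac_of_mem_iff)

lemma denominator_mult: "b \<in> carrier R - {\<zero>} \<Longrightarrow> d \<in> carrier R - {\<zero>} \<Longrightarrow> b \<otimes> d \<in> carrier R - {\<zero>}"
  using integral by auto

text \<open>The operations of \<open>frac_field\<close> are unions over representatives. Once the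
  result is seen not to depend on them, the union is that one result.\<close>

lemma UN_frac_of:
  assumes "a \<in> carrier R" "b \<in> carrier R - {\<zero>}" "c \<in> carrier R" "d \<in> carrier R - {\<zero>}"
    and "\<And>a' b' c' d'. (a', b') \<in> frac_of R a b \<Longrightarrow> (c', d') \<in> frac_of R c d \<Longrightarrow> F a' b' c' d' = F a b c d"
  shows "(\<Union>(a', b')\<in>frac_of R a b. \<Union>(c', d')\<in>frac_of R c d. F a' b' c' d') = F a b c d"
proof -
  have "(\<Union>(c', d')\<in>frac_of R c d. F a' b' c' d') = F a b c d" if "(a', b') \<in> frac_of R a b" for a' b'
    by (rule UN_constant_eq[OF frac_of_self[OF assms(3,4)]]) (use assms(5) that in auto)
  then show ?thesis
    by (intro UN_constant_eq[OF frac_of_self[OF assms(1,2)]]) auto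
qed

lemma frac_field_mult:
  assumes "a \<in> carrier R" "b \<in> carrier R - {\<zero>}" "c \<in> carrier R" "d \<in> carrier R - {\<zero>}"
  shows "frac_of R a b \<otimes>\<^bsub>frac_field R\<^esub> frac_of R c d = frac_of R (a \<otimes> c) (b \<otimes> d)"
  unfolding frac_field_def monoid.simps
proof (rule UN_frac_of[OF assms])
  fix a' b' c' d' assume "(a', b') \<in> frac_of R a b" "(c', d') \<in> frac_of R c d"
  then have cl: "a' \<in> carrier R" "b' \<in> carrier R - {\<zero>}" "c' \<in> carrier R" "d' \<in> carrier R - {\<zero>}"
    and eq: "a \<otimes> b' = a' \<otimes> b" "c \<otimes> d' = c' \<otimes> d"
    using assms by (auto simp: frac_of_mem_iff)
  have "(a' \<otimes> c') \<otimes> (b \<otimes> d) = (a' \<otimes> b) \<otimes> (c' \<otimes> d)" using cl assms by (simp add: m_ac)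
  also have "\<dots> = (a \<otimes> b') \<otimes> (c \<otimes> d')" by (simp only: eq)
  also have "\<dots> = (a \<otimes> c) \<otimes> (b' \<otimes> d')" using cl assms by (simp add: m_ac)
  finally show "frac_of R (a' \<otimes> c') (b' \<otimes> d') = frac_of R (a \<otimes> c) (b \<otimes> d)"
    using cl assms denominator_mult by (subst frac_of_eq_iff) auto
qed

lemma frac_field_add:
  assumes "a \<in> carrier R" "b \<in> carrier R - {\<zero>}" "c \<in> carrier R" "d \<in> carrier R - {\<zero>}"
  shows "frac_of R a b \<oplus>\<^bsub>frac_field R\<^esub> frac_of R c d = frac_of R (a \<otimes> d \<oplus> c \<otimes> b) (b \<otimes> d)"
  unfolding frac_field_def ring_record_simps
proof (rule UN_frac_of[OF assms])
  fix a' b' c' d' assume "(a', b') \<in> frac_of R a b" "(c', d') \<in> frac_of R c d"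
  then have cl: "a' \<in> carrier R" "b' \<in> carrier R" "b' \<noteq> \<zero>" "c' \<in> carrier R" "d' \<in> carrier R" "d' \<noteq> \<zero>"
    and eq: "a \<otimes> b' = a' \<otimes> b" "c \<otimes> d' = c' \<otimes> d"
    using assms by (auto simp: frac_of_mem_iff)
  have cl': "b \<in> carrier R" "d \<in> carrier R" using assms by auto
  have "(a' \<otimes> d' \<oplus> c' \<otimes> b') \<otimes> (b \<otimes> d) = (a' \<otimes> b) \<otimes> (d' \<otimes> d) \<oplus> (c' \<otimes> d) \<otimes> (b' \<otimes> b)"
    using cl cl' assms by (simp add: l_distr r_distr m_ac a_ac)
  also have "\<dots> = (a \<otimes> b') \<otimes> (d' \<otimes> d) \<oplus> (c \<otimes> d') \<otimes> (b' \<otimes> b)" by (simp only: eq)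
  also have "\<dots> = (a \<otimes> d \<oplus> c \<otimes> b) \<otimes> (b' \<otimes> d')"
    using cl cl' assms by (simp add: l_distr r_distr m_ac a_ac)
  finally show "frac_of R (a' \<otimes> d' \<oplus> c' \<otimes> b') (b' \<otimes> d') = frac_of R (a \<otimes> d \<oplus> c \<otimes> b) (b \<otimes> d)"
    using cl assms denominator_mult by (subst frac_of_eq_iff) auto
qed

lemma frac_field_carrierE:
  assumes "p \<in> carrier (frac_field R)"
  obtains a b where "a \<in> carrier R" "b \<in> carrier R - {\<zero>}" "p = frac_of R a b"
  using assms by (auto simp: frac_field_def frac_of_def elim!: quotientE)

lemma frac_of_carrier:
  "a \<in> carrier R \<Longrightarrow> b \<in> carrier R - {\<zero>} \<Longrightarrow> frac_of R a b \<in> carrier (frac_field R)"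
  by (auto simp: frac_field_def frac_of_def intro: quotientI)

lemma frac_field_zero: "\<zero>\<^bsub>frac_field R\<^esub> = frac_of R \<zero> \<one>"
  by (simp add: frac_field_def)

lemma frac_of_eq_zero_iff:
  "a \<in> carrier R \<Longrightarrow> b \<in> carrier R - {\<zero>} \<Longrightarrow> frac_of R a b = \<zero>\<^bsub>frac_field R\<^esub> \<longleftrightarrow> a = \<zero>"
  unfolding frac_field_zero by (subst frac_of_eq_iff) auto

lemma frac_field_abelian_monoid: "abelian_monoid (frac_field R)"
proof (rule abelian_monoidI)
  fix p q assume p: "p \<in> carrier (frac_field R)" and q: "q \<in> carrier (frac_field R)"
  obtain a b where ab: "a \<in> carrier R" "b \<in> carrier R - {\<zero>}" "p = frac_of R a b"
    using p by (rule frac_field_carrierE)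
  obtain c d where cd: "c \<in> carrier R" "d \<in> carrier R - {\<zero>}" "q = frac_of R c d"
    using q by (rule frac_field_carrierE)
  note nz = denominator_mult[OF ab(2) cd(2)]
  show "p \<oplus>\<^bsub>frac_field R\<^esub> q \<in> carrier (frac_field R)"
    using ab cd nz by (simp add: frac_field_add frac_of_carrier)
  show "p \<oplus>\<^bsub>frac_field R\<^esub> q = q \<oplus>\<^bsub>frac_field R\<^esub> p"
    using ab cd by (simp add: frac_field_add m_comm a_comm)
  show "\<zero>\<^bsub>frac_field R\<^esub> \<oplus>\<^bsub>frac_field R\<^esub> p = p"
    using ab by (simp add: frac_field_add frac_field_zero)
  fix r assume r: "r \<in> carrier (frac_field R)"
  obtain e f where ef: "e \<in> carrier R" "f \<in> carrier R - {\<zero>}" "r = frac_of R e f"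
    using r by (rule frac_field_carrierE)
  note nz' = denominator_mult[OF cd(2) ef(2)]
  have "(a \<otimes> d \<oplus> c \<otimes> b) \<otimes> f \<oplus> e \<otimes> (b \<otimes> d) = a \<otimes> (d \<otimes> f) \<oplus> (c \<otimes> f \<oplus> e \<otimes> d) \<otimes> b"
    using ab cd ef by (simp add: l_distr r_distr m_ac a_ac)
  then show "p \<oplus>\<^bsub>frac_field R\<^esub> q \<oplus>\<^bsub>frac_field R\<^esub> r = p \<oplus>\<^bsub>frac_field R\<^esub> (q \<oplus>\<^bsub>frac_field R\<^esub> r)"
    using ab cd ef nz nz' by (simp add: frac_field_add m_assoc)
qed (simp add: frac_field_zero frac_of_carrier)

lemma frac_field_finsum:
  assumes "finite I" "x \<in> I \<rightarrow> carrier R" "d \<in> carrier R - {\<zero>}"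
  shows "(\<Oplus>\<^bsub>frac_field R\<^esub>i\<in>I. frac_of R (x i) d) = frac_of R (\<Oplus>i\<in>I. x i) d"
  using assms(1,2)
proof (induction I)
  case empty
  interpret K: abelian_monoid "frac_field R" by (rule frac_field_abelian_monoid)
  from assms(3) show ?case by (simp add: frac_field_zero frac_of_eq_iff)
next
  case (insert j I)
  interpret K: abelian_monoid "frac_field R" by (rule frac_field_abelian_monoid)
  from insert.prems have x: "x j \<in> carrier R" "x \<in> I \<rightarrow> carrier R" by auto
  then have S: "(\<Oplus>i\<in>I. x i) \<in> carrier R" by simp
  have "(\<Oplus>\<^bsub>frac_field R\<^esub>i\<in>insert j I. frac_of R (x i) d) =
      frac_of R (x j) d \<oplus>\<^bsub>frac_field R\<^esub> (\<Oplus>\<^bsub>frac_field R\<^esub>i\<in>I. frac_of R (x i) d)"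
    using insert.hyps x assms(3) by (subst K.finsum_insert) (auto intro: frac_of_carrier)
  also have "\<dots> = frac_of R (x j \<otimes> d \<oplus> (\<Oplus>i\<in>I. x i) \<otimes> d) (d \<otimes> d)"
    using insert.IH[OF x(2)] frac_field_add[OF x(1) assms(3) S assms(3)] by simp
  also have "\<dots> = frac_of R (x j \<oplus> (\<Oplus>i\<in>I. x i)) d"
    using x(1) S assms(3) denominator_mult[OF assms(3) assms(3)]
    by (subst frac_of_eq_iff) (auto simp: l_distr r_distr m_ac a_ac)
  also have "x j \<oplus> (\<Oplus>i\<in>I. x i) = (\<Oplus>i\<in>insert j I. x i)"
    using insert.hyps x by (subst finsum_insert) auto
  finally show ?case .
qed

lemma common_denominator:
  assumes "finite I" "a \<in> I \<rightarrow> carrier (frac_field R)"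
  shows "\<exists>d\<in>carrier R - {\<zero>}. \<exists>x\<in>I \<rightarrow> carrier R. \<forall>i\<in>I. a i = frac_of R (x i) d"
  using assms
proof (induction I)
  case empty
  show ?case by (intro bexI[of _ \<one>] bexI[of _ "\<lambda>_. \<one>"]) auto
next
  case (insert j I)
  then obtain d x where d: "d \<in> carrier R - {\<zero>}" and x: "x \<in> I \<rightarrow> carrier R" "\<forall>i\<in>I. a i = frac_of R (x i) d"
    by auto
  from insert.prems obtain y e where y: "y \<in> carrier R" "e \<in> carrier R - {\<zero>}" "a j = frac_of R y e"
    using frac_field_carrierE[of "a j"] by (metis PiE insertI1)
  have nz: "d \<otimes> e \<in> carrier R - {\<zero>}" using d y(2) by (rule denominator_mult)
  let ?x = "\<lambda>i. if i = j then y \<otimes> d else x i \<otimes> e"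
  have x': "a i = frac_of R (?x i) (d \<otimes> e)" if "i \<in> insert j I" for i
  proof (cases "i = j")
    case True
    then show ?thesis using y d nz by (simp add: frac_of_eq_iff m_ac)
  next
    case False
    with that have "i \<in> I" by simp
    with x have "x i \<in> carrier R" "a i = frac_of R (x i) d" by auto
    with False y d nz show ?thesis by (simp add: frac_of_eq_iff m_ac)
  qed
  have x'_carr: "?x \<in> insert j I \<rightarrow> carrier R"
    using funcset_mem[OF x(1)] y d by (intro Pi_I) auto
  show ?case
    by (rule bexI[OF _ nz], rule bexI[of _ ?x, OF _ x'_carr], rule ballI, rule x')
qed

text \<open>Clearing denominators: the coefficients of a relation over the fraction field have a
  common denominator, and their numerators are a relation over the ring in which the same
  coefficients are zero. A relation over the ring is conversely one with denominator 1.\<close>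

lemma rows_independent_frac_field:
  assumes I: "I \<subseteq> {..<dim_row M}" and M: "\<And>i j. i < dim_row M \<Longrightarrow> j < dim_col M \<Longrightarrow> M $$ (i, j) \<in> carrier R"
  shows "rows_independent (frac_field R) (map_mat (\<lambda>a. frac_of R a \<one>) M) I \<longleftrightarrow> rows_independent R M I"
    (is "?l \<longleftrightarrow> ?r")
proof -
  let ?K = "frac_field R" and ?M = "map_mat (\<lambda>a. frac_of R a \<one>) M"
  have fin: "finite I" using I finite_subset by blast
  interpret K: abelian_monoid ?K by (rule frac_field_abelian_monoid)
  have sum_eq: "(\<Oplus>\<^bsub>?K\<^esub>i\<in>I. a i \<otimes>\<^bsub>?K\<^esub> ?M $$ (i, j)) = frac_of R (\<Oplus>i\<in>I. x i \<otimes> M $$ (i, j)) d"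
    if "j < dim_col M" "d \<in> carrier R - {\<zero>}" "x \<in> I \<rightarrow> carrier R" "\<forall>i\<in>I. a i = frac_of R (x i) d" for j d x a
  proof -
    have c: "x i \<in> carrier R" "M $$ (i, j) \<in> carrier R" if "i \<in> I" for i
      using that \<open>x \<in> _\<close> M I \<open>j < _\<close> by auto
    have "(\<Oplus>\<^bsub>?K\<^esub>i\<in>I. a i \<otimes>\<^bsub>?K\<^esub> ?M $$ (i, j)) = (\<Oplus>\<^bsub>?K\<^esub>i\<in>I. frac_of R (x i \<otimes> M $$ (i, j)) d)"
    proof (rule K.finsum_cong')
      fix i assume i: "i \<in> I"
      have "?M $$ (i, j) = frac_of R (M $$ (i, j)) \<one>" using i I that(1) by auto
      then show "a i \<otimes>\<^bsub>?K\<^esub> ?M $$ (i, j) = frac_of R (x i \<otimes> M $$ (i, j)) d"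
        using c[OF i] that(2,4) i by (simp add: frac_field_mult)
    qed (use c that(2) in \<open>auto intro!: frac_of_carrier\<close>)
    also have "\<dots> = frac_of R (\<Oplus>i\<in>I. x i \<otimes> M $$ (i, j)) d"
      using fin c that(2) by (intro frac_field_finsum) auto
    finally show ?thesis .
  qed
  have S: "(\<Oplus>i\<in>I. x i \<otimes> M $$ (i, j)) \<in> carrier R" if "x \<in> I \<rightarrow> carrier R" "j < dim_col M" for x j
    using that M I by (intro finsum_closed Pi_I m_closed) auto
  show ?thesis
  proof
    assume l: ?l
    show ?r
      unfolding rows_independent_def
    proof (intro ballI impI)
      fix x i assume x: "x \<in> I \<rightarrow> carrier R" and z: "\<forall>j<dim_col M. (\<Oplus>i\<in>I. x i \<otimes> M $$ (i, j)) = \<zero>" and i: "i \<in> I"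
      let ?a = "\<lambda>i. frac_of R (x i) \<one>"
      have "?a \<in> I \<rightarrow> carrier ?K" using x by (auto intro: frac_of_carrier)
      moreover have "\<forall>j<dim_col ?M. (\<Oplus>\<^bsub>?K\<^esub>i\<in>I. ?a i \<otimes>\<^bsub>?K\<^esub> ?M $$ (i, j)) = \<zero>\<^bsub>?K\<^esub>"
        using z x by (simp add: sum_eq[of _ \<one> x] frac_field_zero)
      ultimately have "?a i = \<zero>\<^bsub>?K\<^esub>"
        using i by (rule rows_independentD[OF l])
      then show "x i = \<zero>" using x i by (subst (asm) frac_of_eq_zero_iff) auto
    qed
  next
    assume r: ?r
    show ?l
      unfolding rows_independent_def
    proof (intro ballI impI)
      fix a i assume a: "a \<in> I \<rightarrow> carrier ?K"
        and z: "\<forall>j<dim_col ?M. (\<Oplus>\<^bsub>?K\<^esub>i\<in>I. a i \<otimes>\<^bsub>?K\<^esub> ?M $$ (i, j)) = \<zero>\<^bsub>?K\<^esub>" and i: "i \<in> I"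
      from common_denominator[OF fin a] obtain d x where d: "d \<in> carrier R - {\<zero>}"
        and x: "x \<in> I \<rightarrow> carrier R" "\<forall>i\<in>I. a i = frac_of R (x i) d" by blast
      have "\<forall>j<dim_col M. (\<Oplus>i\<in>I. x i \<otimes> M $$ (i, j)) = \<zero>"
        using z d S[OF x(1)] by (simp add: sum_eq[OF _ d x] frac_of_eq_zero_iff)
      then have "x i = \<zero>" using i by (rule rows_independentD[OF r x(1)])
      then show "a i = \<zero>\<^bsub>?K\<^esub>" using x i d by (simp add: frac_of_eq_zero_iff)
    qed
  qed
qed

end

section \<open>The rank over a coordinate ring as a rank of functions on the cone\<close>

lemma Max_card_eq_iff:
  assumes "finite A" "\<And>I. Q I \<Longrightarrow> I \<subseteq> A" "Q {}"
  shows "Max {card I | I. Q I} = r \<longleftrightarrow> (\<exists>I. Q I \<and> card I = r) \<and> (\<forall>I. Q I \<longrightarrow> card I \<le> r)"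
proof -
  have "{card I | I. Q I} \<subseteq> card ` Pow A" using assms(2) by blast
  then have fin: "finite {card I | I. Q I}" by (rule finite_subset) (simp add: assms(1))
  have ne: "{card I | I. Q I} \<noteq> {}" using assms(3) by blast
  show ?thesis unfolding Max_eq_iff[OF fin ne] by blast
qed

lemma row_rank_eq_iff:
  "row_rank K M = r \<longleftrightarrow>
    (\<exists>I\<subseteq>{..<dim_row M}. rows_independent K M I \<and> card I = r) \<and>
    (\<forall>I\<subseteq>{..<dim_row M}. rows_independent K M I \<longrightarrow> card I \<le> r)"
proof -
  have "rows_independent K M {}" by (simp add: rows_independent_def)
  then show ?thesis
    unfolding row_rank_def
    by (subst Max_card_eq_iff[of "{..<dim_row M}"]) (simp_all only: finite_lessThan conj_assoc imp_conjL empty_subsetI)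
qed

text \<open>Independence of rows over the polynomial functions on \<open>T\<close>. Arbitrary index
  types allow \<open>M\<close> to be transposed and reindexed, and coefficients range over all
  polynomials, so that no carrier has to be tracked.\<close>

definition independent_on ::
  "'k::comm_ring_1 coord_vec set \<Rightarrow> 'i set \<Rightarrow> 'j set \<Rightarrow> ('i \<Rightarrow> 'j \<Rightarrow> 'k mpoly) \<Rightarrow> bool" where
  "independent_on T I C M \<longleftrightarrow>
    (\<forall>a. (\<forall>j\<in>C. vanishes T (\<Sum>i\<in>I. a i * M i j)) \<longrightarrow> (\<forall>i\<in>I. vanishes T (a i)))"

lemma elements_mat_subsetD:
  "elements_mat A \<subseteq> S \<Longrightarrow> i < dim_row A \<Longrightarrow> j < dim_col A \<Longrightarrow> A $$ (i, j) \<in> S"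
  using elements_matI[OF carrier_matI] by blast

lemma independent_onD:
  "independent_on T I C M \<Longrightarrow> (\<And>j. j \<in> C \<Longrightarrow> vanishes T (\<Sum>i\<in>I. a i * M i j)) \<Longrightarrow> i \<in> I \<Longrightarrow> vanishes T (a i)"
  by (simp add: independent_on_def)

lemma coord_ring_domain:
  fixes W :: "'k::alg_closed_field point set"
  assumes "irreducible_variety B W"
  shows "primeideal (vanishing_ideal B W) (poly_ring B)" "domain (coord_ring B W)"
proof -
  have irr: "irreducible_cone (\<Union>W)" by (rule irreducible_variety_cone[OF assms])
  show "primeideal (vanishing_ideal B W) (poly_ring B)"
  proof (rule primeidealI[OF _ poly_ring_cring])
    show "ideal (vanishing_ideal B W) (poly_ring B)"
      using vanishing_ideal_of_points[of B "\<Union>W"] by (simp add: vanishing_ideal_eq vanishes_def)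
    have "\<not> vanishes (\<Union>W) 1"
      using irr by (auto simp: irreducible_cone_def vanishes_def)
    then have "1 \<in> polys B - vanishing_ideal B W"
      by (auto simp: vanishing_ideal_eq)
    then show "carrier (poly_ring B) \<noteq> vanishing_ideal B W" by auto
  qed (use irr in \<open>auto simp: vanishing_ideal_eq irreducible_cone_def\<close>)
  then show "domain (coord_ring B W)"
    unfolding coord_ring_def by (rule primeideal.quotient_is_domain)
qed

text \<open>A coset is zero iff its representative vanishes on the cone, so a relation in the
  coordinate ring is the same as a relation between functions.\<close>

lemma rows_independent_reduce_mat:
  fixes W :: "'k::alg_closed_field point set"
  assumes W: "irreducible_variety B W" and I: "I \<subseteq> {..<dim_row \<Psi>}" and \<Psi>: "elements_mat \<Psi> \<subseteq> polys B"
  shows "rows_independent (coord_ring B W) (reduce_mat B W \<Psi>) I \<longleftrightarrow>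
    independent_on (\<Union>W) I {..<dim_col \<Psi>} (\<lambda>i j. \<Psi> $$ (i, j))"
proof -
  let ?P = "poly_ring B :: 'k mpoly ring" and ?V = "vanishing_ideal B W"
  let ?h = "\<lambda>p. ?V +>\<^bsub>?P\<^esub> p"
  interpret V: primeideal ?V ?P by (rule coord_ring_domain[OF W])
  interpret h: ring_hom_cring ?P "coord_ring B W" ?h
    unfolding coord_ring_def by (rule V.rcos_ring_hom_cring)
  have fin: "finite I" using I finite_subset by blast
  have supp: "u v = 0" if "u \<in> \<Union>W" "v \<notin> B" for u v
    using that W proj_closed_subset proj_space_memD(1) coord_vecs_zero
    unfolding irreducible_variety_def by (metis UnionE subsetD)
  have zero: "?h p = \<zero>\<^bsub>coord_ring B W\<^esub> \<longleftrightarrow> vanishes (\<Union>W) p" if "p \<in> polys B" for p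
  proof -
    have "?h p = \<zero>\<^bsub>coord_ring B W\<^esub> \<longleftrightarrow> p \<in> ?V"
      using that V.a_coset_join1[of ?V p] V.a_coset_join2[of p ?V] V.a_subgroup
      by (auto simp: coord_ring_def FactRing_def)
    with that show ?thesis by (simp add: vanishing_ideal_eq)
  qed
  have \<Psi>B: "\<Psi> $$ (i, j) \<in> polys B" if "i \<in> I" "j < dim_col \<Psi>" for i j
    using I that by (intro elements_mat_subsetD[OF \<Psi>]) auto
  have carr: "?h p \<in> carrier (coord_ring B W)" if "p \<in> polys B" for p
    using that by simp
  have entry: "reduce_mat B W \<Psi> $$ (i, j) = ?h (\<Psi> $$ (i, j))" if "i \<in> I" "j < dim_col \<Psi>" for i j
    using that I by (auto simp: reduce_mat_def)
  have term_carr: "?h p \<otimes>\<^bsub>coord_ring B W\<^esub> reduce_mat B W \<Psi> $$ (i, j) \<in> carrier (coord_ring B W)"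
    if "i \<in> I" "j < dim_col \<Psi>" "p \<in> polys B" for p i j
    unfolding entry[OF that(1,2)] by (intro h.S.m_closed carr that \<Psi>B)
  have sum_eq: "(\<Oplus>\<^bsub>coord_ring B W\<^esub>i\<in>I. ?h (p i) \<otimes>\<^bsub>coord_ring B W\<^esub> reduce_mat B W \<Psi> $$ (i, j)) =
      ?h (\<Sum>i\<in>I. p i * \<Psi> $$ (i, j))" if "\<And>i. i \<in> I \<Longrightarrow> p i \<in> polys B" "j < dim_col \<Psi>" for p j
  proof -
    have "(\<Sum>i\<in>I. p i * \<Psi> $$ (i, j)) = (\<Oplus>\<^bsub>?P\<^esub>i\<in>I. p i * \<Psi> $$ (i, j))"
      using fin that \<Psi>B by (subst poly_ring_finsum) (auto intro: polys_mult)
    also have "?h \<dots> = (\<Oplus>\<^bsub>coord_ring B W\<^esub>i\<in>I. (?h \<circ> (\<lambda>i. p i * \<Psi> $$ (i, j))) i)"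
      using that \<Psi>B by (intro h.hom_finsum) (auto intro: polys_mult)
    also have "\<dots> = (\<Oplus>\<^bsub>coord_ring B W\<^esub>i\<in>I. ?h (p i) \<otimes>\<^bsub>coord_ring B W\<^esub> reduce_mat B W \<Psi> $$ (i, j))"
    proof (rule h.S.finsum_cong')
      fix i assume i: "i \<in> I"
      show "(?h \<circ> (\<lambda>i. p i * \<Psi> $$ (i, j))) i = ?h (p i) \<otimes>\<^bsub>coord_ring B W\<^esub> reduce_mat B W \<Psi> $$ (i, j)"
        unfolding entry[OF i that(2)] comp_def
        using that(1)[OF i] \<Psi>B[OF i that(2)] h.hom_mult[of "p i" "\<Psi> $$ (i, j)"] by simp
    next
      show "(\<lambda>i. ?h (p i) \<otimes>\<^bsub>coord_ring B W\<^esub> reduce_mat B W \<Psi> $$ (i, j)) \<in> I \<rightarrow> carrier (coord_ring B W)"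
        using that by (intro Pi_I term_carr)
    qed simp
    finally show ?thesis by simp
  qed
  have dim: "dim_col (reduce_mat B W \<Psi>) = dim_col \<Psi>" by (simp add: reduce_mat_def)
  show ?thesis
  proof
    assume l: "rows_independent (coord_ring B W) (reduce_mat B W \<Psi>) I"
    show "independent_on (\<Union>W) I {..<dim_col \<Psi>} (\<lambda>i j. \<Psi> $$ (i, j))"
      unfolding independent_on_def
    proof (intro allI impI ballI)
      fix a i assume z: "\<forall>j\<in>{..<dim_col \<Psi>}. vanishes (\<Union>W) (\<Sum>i\<in>I. a i * \<Psi> $$ (i, j))" and i: "i \<in> I"
      \<comment> \<open>The given coefficients may involve variables outside \<open>B\<close>; their
        restrictions are elements of the ring with the same values on the cone.\<close>
      let ?p = "\<lambda>i. restrict_vars B (a i)"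
      have ev: "poly_eval t (?p i) = poly_eval t (a i)" if "t \<in> \<Union>W" for t i
        using supp[OF that] by (rule poly_eval_restrict_vars)
      have v: "vanishes (\<Union>W) (\<Sum>i\<in>I. ?p i * \<Psi> $$ (i, j))" if "j < dim_col \<Psi>" for j
        using z that ev by (simp add: vanishes_def poly_eval.hom_sum poly_eval.hom_mult)
      have "\<forall>j<dim_col (reduce_mat B W \<Psi>).
          (\<Oplus>\<^bsub>coord_ring B W\<^esub>i\<in>I. ?h (?p i) \<otimes>\<^bsub>coord_ring B W\<^esub> reduce_mat B W \<Psi> $$ (i, j)) = \<zero>\<^bsub>coord_ring B W\<^esub>"
        unfolding dim
      proof (intro allI impI)
        fix j assume j: "j < dim_col \<Psi>"
        have "(\<Sum>i\<in>I. ?p i * \<Psi> $$ (i, j)) \<in> polys B"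
          by (intro polys_sum polys_mult restrict_vars_polys \<Psi>B j)
        from zero[OF this] v[OF j]
        show "(\<Oplus>\<^bsub>coord_ring B W\<^esub>i\<in>I. ?h (?p i) \<otimes>\<^bsub>coord_ring B W\<^esub> reduce_mat B W \<Psi> $$ (i, j)) = \<zero>\<^bsub>coord_ring B W\<^esub>"
          unfolding sum_eq[OF restrict_vars_polys j] by blast
      qed
      moreover have "(\<lambda>i. ?h (?p i)) \<in> I \<rightarrow> carrier (coord_ring B W)"
        by (intro Pi_I carr restrict_vars_polys)
      from rows_independentD[OF l this] calculation i
      have "?h (?p i) = \<zero>\<^bsub>coord_ring B W\<^esub>" by simp
      then have "vanishes (\<Union>W) (?p i)" using zero restrict_vars_polys by blast
      then show "vanishes (\<Union>W) (a i)" using ev by (simp add: vanishes_def)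
    qed
  next
    assume r: "independent_on (\<Union>W) I {..<dim_col \<Psi>} (\<lambda>i j. \<Psi> $$ (i, j))"
    show "rows_independent (coord_ring B W) (reduce_mat B W \<Psi>) I"
      unfolding rows_independent_def dim
    proof (intro ballI impI)
      fix a i assume a: "a \<in> I \<rightarrow> carrier (coord_ring B W)" and i: "i \<in> I"
        and z: "\<forall>j<dim_col \<Psi>. (\<Oplus>\<^bsub>coord_ring B W\<^esub>i\<in>I. a i \<otimes>\<^bsub>coord_ring B W\<^esub> reduce_mat B W \<Psi> $$ (i, j)) =
          \<zero>\<^bsub>coord_ring B W\<^esub>"
      have "\<exists>p. p \<in> polys B \<and> a i = ?h p" if "i \<in> I" for i
      proof -
        have "a i \<in> a_rcosets\<^bsub>?P\<^esub> ?V"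
          using funcset_mem[OF a that] by (simp add: coord_ring_def FactRing_def)
        then show ?thesis unfolding A_RCOSETS_def' by auto
      qed
      then obtain p where p: "\<And>i. i \<in> I \<Longrightarrow> p i \<in> polys B \<and> a i = ?h (p i)" by metis
      have v: "vanishes (\<Union>W) (\<Sum>i\<in>I. p i * \<Psi> $$ (i, j))" if j: "j < dim_col \<Psi>" for j
      proof -
        have "(\<Oplus>\<^bsub>coord_ring B W\<^esub>i\<in>I. a i \<otimes>\<^bsub>coord_ring B W\<^esub> reduce_mat B W \<Psi> $$ (i, j)) =
          (\<Oplus>\<^bsub>coord_ring B W\<^esub>i\<in>I. ?h (p i) \<otimes>\<^bsub>coord_ring B W\<^esub> reduce_mat B W \<Psi> $$ (i, j))"
        proof (rule h.S.finsum_cong')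
          show "(\<lambda>i. ?h (p i) \<otimes>\<^bsub>coord_ring B W\<^esub> reduce_mat B W \<Psi> $$ (i, j)) \<in> I \<rightarrow> carrier (coord_ring B W)"
            using j p by (intro Pi_I term_carr) auto
        qed (use p in auto)
        with z j sum_eq[of p j] p have "?h (\<Sum>i\<in>I. p i * \<Psi> $$ (i, j)) = \<zero>\<^bsub>coord_ring B W\<^esub>" by simp
        then show ?thesis using zero p \<Psi>B j by (simp add: polys_sum polys_mult)
      qed
      have "vanishes (\<Union>W) (p i)"
        by (rule independent_onD[OF r _ i, where a = p], rule v) simp
      then show "a i = \<zero>\<^bsub>coord_ring B W\<^esub>" using p[OF i] zero by simp
    qed
  qed
qed

text \<open>Passes from the fraction field to the coordinate ring by clearing denominators, and from
  there to functions on the cone. Later arguments see the rank in this form.\<close>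

lemma rank_over_coord_ring_eq_iff:
  fixes W :: "'k::alg_closed_field point set"
  assumes W: "irreducible_variety B W" and \<Psi>: "elements_mat \<Psi> \<subseteq> polys B"
  shows "rank_over_domain (coord_ring B W) (reduce_mat B W \<Psi>) = r \<longleftrightarrow>
    (\<exists>I\<subseteq>{..<dim_row \<Psi>}. independent_on (\<Union>W) I {..<dim_col \<Psi>} (\<lambda>i j. \<Psi> $$ (i, j)) \<and> card I = r) \<and>
    (\<forall>I\<subseteq>{..<dim_row \<Psi>}. independent_on (\<Union>W) I {..<dim_col \<Psi>} (\<lambda>i j. \<Psi> $$ (i, j)) \<longrightarrow> card I \<le> r)"
proof -
  interpret D: domain "coord_ring B W" by (rule coord_ring_domain[OF W])
  interpret V: primeideal "vanishing_ideal B W" "poly_ring B" by (rule coord_ring_domain[OF W])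
  interpret h: ring_hom_cring "poly_ring B" "coord_ring B W" "\<lambda>p. vanishing_ideal B W +>\<^bsub>poly_ring B\<^esub> p"
    unfolding coord_ring_def by (rule V.rcos_ring_hom_cring)
  have "reduce_mat B W \<Psi> $$ (i, j) \<in> carrier (coord_ring B W)" if "i < dim_row \<Psi>" "j < dim_col \<Psi>" for i j
  proof -
    have "\<Psi> $$ (i, j) \<in> polys B" using that by (rule elements_mat_subsetD[OF \<Psi>])
    then show ?thesis using that by (simp add: reduce_mat_def)
  qed
  then have eq: "rows_independent (frac_field (coord_ring B W))
      (map_mat (\<lambda>a. frac_of (coord_ring B W) a \<one>\<^bsub>coord_ring B W\<^esub>) (reduce_mat B W \<Psi>)) I \<longleftrightarrow>
      independent_on (\<Union>W) I {..<dim_col \<Psi>} (\<lambda>i j. \<Psi> $$ (i, j))" if "I \<subseteq> {..<dim_row \<Psi>}" for I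
    using that rows_independent_reduce_mat[OF W that \<Psi>] D.rows_independent_frac_field[of I "reduce_mat B W \<Psi>"]
    by (simp add: reduce_mat_def)
  have dim: "dim_row (map_mat h (reduce_mat B W \<Psi>)) = dim_row \<Psi>" for h :: "'k mpoly set \<Rightarrow> 'a"
    by (simp add: reduce_mat_def)
  have cong: "(\<exists>I\<subseteq>S. P I \<and> card I = r) \<and> (\<forall>I\<subseteq>S. P I \<longrightarrow> card I \<le> r) \<longleftrightarrow>
      (\<exists>I\<subseteq>S. Q I \<and> card I = r) \<and> (\<forall>I\<subseteq>S. Q I \<longrightarrow> card I \<le> r)"
    if "\<And>I. I \<subseteq> S \<Longrightarrow> P I \<longleftrightarrow> Q I" for P Q and S :: "nat set"
    using that by (simp cong: conj_cong imp_cong)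
  show ?thesis
    unfolding rank_over_domain_def row_rank_eq_iff dim by (rule cong[OF eq])
qed

section \<open>Minors and independence\<close>

lemma poly_eval_det_mat:
  "poly_eval t (det (mat k k f)) = det (mat k k (\<lambda>ij. poly_eval t (f ij)))"
proof -
  have "map_mat (poly_eval t) (mat k k f) = mat k k (\<lambda>ij. poly_eval t (f ij))"
    by (rule eq_matI) auto
  then show ?thesis by (metis poly_eval.hom_det)
qed

text \<open>A relation between the rows comes from expanding, along its last column, the determinant of
  a maximal nonvanishing minor bordered by the next row and an arbitrary column.\<close>

lemma independent_on_minor:
  fixes M :: "nat \<Rightarrow> 'j \<Rightarrow> 'k::comm_ring_1 mpoly"
  assumes "T \<noteq> {}" "independent_on T {..<k} C M"
  shows "\<exists>cs. (\<forall>i<k. cs i \<in> C) \<and> \<not> vanishes T (det (mat k k (\<lambda>(i, j). M i (cs j))))"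
  using assms(2)
proof (induction k)
  case 0
  have "det (mat 0 0 (\<lambda>(i, j). M i (cs j))) = 1" for cs by (rule det_dim_zero) simp
  then show ?case using assms(1) by (auto simp: vanishes_def)
next
  case (Suc k)
  have "independent_on T {..<k} C M"
    unfolding independent_on_def
  proof (intro allI impI ballI)
    fix a i assume z: "\<forall>j\<in>C. vanishes T (\<Sum>i<k. a i * M i j)" and i: "i \<in> {..<k}"
    \<comment> \<open>A relation between the first \<open>k\<close> rows is one between all
      \<open>Suc k\<close>, with coefficient 0 on the last.\<close>
    have "vanishes T ((a(k := 0)) i)"
      by (rule independent_onD[OF Suc.prems]) (use z i in auto)
    with i show "vanishes T (a i)" by simp
  qed
  with Suc.IH obtain cs where cs: "\<And>i. i < k \<Longrightarrow> cs i \<in> C"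
    and nv: "\<not> vanishes T (det (mat k k (\<lambda>(i, j). M i (cs j))))" by blast
  define A where "A j = mat (Suc k) (Suc k) (\<lambda>(i, l). M i (if l < k then cs l else j))" for j
  \<comment> \<open>The cofactors along the last column. They do not involve the column
    \<open>j\<close> placed there, so the same coefficients serve for all \<open>j\<close>.\<close>
  define a where "a i = (-1) ^ (i + k) *
    det (mat k k (\<lambda>(i', l). M (if i' < i then i' else Suc i') (cs l)))" for i
  have A: "A j \<in> carrier_mat (Suc k) (Suc k)" for j by (simp add: A_def)
  have cof: "cofactor (A j) i k = a i" for i j
  proof -
    have "mat_delete (A j) i k = mat k k (\<lambda>(i', l). M (if i' < i then i' else Suc i') (cs l))"
      by (rule eq_matI) (auto simp: mat_delete_def A_def)
    then show ?thesis by (simp add: cofactor_def a_def)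
  qed
  have det_A: "det (A j) = (\<Sum>i<Suc k. a i * M i j)" for j
    unfolding laplace_expansion_column[OF A lessI, of j] cof
    by (rule sum.cong) (auto simp: A_def mult.commute)
  have "a k = det (mat k k (\<lambda>(i, j). M i (cs j)))"
  proof -
    have "mat k k (\<lambda>(i', l). M (if i' < k then i' else Suc i') (cs l)) = mat k k (\<lambda>(i, j). M i (cs j))"
      by (rule eq_matI) auto
    then show ?thesis by (simp add: a_def)
  qed
  with nv have "\<not> vanishes T (a k)" by simp
  \<comment> \<open>If every bordered minor vanished, \<open>a\<close> would be a relation whose
    coefficient at row \<open>k\<close>, the previous minor, does not vanish.\<close>
  then have "\<not> (\<forall>j\<in>C. vanishes T (det (A j)))"
    unfolding det_A using independent_onD[OF Suc.prems, of a k] by blast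
  then obtain j where j: "j \<in> C" "\<not> vanishes T (det (A j))" by blast
  have "mat (Suc k) (Suc k) (\<lambda>(i, l). M i ((\<lambda>l. if l < k then cs l else j) l)) = A j"
    by (simp add: A_def)
  with j cs show ?case by (intro exI[of _ "\<lambda>l. if l < k then cs l else j"]) auto
qed

lemma det_nonzero_rows_independent:
  fixes N :: "nat \<Rightarrow> nat \<Rightarrow> 'a::idom"
  assumes "det (mat k k (\<lambda>(i, j). N i j)) \<noteq> 0" "\<And>j. j < k \<Longrightarrow> (\<Sum>i<k. v i * N i j) = 0" "i < k"
  shows "v i = 0"
proof (rule ccontr)
  assume vi: "v i \<noteq> 0"
  let ?A = "mat k k (\<lambda>(i, j). N i j)"
  have "?A\<^sup>T *\<^sub>v vec k v = 0\<^sub>v k"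
  proof (rule eq_vecI)
    fix j assume "j < dim_vec (0\<^sub>v k :: 'a vec)"
    then have j: "j < k" by simp
    then have "(?A\<^sup>T *\<^sub>v vec k v) $ j = (\<Sum>i<k. N i j * v i)"
      by (simp add: scalar_prod_def atLeast0LessThan)
    with assms(2)[OF j] j show "(?A\<^sup>T *\<^sub>v vec k v) $ j = 0\<^sub>v k $ j" by (simp add: mult.commute)
  qed simp
  moreover have "vec k v \<noteq> 0\<^sub>v k"
    using vi assms(3) by (metis index_vec index_zero_vec(1))
  ultimately have "det ?A\<^sup>T = 0"
    by (subst det_0_iff_vec_prod_zero[of _ k]) (auto intro!: exI[of _ "vec k v"])
  then show False using assms(1) det_transpose[of ?A k] by simp
qed

text \<open>\<open>D\<close> is the minor found by \<open>independent_on_minor\<close>. Its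
  variables and degree are recorded so that density of the image can be applied to it, and its
  nonvanishing gives independence at any point \<open>t\<close>, in \<open>T\<close> or not.\<close>

lemma independent_on_generic:
  fixes M :: "nat \<Rightarrow> 'j \<Rightarrow> 'k::idom mpoly"
  assumes "T \<noteq> {}" "independent_on T {..<k} C M"
  shows "\<exists>D. \<not> vanishes T D \<and>
    (\<forall>V. (\<forall>i<k. \<forall>j\<in>C. M i j \<in> polys V) \<longrightarrow> D \<in> polys V) \<and>
    (\<forall>B d. (\<forall>i<k. \<forall>j\<in>C. homogeneous_in B (d i) (M i j)) \<longrightarrow> homogeneous_in B (\<Sum>i<k. d i) D) \<and>
    (\<forall>t v. poly_eval t D \<noteq> 0 \<longrightarrow> (\<forall>j\<in>C. (\<Sum>i<k. v i * poly_eval t (M i j)) = 0) \<longrightarrow> (\<forall>i<k. v i = 0))"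
proof -
  from independent_on_minor[OF assms] obtain cs where cs: "\<And>i. i < k \<Longrightarrow> cs i \<in> C"
    and nv: "\<not> vanishes T (det (mat k k (\<lambda>(i, j). M i (cs j))))" by blast
  let ?D = "det (mat k k (\<lambda>(i, j). M i (cs j)))"
  have "?D \<in> polys V" if "\<forall>i<k. \<forall>j\<in>C. M i j \<in> polys V" for V
    by (rule polys_det[of _ k]) (use that cs in auto)
  moreover have "homogeneous_in B (\<Sum>i<k. d i) ?D"
    if "\<forall>i<k. \<forall>j\<in>C. homogeneous_in B (d i) (M i j)" for B d
    by (rule homogeneous_in_det) (use that cs in auto)
  moreover have "v i = 0" if ne: "poly_eval t ?D \<noteq> 0"
    and z: "\<forall>j\<in>C. (\<Sum>i<k. v i * poly_eval t (M i j)) = 0" and i: "i < k" for t v i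
  proof (rule det_nonzero_rows_independent[OF _ _ i, where N = "\<lambda>i j. poly_eval t (M i (cs j))"])
    show "det (mat k k (\<lambda>(i, j). poly_eval t (M i (cs j)))) \<noteq> 0"
      using ne unfolding poly_eval_det_mat by (simp add: case_prod_unfold)
  qed (use z cs in auto)
  ultimately show ?thesis using nv by (intro exI[of _ ?D]) simp
qed

text \<open>Independent columns contain a \<open>k\<close> by \<open>k\<close> minor
  \<open>D\<close> that is not identically zero on \<open>T\<close>, and the rows of this minor are
  independent wherever \<open>D\<close> is nonzero. Irreducibility extends the conclusion to all of
  \<open>T\<close>.\<close>

lemma independent_columns_rows:
  fixes M :: "'i \<Rightarrow> 'j \<Rightarrow> 'k::idom mpoly"
  assumes T: "irreducible_cone T" and kc: "\<And>l. l < k \<Longrightarrow> kc l \<in> C"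
    and ind: "independent_on T {..<k} R (\<lambda>l i. M i (kc l))"
  obtains I where "I \<subseteq> R" "finite I" "card I = k" "independent_on T I C M"
proof -
  have "T \<noteq> {}" using T by (simp add: irreducible_cone_def)
  from independent_on_minor[OF this ind] obtain rs where rs: "\<And>l. l < k \<Longrightarrow> rs l \<in> R"
    and nv: "\<not> vanishes T (det (mat k k (\<lambda>(l, i). M (rs i) (kc l))))" by blast
  let ?D = "det (mat k k (\<lambda>(l, i). M (rs i) (kc l)))"
  have zero: "v i = 0" if "poly_eval t ?D \<noteq> 0" "\<And>l. l < k \<Longrightarrow> (\<Sum>i<k. v i * poly_eval t (M (rs i) (kc l))) = 0" "i < k"
    for t v i
  proof (rule det_nonzero_rows_independent[where N = "\<lambda>i l. poly_eval t (M (rs i) (kc l))", OF _ that(2,3)])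
    have "(mat k k (\<lambda>(i, l). poly_eval t (M (rs i) (kc l))))\<^sup>T = mat k k (\<lambda>(l, i). poly_eval t (M (rs i) (kc l)))"
      by (rule eq_matI) auto
    then have "det (mat k k (\<lambda>(i, l). poly_eval t (M (rs i) (kc l)))) = poly_eval t ?D"
      unfolding poly_eval_det_mat using det_transpose[of "mat k k (\<lambda>(i, l). poly_eval t (M (rs i) (kc l)))" k]
      by (simp add: case_prod_unfold)
    with that(1) show "det (mat k k (\<lambda>(i, l). poly_eval t (M (rs i) (kc l)))) \<noteq> 0" by simp
  qed
  from nv obtain t0 where t0: "t0 \<in> T" "poly_eval t0 ?D \<noteq> 0" by (rule not_vanishesE)
  \<comment> \<open>A repeated row would be a relation with coefficients 1 and -1 at
    \<open>t0\<close>, where \<open>D\<close> is nonzero; so the rows are \<open>k\<close> different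
    ones.\<close>
  have inj: "inj_on rs {..<k}"
  proof (rule inj_onI, rule ccontr)
    fix i i' assume i: "i \<in> {..<k}" "i' \<in> {..<k}" and eq: "rs i = rs i'" and ne: "i \<noteq> i'"
    let ?v = "\<lambda>x. (if x = i then 1 else 0) - (if x = i' then 1 else 0) :: 'k"
    have "?v i = 0"
    proof (rule zero[OF t0(2), where v = ?v])
      fix l
      show "(\<Sum>x<k. ?v x * poly_eval t0 (M (rs x) (kc l))) = 0"
        using i eq by (simp add: left_diff_distrib sum_subtractf if_distrib[of "\<lambda>x. x * _"] sum.delta cong: if_cong)
    qed (use i in simp)
    with ne show False by simp
  qed
  have "independent_on T (rs ` {..<k}) C M"
    unfolding independent_on_def
  proof (intro allI impI ballI)
    fix a x assume z: "\<forall>j\<in>C. vanishes T (\<Sum>i\<in>rs ` {..<k}. a i * M i j)" and x: "x \<in> rs ` {..<k}"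
    then obtain i where i: "i < k" "x = rs i" by auto
    have "poly_eval t (a x) * poly_eval t ?D = 0" if t: "t \<in> T" for t
    proof (cases "poly_eval t ?D = 0")
      case False
      have "(\<Sum>i<k. poly_eval t (a (rs i)) * poly_eval t (M (rs i) (kc l))) = 0" if "l < k" for l
      proof -
        have "poly_eval t (\<Sum>i\<in>rs ` {..<k}. a i * M i (kc l)) = 0"
          using z t kc[OF that] by (auto simp: vanishes_def)
        then show ?thesis
          by (simp add: sum.reindex[OF inj] poly_eval.hom_sum poly_eval.hom_mult)
      qed
      from zero[OF False this i(1)] show ?thesis by (simp add: i(2))
    qed simp
    from irreducible_coneD[OF T this] nv show "vanishes T (a x)" by blast
  qed
  moreover have "card (rs ` {..<k}) = k" using inj by (simp add: card_image)
  ultimately show thesis using rs by (intro that[of "rs ` {..<k}"]) auto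
qed

lemma independent_on_reindex:
  fixes M :: "'i \<Rightarrow> 'j \<Rightarrow> 'k::comm_ring_1 mpoly"
  assumes "bij_betw rs A I" "independent_on T I C M"
  shows "independent_on T A C (\<lambda>i. M (rs i))"
  unfolding independent_on_def
proof (intro allI impI ballI)
  fix a i assume z: "\<forall>j\<in>C. vanishes T (\<Sum>i\<in>A. a i * M (rs i) j)" and i: "i \<in> A"
  let ?b = "\<lambda>x. a (the_inv_into A rs x)"
  have inv: "the_inv_into A rs (rs i) = i" if "i \<in> A" for i
    using assms(1) that by (simp add: bij_betw_def the_inv_into_f_f)
  have eq: "(\<Sum>x\<in>I. ?b x * M x j) = (\<Sum>i\<in>A. a i * M (rs i) j)" for j
    using inv by (subst sum.reindex_bij_betw[OF assms(1), symmetric]) simp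
  have "vanishes T (?b (rs i))"
  proof (rule independent_onD[OF assms(2), where a = ?b])
    show "rs i \<in> I" using assms(1) i by (auto simp: bij_betw_def)
  qed (use z eq in simp)
  with i inv show "vanishes T (a i)" by simp
qed

lemma independent_on_subset:
  fixes M :: "'i \<Rightarrow> 'j \<Rightarrow> 'k::comm_ring_1 mpoly"
  assumes "independent_on T I C M" "I' \<subseteq> I" "finite I"
  shows "independent_on T I' C M"
  unfolding independent_on_def
proof (intro allI impI ballI)
  fix a i assume z: "\<forall>j\<in>C. vanishes T (\<Sum>i\<in>I'. a i * M i j)" and i: "i \<in> I'"
  have "(\<Sum>x\<in>I. (if x \<in> I' then a x else 0) * M x j) = (\<Sum>x\<in>I'. a x * M x j)" for j
    by (rule sum.mono_neutral_cong_right) (use assms in auto)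
  with z have "vanishes T (if i \<in> I' then a i else 0)"
    using assms(2) i by (intro independent_onD[OF assms(1), where a = "\<lambda>x. if x \<in> I' then a x else 0"]) auto
  with i show "vanishes T (a i)" by simp
qed

section \<open>Signed maximal minors\<close>

lemma pick_compl_singleton: "pick (- {j}) i = (if i < j then i else Suc i)"
proof -
  let ?i = "if i < j then i else Suc i"
  have "{a \<in> - {j}. a < ?i} = (if i < j then {..<i} else {..<Suc i} - {j})" by auto
  then have "card {a \<in> - {j}. a < ?i} = i" by simp
  then show ?thesis using pick_card_in_set[of ?i "- {j}"] by (simp split: if_splits)
qed

lemma submatrix_delete_column:
  assumes "I \<subseteq> {..<dim_row A}" "card I = N" "dim_col A = Suc N" "j \<le> N"
  shows "submatrix A I (- {j}) = mat N N (\<lambda>(i, l). A $$ (pick I i, if l < j then l else Suc l))"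
proof -
  have "{i. i < dim_row A \<and> i \<in> I} = I" using assms(1) by auto
  moreover have "{l. l < dim_col A \<and> l \<in> - {j}} = {..N} - {j}" using assms(3) by auto
  moreover have "card ({..N} - {j}) = N" using assms(4) by simp
  ultimately show ?thesis using assms(2) by (simp add: submatrix_def pick_compl_singleton)
qed

text \<open>The rows \<open>I\<close> of \<open>A\<close> with \<open>c\<close> added as last row.
  Expansion along that row pairs \<open>c\<close> with the signed minors; its index \<open>N\<close>
  accounts for the global sign in \<open>det_border\<close>.\<close>

definition border :: "'a mat \<Rightarrow> nat set \<Rightarrow> nat \<Rightarrow> (nat \<Rightarrow> 'a) \<Rightarrow> 'a mat" where
  "border A I N c = mat (Suc N) (Suc N) (\<lambda>(i, j). if i < N then A $$ (pick I i, j) else c j)"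

lemma det_border:
  fixes A :: "'a::comm_ring_1 mat"
  assumes "I \<subseteq> {..<dim_row A}" "card I = N" "dim_col A = Suc N"
  shows "det (border A I N c) = (-1) ^ N * (\<Sum>j\<le>N. c j * signed_minor A I j)"
proof -
  have B: "border A I N c \<in> carrier_mat (Suc N) (Suc N)" by (simp add: border_def)
  have cof: "cofactor (border A I N c) N j = (-1) ^ N * signed_minor A I j" if "j \<le> N" for j
  proof -
    have "mat_delete (border A I N c) N j = submatrix A I (- {j})"
      unfolding submatrix_delete_column[OF assms that]
      by (rule eq_matI) (use that in \<open>auto simp: mat_delete_def border_def\<close>)
    then show ?thesis by (simp add: cofactor_def signed_minor_def power_add)
  qed
  have "det (border A I N c) = (\<Sum>j<Suc N. c j * ((-1) ^ N * signed_minor A I j))"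
    unfolding laplace_expansion_row[OF B lessI]
    by (rule sum.cong) (auto simp: cof less_Suc_eq_le, simp add: border_def)
  then show ?thesis by (simp add: sum_distrib_left lessThan_Suc_atMost mult.left_commute)
qed

lemma border_mult_vec:
  fixes A :: "'a::comm_ring_1 mat"
  assumes "i < Suc N"
  shows "(border A I N c *\<^sub>v vec (Suc N) x) $ i =
    (if i < N then \<Sum>j\<le>N. A $$ (pick I i, j) * x j else \<Sum>j\<le>N. c j * x j)"
  using assms
  by (simp add: border_def scalar_prod_def atLeast0LessThan lessThan_Suc_atMost)

lemma pick_mem: "finite I \<Longrightarrow> i < card I \<Longrightarrow> pick I i \<in> I"
  by (rule pick_in_set_le)

lemma bij_betw_pick:
  assumes "finite I"
  shows "bij_betw (pick I) {..<card I} I"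
proof -
  have inj: "inj_on (pick I) {..<card I}"
    by (rule inj_onI) (metis lessThan_iff nat_neq_iff pick_mono_le)
  have "pick I ` {..<card I} \<subseteq> I" using pick_mem[OF assms] by auto
  then have "pick I ` {..<card I} = I"
    using assms card_image[OF inj] by (intro card_subset_eq) auto
  with inj show ?thesis by (simp add: bij_betw_def)
qed

text \<open>The bordering row is \<open>x i\<close> times the unit vector at \<open>j\<close> minus
  \<open>x j\<close> times the one at \<open>i\<close>. It annihilates \<open>x\<close>, as do the
  rows \<open>I\<close>, so for nonzero \<open>x\<close> the bordered determinant is 0, and its
  expansion is the equality.\<close>

lemma signed_minor_proportional:
  fixes A :: "'a::idom mat"
  assumes I: "I \<subseteq> {..<dim_row A}" "card I = N" "dim_col A = Suc N"
    and ker: "\<And>i. i \<in> I \<Longrightarrow> (\<Sum>j\<le>N. A $$ (i, j) * x j) = 0" and ij: "i \<le> N" "j \<le> N"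
  shows "x i * signed_minor A I j = x j * signed_minor A I i"
proof (cases "\<forall>l\<le>N. x l = 0")
  case False
  have fin: "finite I" using I(1) finite_subset by blast
  define c where "c l = (if l = j then x i else 0) - (if l = i then x j else 0)" for l
  have c: "(\<Sum>l\<le>N. c l * y l) = x i * y j - x j * y i" for y
    using ij by (simp add: c_def left_diff_distrib sum_subtractf if_distrib[of "\<lambda>x. x * _"] sum.delta cong: if_cong)
  have B: "border A I N c \<in> carrier_mat (Suc N) (Suc N)" by (simp add: border_def)
  have "border A I N c *\<^sub>v vec (Suc N) x = 0\<^sub>v (Suc N)"
  proof (rule eq_vecI)
    fix l assume "l < dim_vec (0\<^sub>v (Suc N) :: 'a vec)"
    then have l: "l < Suc N" by simp
    show "(border A I N c *\<^sub>v vec (Suc N) x) $ l = 0\<^sub>v (Suc N) $ l"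
      unfolding border_mult_vec[OF l] using l ker[OF pick_mem[OF fin]] I(2) by (simp add: c mult.commute)
  qed (simp add: border_def)
  moreover have "vec (Suc N) x \<noteq> 0\<^sub>v (Suc N)"
    using False by (metis index_vec index_zero_vec(1) less_Suc_eq_le)
  ultimately have "det (border A I N c) = 0"
    by (subst det_0_iff_vec_prod_zero[OF B]) (auto intro!: exI[of _ "vec (Suc N) x"])
  then show ?thesis by (simp add: det_border[OF I] c)
qed (use ij in simp)

lemma signed_minor_nonzero:
  fixes A :: "'a::idom mat"
  assumes I: "I \<subseteq> {..<dim_row A}" "card I = N" "dim_col A = Suc N"
    and ind: "\<And>v i. (\<And>j. j \<le> N \<Longrightarrow> (\<Sum>i<N. v i * A $$ (pick I i, j)) = 0) \<Longrightarrow> i < N \<Longrightarrow> v i = 0"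
  shows "\<exists>j\<le>N. signed_minor A I j \<noteq> 0"
proof (rule ccontr)
  assume "\<not> ?thesis"
  then have det0: "det (border A I N c) = 0" for c
    unfolding det_border[OF I] by simp
  have B: "border A I N c \<in> carrier_mat (Suc N) (Suc N)" for c by (simp add: border_def)
  text \<open>A nonzero \<open>x\<close> in the kernel of \<open>A\<^sub>I\<close> has an entry \<open>x\<^sub>j \<noteq> 0\<close>, so the \<open>j\<close>-th unit vector is
    independent of the rows \<open>A\<^sub>I\<close>.\<close>
  from det0[of "\<lambda>_. 0"] obtain y where y: "y \<in> carrier_vec (Suc N)" "y \<noteq> 0\<^sub>v (Suc N)"
      "border A I N (\<lambda>_. 0) *\<^sub>v y = 0\<^sub>v (Suc N)"
    using det_0_iff_vec_prod_zero[OF B] by blast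
  define x where "x j = y $ j" for j
  have yx: "y = vec (Suc N) x" using y(1) by (intro eq_vecI) (auto simp: x_def)
  have ker: "(\<Sum>j\<le>N. A $$ (pick I i, j) * x j) = 0" if "i < N" for i
  proof -
    have "(border A I N (\<lambda>_. 0) *\<^sub>v vec (Suc N) x) $ i = 0"
      using y(3) that unfolding yx by simp
    then show ?thesis using that by (subst (asm) border_mult_vec) auto
  qed
  obtain j where j: "j \<le> N" "x j \<noteq> 0"
    using y(1,2) by (metis (no_types, lifting) carrier_vecD eq_vecI index_zero_vec(1,2) less_Suc_eq_le x_def)
  let ?c = "\<lambda>l. if l = j then 1 else 0 :: 'a"
  have BT: "(border A I N ?c)\<^sup>T \<in> carrier_mat (Suc N) (Suc N)" by (simp add: border_def)
  have "det (border A I N ?c)\<^sup>T = 0" using det_transpose[OF B] det0 by simp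
  then obtain w where w: "w \<in> carrier_vec (Suc N)" "w \<noteq> 0\<^sub>v (Suc N)"
      "(border A I N ?c)\<^sup>T *\<^sub>v w = 0\<^sub>v (Suc N)"
    using det_0_iff_vec_prod_zero[OF BT] by blast
  have rel: "(\<Sum>i<N. w $ i * A $$ (pick I i, l)) + w $ N * ?c l = 0" if l: "l \<le> N" for l
  proof -
    have "((border A I N ?c)\<^sup>T *\<^sub>v w) $ l = (\<Sum>i<Suc N. border A I N ?c $$ (i, l) * w $ i)"
      using l w(1) by (simp add: scalar_prod_def atLeast0LessThan border_def)
    also have "\<dots> = (\<Sum>i<N. w $ i * A $$ (pick I i, l)) + w $ N * ?c l"
      using l by (simp add: border_def mult.commute)
    finally show ?thesis using w(3) l by simp
  qed
  \<comment> \<open>Pairing the relation with \<open>x\<close> removes the rows of \<open>A\<close>,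
    whose kernel contains \<open>x\<close>, and leaves \<open>w $ N * x j\<close>.\<close>
  have "0 = (\<Sum>l\<le>N. ((\<Sum>i<N. w $ i * A $$ (pick I i, l)) + w $ N * ?c l) * x l)"
    using rel by simp
  also have "\<dots> = (\<Sum>l\<le>N. \<Sum>i<N. w $ i * (A $$ (pick I i, l) * x l)) + (\<Sum>l\<le>N. w $ N * ?c l * x l)"
    by (simp add: distrib_right sum.distrib sum_distrib_right mult.assoc)
  also have "(\<Sum>l\<le>N. \<Sum>i<N. w $ i * (A $$ (pick I i, l) * x l)) =
      (\<Sum>i<N. w $ i * (\<Sum>l\<le>N. A $$ (pick I i, l) * x l))"
    unfolding sum_distrib_left by (rule sum.swap)
  also have "\<dots> = 0" using ker by simp
  also have "(\<Sum>l\<le>N. w $ N * ?c l * x l) = w $ N * x j"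
    using j(1) by (simp add: if_distrib[of "\<lambda>x. _ * x * _"] sum.delta cong: if_cong)
  finally have wN: "w $ N = 0" using j(2) by simp
  have "w $ i = 0" if "i < N" for i
    by (rule ind[OF _ that]) (use rel wN in simp)
  with wN have "w $ i = 0" if "i < Suc N" for i using that by (cases "i = N") auto
  with w(1,2) show False by (metis carrier_vecD eq_vecI index_zero_vec(1,2))
qed

lemma poly_eval_signed_minor:
  assumes "I \<subseteq> {..<dim_row A}" "card I = N" "dim_col A = Suc N" "j \<le> N"
  shows "poly_eval t (signed_minor A I j) = signed_minor (map_mat (poly_eval t) A) I j"
proof -
  have fin: "finite I" using assms(1) finite_subset by blast
  have "map_mat (poly_eval t) (submatrix A I (- {j})) = submatrix (map_mat (poly_eval t) A) I (- {j})"
    using pick_mem[OF fin] assms subsetD[OF assms(1) pick_mem[OF fin]]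
    by (subst (1 2) submatrix_delete_column[where N = N]) (auto intro!: eq_matI)
  then show ?thesis
    unfolding signed_minor_def poly_eval.hom_mult poly_eval.hom_power poly_eval.hom_uminus poly_eval.hom_one
    by (simp flip: poly_eval.hom_det)
qed

lemma signed_minor_polys:
  assumes "I \<subseteq> {..<dim_row A}" "card I = N" "dim_col A = Suc N" "j \<le> N" "elements_mat A \<subseteq> polys V"
  shows "signed_minor A I j \<in> polys V"
proof -
  have fin: "finite I" using assms(1) finite_subset by blast
  have "A $$ (pick I i, if l < j then l else Suc l) \<in> polys V" if "i < N" "l < N" for i l
    using pick_mem[OF fin, of i] that assms(1-4) by (intro elements_mat_subsetD[OF assms(5)]) auto
  then have "det (submatrix A I (- {j})) \<in> polys V"
    unfolding submatrix_delete_column[OF assms(1-4)] by (intro polys_det[of _ N]) auto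
  then show ?thesis
    unfolding signed_minor_def by (intro polys_mult polys_power polys_uminus polys_one)
qed

text \<open>Rows may differ in degree, but a maximal minor takes one entry from each row in
  \<open>I\<close>. The degree is therefore independent of \<open>j\<close>, as a tuple defining a
  rational map requires.\<close>

lemma signed_minor_homogeneous:
  assumes "I \<subseteq> {..<dim_row A}" "card I = N" "dim_col A = Suc N" "j \<le> N"
    and "\<And>i j. i < dim_row A \<Longrightarrow> j < dim_col A \<Longrightarrow> homogeneous_in B (d i) (A $$ (i, j))"
  shows "homogeneous_in B (\<Sum>i<N. d (pick I i)) (signed_minor A I j)"
proof -
  have fin: "finite I" using assms(1) finite_subset by blast
  have "homogeneous_in B (d (pick I i)) (A $$ (pick I i, if l < j then l else Suc l))" if "i < N" "l < N" for i l
    using pick_mem[OF fin, of i] that assms(1-4) by (intro assms(5)) auto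
  then have "homogeneous_in B (\<Sum>i<N. d (pick I i)) (det (submatrix A I (- {j})))"
    unfolding submatrix_delete_column[OF assms(1-4)] by (intro homogeneous_in_det) auto
  moreover have "homogeneous_in B (0 * j) ((- 1) ^ j)"
    by (intro homogeneous_in_power homogeneous_in_uminus homogeneous_in_one)
  ultimately show ?thesis
    unfolding signed_minor_def using homogeneous_in_mult by fastforce
qed

section \<open>Forms on the graph of a rational map\<close>

lemma poly_subst_cong:
  assumes "p \<in> polys V" "\<And>v. v \<in> V \<Longrightarrow> \<sigma> v = \<tau> v"
  shows "poly_subst \<sigma> p = poly_subst \<tau> p"
  unfolding poly_subst_def
  by (intro sum.cong prod.cong refl arg_cong2[where f = "(*)"] arg_cong2[where f = "(^)"])
     (use assms in \<open>auto simp: polys_def\<close>)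

lemma homogeneous_in_disjoint:
  assumes "p \<in> polys V" "V \<inter> B = {}"
  shows "homogeneous_in B 0 p"
  unfolding homogeneous_in_def
proof
  fix \<mu> assume "\<mu> \<in> Poly_Mapping.keys p"
  with assms have "Poly_Mapping.keys \<mu> \<inter> B = {}" by (auto simp: polys_def)
  then show "(\<Sum>v\<in>Poly_Mapping.keys \<mu> \<inter> B. Poly_Mapping.lookup \<mu> v) = 0" by simp
qed

lemma tuple_value_coord_vecs: "tuple_defined C g t \<Longrightarrow> tuple_value C g t \<in> coord_vecs C"
  by (auto simp: tuple_defined_def coord_vecs_def tuple_value_def)

lemma proj_point_eqI:
  assumes "u \<in> coord_vecs B" "w \<in> coord_vecs B" "\<And>v v'. v \<in> B \<Longrightarrow> v' \<in> B \<Longrightarrow> u v * w v' = u v' * w v"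
  shows "proj_point B u = proj_point B w"
proof -
  from assms(1) obtain v0 where v0: "v0 \<in> B" "u v0 \<noteq> 0" by (auto simp: coord_vecs_def)
  from assms(2) obtain v1 where v1: "v1 \<in> B" "w v1 \<noteq> 0" by (auto simp: coord_vecs_def)
  define c where "c = w v0 / u v0"
  have eq: "w v = c * u v" for v
  proof (cases "v \<in> B")
    case True
    from assms(3)[OF v0(1) this] v0(2) show ?thesis by (simp add: c_def field_simps)
  next
    case False
    with assms(1,2) show ?thesis by (simp add: coord_vecs_zero)
  qed
  with v1(2) have "c \<noteq> 0" by auto
  with eq assms(1,2) show ?thesis by (subst proj_point_eq_iff) (auto simp: fun_eq_iff)
qed

locale product_map =
  fixes n m s :: nat and X Y Z :: "'k::alg_closed_field point set" and f :: "nat \<Rightarrow> 'k mpoly"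
  assumes irrX: "irreducible_variety (xs n) X" and irrY: "irreducible_variety (ys m) Y"
    and irrZ: "irreducible_variety (zs s) Z"
    and f: "product_rational_map n m s X Y Z f"
begin

abbreviation E :: "'k coord_vec set" where "E \<equiv> sum_cone (\<Union>X) (\<Union>Y)"
abbreviation T :: "'k coord_vec set" where "T \<equiv> \<Union>Z"
abbreviation F :: "'k coord_vec \<Rightarrow> 'k coord_vec" where "F \<equiv> tuple_value (zs s) f"

definition pull :: "'k mpoly \<Rightarrow> 'k mpoly" where
  "pull = poly_subst (\<lambda>v. if v \<in> zs s then f (snd v) else Var v)"

text \<open>The point \<open>(x, y, f(x, y))\<close> of the graph. Replacing \<open>z\<close> by
  \<open>f\<close> and evaluating at \<open>e\<close> amounts to evaluating here, so the generators
  of the Rees ideal vanish at these points.\<close>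

definition graph_point :: "'k coord_vec \<Rightarrow> 'k coord_vec" where
  "graph_point e = (\<lambda>v. if v \<in> zs s then F e v else e v)"

lemma X_sub: "X \<subseteq> proj_space (xs n)" and Y_sub: "Y \<subseteq> proj_space (ys m)" and Z_sub: "Z \<subseteq> proj_space (zs s)"
  using irrX irrY irrZ proj_closed_subset by (auto simp: irreducible_variety_def)

lemma E_irr: "irreducible_cone E"
  by (intro irreducible_cone_sum irreducible_variety_cone[OF irrX] irreducible_variety_cone[OF irrY])

lemma T_irr: "irreducible_cone T"
  by (rule irreducible_variety_cone[OF irrZ])

lemma X_coord: "u \<in> \<Union>X \<Longrightarrow> u \<in> coord_vecs (xs n)"
  and Y_coord: "w \<in> \<Union>Y \<Longrightarrow> w \<in> coord_vecs (ys m)"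
  and Z_coord: "t \<in> T \<Longrightarrow> t \<in> coord_vecs (zs s)"
  using X_sub Y_sub Z_sub proj_space_memD(1) by blast+

lemma f_polys: "i \<le> s \<Longrightarrow> f i \<in> polys (xs n \<union> ys m)"
  using f by (auto simp: product_rational_map_def)

lemma f_homogeneous:
  obtains d e where "\<And>i. i \<le> s \<Longrightarrow> homogeneous_in (xs n) d (f i)" "\<And>i. i \<le> s \<Longrightarrow> homogeneous_in (ys m) e (f i)"
  using f by (auto simp: product_rational_map_def)

lemma f_nonzero: "\<exists>i\<le>s. \<not> vanishes E (f i)"
proof -
  from f obtain i where i: "i \<le> s" "f i \<notin> product_ideal n m X Y"
    by (auto simp: product_rational_map_def)
  with f_polys[OF i(1)] show ?thesis by (auto simp: mem_product_ideal_iff[OF X_sub Y_sub])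
qed

lemma F_in_T:
  assumes "e \<in> E" "tuple_defined (zs s) f e"
  shows "F e \<in> T" "proj_point (zs s) (F e) \<in> Z"
proof -
  from assms(1) obtain u w P Q where *: "u \<in> P" "P \<in> X" "w \<in> Q" "Q \<in> Y" "e = (\<lambda>v. u v + w v)"
    by (auto simp: sum_cone_def)
  then show 1: "proj_point (zs s) (F e) \<in> Z"
    using f assms(2) unfolding product_rational_map_def by blast
  show "F e \<in> T"
    using proj_point_self[OF tuple_value_coord_vecs[OF assms(2)]] 1 by blast
qed

lemma poly_eval_pull: "poly_eval e (pull q) = poly_eval (graph_point e) q"
proof -
  have "(\<lambda>v. poly_eval e (if v \<in> zs s then f (snd v) else Var v)) = graph_point e"
    by (auto simp: graph_point_def tuple_value_def)
  then show ?thesis by (simp add: pull_def poly_eval_subst)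
qed

lemma poly_eval_graph_point: "q \<in> polys (zs s) \<Longrightarrow> poly_eval (graph_point e) q = poly_eval (F e) q"
  by (rule poly_eval_cong) (auto simp: graph_point_def)

lemma poly_eval_pull_z: "q \<in> polys (zs s) \<Longrightarrow> poly_eval e (pull q) = poly_eval (F e) q"
  by (simp add: poly_eval_pull poly_eval_graph_point)

section \<open>Dominance as a condition on forms\<close>

lemma T_nonzero: "\<exists>i\<le>s. \<not> vanishes T (Var (Bz, i))"
proof -
  obtain t where t: "t \<in> T" using T_irr by (auto simp: irreducible_cone_def)
  from Z_coord[OF t] obtain v where "t v \<noteq> 0" "v \<in> zs s" by (auto simp: coord_vecs_def)
  then obtain i where "i \<le> s" "t (Bz, i) \<noteq> 0" by (auto simp: zs_def)
  with t show ?thesis by (intro exI[of _ i]) (auto simp: vanishes_def)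
qed

text \<open>The quantifier runs over all of \<open>E\<close>, including base points, where
  \<open>F e\<close> is the zero vector and no projective image exists. This keeps the hypothesis a
  polynomial condition on \<open>E\<close>.\<close>

definition image_dense :: bool where
  "image_dense \<longleftrightarrow> (\<forall>q d. q \<in> polys (zs s) \<longrightarrow> homogeneous_in (zs s) d q \<longrightarrow>
     (\<forall>e\<in>E. poly_eval (F e) q = 0) \<longrightarrow> vanishes T q)"

lemma image_denseD:
  "image_dense \<Longrightarrow> q \<in> polys (zs s) \<Longrightarrow> homogeneous_in (zs s) d q \<Longrightarrow>
    (\<And>e. e \<in> E \<Longrightarrow> poly_eval (F e) q = 0) \<Longrightarrow> vanishes T q"
  unfolding image_dense_def by blast

lemma pull_not_vanishes:
  "image_dense \<Longrightarrow> q \<in> polys (zs s) \<Longrightarrow> homogeneous_in (zs s) d q \<Longrightarrow> \<not> vanishes T q \<Longrightarrow> \<not> vanishes E (pull q)"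
  using image_denseD[of q d] by (auto simp: vanishes_def poly_eval_pull_z)

lemma image_set_eq:
  "{proj_point (zs s) (tuple_value (zs s) f (\<lambda>v. u v + w v)) | P Q u w.
      P \<in> X \<and> u \<in> P \<and> Q \<in> Y \<and> w \<in> Q \<and> tuple_defined (zs s) f (\<lambda>v. u v + w v)} =
   {proj_point (zs s) (F e) | e. e \<in> E \<and> tuple_defined (zs s) f e}" (is "?A = ?B")
proof
  show "?A \<subseteq> ?B" unfolding sum_cone_def by blast
  show "?B \<subseteq> ?A" unfolding sum_cone_def by blast
qed

text \<open>A form that vanishes at the image points cuts out a closed set containing their closure.
  Conversely, a closed set containing the image is given by forms, and each of them is shown to
  vanish on \<open>Z\<close>.\<close>

lemma dominant_iff: "dominant s X Y Z f \<longleftrightarrow> image_dense"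
proof
  let ?S = "{proj_point (zs s) (F e) | e. e \<in> E \<and> tuple_defined (zs s) f e}"
  {
    assume dom: "dominant s X Y Z f"
    then have cl: "proj_closure (zs s) ?S = Z" by (simp add: dominant_def image_set_eq)
    show image_dense
      unfolding image_dense_def
    proof (intro allI impI)
      fix q d assume q: "q \<in> polys (zs s)" "homogeneous_in (zs s) d q" and z: "\<forall>e\<in>E. poly_eval (F e) q = 0"
      have "proj_closed (zs s) (zero_locus (zs s) {q})"
        unfolding proj_closed_def by (rule exI[of _ "{q}"]) (use q in auto)
      moreover have "?S \<subseteq> zero_locus (zs s) {q}"
      proof
        fix P assume "P \<in> ?S"
        then obtain e where e: "e \<in> E" "tuple_defined (zs s) f e" "P = proj_point (zs s) (F e)" by blast
        show "P \<in> zero_locus (zs s) {q}"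
          unfolding e(3) by (subst proj_point_in_zero_locus[OF tuple_value_coord_vecs[OF e(2)]]) (use q z e(1) in auto)
      qed
      ultimately have "Z \<subseteq> zero_locus (zs s) {q}"
        using cl unfolding proj_closure_def by blast
      then show "vanishes T q" by (auto simp: vanishes_def zero_locus_def)
    qed
  }
  assume dense: image_dense
  have closed: "proj_closed (zs s) Z" using irrZ by (simp add: irreducible_variety_def)
  have "?S \<subseteq> Z" using F_in_T by auto
  then have "proj_closure (zs s) ?S \<subseteq> Z"
    using closed unfolding proj_closure_def by blast
  moreover have "Z \<subseteq> C" if C: "proj_closed (zs s) C" "?S \<subseteq> C" for C
  proof
    from C(1) obtain G where G: "G \<subseteq> polys (zs s)" "\<And>p. p \<in> G \<Longrightarrow> \<exists>d. homogeneous_in (zs s) d p"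
      "C = zero_locus (zs s) G" by (auto simp: proj_closed_def)
    have van: "vanishes T q" if q: "q \<in> G" for q
    proof -
      from G(2)[OF q] obtain d where d: "homogeneous_in (zs s) d q" by blast
      obtain i where i: "i \<le> s" "\<not> vanishes T (Var (Bz, i))" using T_nonzero by blast
      text \<open>The factor \<open>z\<^sub>i\<close> accounts for the points at which \<open>f\<close> is not defined.\<close>
      have "vanishes T (q * Var (Bz, i))"
      proof (rule image_denseD[OF dense])
        show "q * Var (Bz, i) \<in> polys (zs s)"
          using q G(1) i(1) by (intro polys_mult polys_Var) (auto simp: zs_def)
        show "homogeneous_in (zs s) (d + 1) (q * Var (Bz, i))"
          using homogeneous_in_mult[OF d homogeneous_in_Var[of "zs s" "(Bz, i)"]] i(1) by (simp add: zs_def)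
        fix e assume e: "e \<in> E"
        show "poly_eval (F e) (q * Var (Bz, i)) = 0"
        proof (cases "tuple_defined (zs s) f e")
          case True
          then have "proj_point (zs s) (F e) \<in> zero_locus (zs s) G" using C(2) G(3) e by blast
          then have "poly_eval (F e) q = 0"
            using proj_point_in_zero_locus[OF tuple_value_coord_vecs[OF True] G(1,2)] q by blast
          then show ?thesis by (simp add: poly_eval.hom_mult)
        next
          case False
          then show ?thesis by (simp add: tuple_defined_def poly_eval.hom_mult)
        qed
      qed
      with T_irr i(2) show ?thesis unfolding irreducible_cone_def by blast
    qed
    fix P assume P: "P \<in> Z"
    with Z_sub obtain t where t: "t \<in> P" "t \<in> coord_vecs (zs s)" "P = proj_point (zs s) t"
      using proj_space_nonempty by blast
    have "\<forall>q\<in>G. poly_eval t q = 0" using van P t(1) by (auto simp: vanishes_def)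
    with t show "P \<in> C" unfolding G(3) using proj_point_in_zero_locus[OF t(2) G(1,2)] by blast
  qed
  then have "Z \<subseteq> proj_closure (zs s) ?S" unfolding proj_closure_def by blast
  ultimately show "dominant s X Y Z f" unfolding dominant_def image_set_eq by (rule equalityI)
qed

text \<open>Vanishing 2 by 2 minors: the block of \<open>e\<close> and the value of \<open>g\<close>
  at \<open>F e\<close> give the same projective point whenever that value is nonzero. A zero value
  is allowed, so the condition is polynomial on \<open>E\<close>.\<close>

definition proportional :: "block \<Rightarrow> nat \<Rightarrow> (nat \<Rightarrow> 'k mpoly) \<Rightarrow> bool" where
  "proportional b N g \<longleftrightarrow>
     (\<forall>e\<in>E. \<forall>i\<le>N. \<forall>j\<le>N. e (b, i) * poly_eval (F e) (g j) = e (b, j) * poly_eval (F e) (g i))"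

text \<open>Forms of one degree that recover one block of coordinates from the image point. That
  their values lie in the target variety is derived from density in
  \<open>inverse_half_rational_map\<close>.\<close>

definition inverse_half :: "block \<Rightarrow> nat \<Rightarrow> (nat \<Rightarrow> 'k mpoly) \<Rightarrow> bool" where
  "inverse_half b N g \<longleftrightarrow>
     (\<exists>d. \<forall>j\<le>N. g j \<in> polys (zs s) \<and> homogeneous_in (zs s) d (g j)) \<and>
     (\<exists>j\<le>N. \<not> vanishes T (g j)) \<and> proportional b N g"

end

section \<open>Partial Jacobian dual matrices\<close>

text \<open>The rows of \<open>\<Psi>\<close> are relations between the coordinates of the block \<open>b\<close> on the graph of
  the rational map, and all such relations depend on the rows at each \<open>t\<close>.\<close>

locale partial_dual = product_map n m s X Y Z f
  for n m s :: nat and X Y Z :: "'k::alg_closed_field point set" and f :: "nat \<Rightarrow> 'k mpoly" +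
  fixes b :: block and N :: nat and \<Psi> :: "'k mpoly mat"
  assumes dim_col: "dim_col \<Psi> = Suc N"
    and entries: "elements_mat \<Psi> \<subseteq> polys (zs s)"
    and rows_homogeneous: "\<And>i. i < dim_row \<Psi> \<Longrightarrow> \<exists>d. \<forall>j\<le>N. homogeneous_in (zs s) d (\<Psi> $$ (i, j))"
    and block_nonzero: "\<And>e. e \<in> E \<Longrightarrow> \<exists>j\<le>N. e (b, j) \<noteq> 0"
    and rows: "\<And>e i. e \<in> E \<Longrightarrow> i < dim_row \<Psi> \<Longrightarrow> (\<Sum>j\<le>N. poly_eval (F e) (\<Psi> $$ (i, j)) * e (b, j)) = 0"
    and relation: "\<And>Q d t v. (\<And>j. j \<le> N \<Longrightarrow> Q j \<in> polys (zs s) \<and> homogeneous_in (zs s) d (Q j)) \<Longrightarrow>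
      (\<And>e. e \<in> E \<Longrightarrow> (\<Sum>j\<le>N. poly_eval (F e) (Q j) * e (b, j)) = 0) \<Longrightarrow>
      (\<And>i. i < dim_row \<Psi> \<Longrightarrow> (\<Sum>j\<le>N. poly_eval t (\<Psi> $$ (i, j)) * v j) = 0) \<Longrightarrow>
      (\<Sum>j\<le>N. poly_eval t (Q j) * v j) = 0"
begin

abbreviation row_independent :: "nat set \<Rightarrow> bool" where
  "row_independent I \<equiv> independent_on T I {..<dim_col \<Psi>} (\<lambda>i j. \<Psi> $$ (i, j))"

lemma T_ne: "T \<noteq> {}"
  using T_irr by (simp add: irreducible_cone_def)

lemma entry_polys: "i < dim_row \<Psi> \<Longrightarrow> j \<le> N \<Longrightarrow> \<Psi> $$ (i, j) \<in> polys (zs s)"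
  using elements_mat_subsetD[OF entries] dim_col by simp

lemma row_degrees: "\<exists>d. \<forall>i<dim_row \<Psi>. \<forall>j\<le>N. homogeneous_in (zs s) (d i) (\<Psi> $$ (i, j))"
  using rows_homogeneous by metis

text \<open>For a vector \<open>v\<close> in the kernel of the rows at \<open>t\<close>, the
  relation \<open>q\<close> times coordinate \<open>l\<close> gives \<open>q(t) * v l = 0\<close>.
  As \<open>q\<close> does not vanish on the irreducible cone \<open>T\<close>, all
  \<open>N + 1\<close> columns are independent, and hence \<open>N + 1\<close> rows are.\<close>

lemma image_dense_or_full_rank:
  assumes "\<not> image_dense"
  shows "\<exists>I\<subseteq>{..<dim_row \<Psi>}. card I = Suc N \<and> row_independent I"
proof -
  from assms obtain q d where q: "q \<in> polys (zs s)" "homogeneous_in (zs s) d q"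
    and z: "\<And>e. e \<in> E \<Longrightarrow> poly_eval (F e) q = 0" and nv: "\<not> vanishes T q"
    unfolding image_dense_def by blast
  have "independent_on T {..<Suc N} {..<dim_row \<Psi>} (\<lambda>l i. \<Psi> $$ (i, l))"
    unfolding independent_on_def
  proof (intro allI impI ballI)
    fix a l assume a: "\<forall>i\<in>{..<dim_row \<Psi>}. vanishes T (\<Sum>l<Suc N. a l * \<Psi> $$ (i, l))" and l: "l \<in> {..<Suc N}"
    have "poly_eval t q * poly_eval t (a l) = 0" if t: "t \<in> T" for t
    proof -
      have "(\<Sum>j\<le>N. poly_eval t (if j = l then q else 0) * poly_eval t (a j)) = 0"
      proof (rule relation[where d = d])
        fix i assume "i < dim_row \<Psi>"
        then have "poly_eval t (\<Sum>l<Suc N. a l * \<Psi> $$ (i, l)) = 0"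
          using a t by (auto simp: vanishes_def)
        then show "(\<Sum>j\<le>N. poly_eval t (\<Psi> $$ (i, j)) * poly_eval t (a j)) = 0"
          by (simp only: lessThan_Suc_atMost poly_eval.hom_sum poly_eval.hom_mult mult.commute)
      next
        fix e assume "e \<in> E"
        then show "(\<Sum>j\<le>N. poly_eval (F e) (if j = l then q else 0) * e (b, j)) = 0"
          using z by (intro sum.neutral) auto
      qed (use q in auto)
      then show ?thesis
        using l by (simp add: if_distrib[of "poly_eval t"] if_distrib[of "\<lambda>x. x * _"] sum.delta less_Suc_eq_le cong: if_cong)
    qed
    with irreducible_coneD[OF T_irr this] nv show "vanishes T (a l)" by blast
  qed
  then obtain I where "I \<subseteq> {..<dim_row \<Psi>}" "card I = Suc N" "row_independent I"
    by (rule independent_columns_rows[OF T_irr, where kc = "\<lambda>l. l" and C = "{..<dim_col \<Psi>}"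
        and M = "\<lambda>i j. \<Psi> $$ (i, j)", rotated]) (auto simp: dim_col)
  then show ?thesis by (intro exI[of _ I]) simp
qed

text \<open>A minor witnesses the independence. It is nonzero at some point of \<open>T\<close> and,
  being a form in \<open>z\<close>, also at some image point by density. The second conclusion links
  the rank over \<open>Z\<close> to the graph.\<close>

lemma generic_row_independence:
  assumes dense: image_dense and I: "I \<subseteq> {..<dim_row \<Psi>}" "row_independent I" "card I = k"
  shows "\<exists>t\<in>T. \<forall>v. (\<forall>j\<le>N. (\<Sum>i<k. v i * poly_eval t (\<Psi> $$ (pick I i, j))) = 0) \<longrightarrow> (\<forall>i<k. v i = 0)"
    and "\<exists>e\<in>E. \<forall>v. (\<forall>j\<le>N. (\<Sum>i<k. v i * poly_eval (F e) (\<Psi> $$ (pick I i, j))) = 0) \<longrightarrow> (\<forall>i<k. v i = 0)"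
proof -
  have fin: "finite I" using I(1) finite_subset by blast
  have pk: "pick I i < dim_row \<Psi>" if "i < k" for i
    using pick_mem[OF fin, of i] that I(1,3) by auto
  have "independent_on T {..<k} {..<dim_col \<Psi>} (\<lambda>i j. \<Psi> $$ (pick I i, j))"
    using independent_on_reindex[OF bij_betw_pick[OF fin] I(2)] I(3) by simp
  from independent_on_generic[OF T_ne this]
  obtain D where nv: "\<not> vanishes T D"
    and DV: "\<forall>V. (\<forall>i<k. \<forall>j\<in>{..<dim_col \<Psi>}. \<Psi> $$ (pick I i, j) \<in> polys V) \<longrightarrow> D \<in> polys V"
    and DB: "\<forall>B d. (\<forall>i<k. \<forall>j\<in>{..<dim_col \<Psi>}. homogeneous_in B (d i) (\<Psi> $$ (pick I i, j))) \<longrightarrow>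
      homogeneous_in B (\<Sum>i<k. d i) D"
    and D0: "\<forall>t v. poly_eval t D \<noteq> 0 \<longrightarrow>
      (\<forall>j\<in>{..<dim_col \<Psi>}. (\<Sum>i<k. v i * poly_eval t (\<Psi> $$ (pick I i, j))) = 0) \<longrightarrow> (\<forall>i<k. v i = 0)"
    by (elim exE conjE)
  have D0': "\<forall>v. (\<forall>j\<le>N. (\<Sum>i<k. v i * poly_eval t (\<Psi> $$ (pick I i, j))) = 0) \<longrightarrow> (\<forall>i<k. v i = 0)"
    if "poly_eval t D \<noteq> 0" for t
  proof (intro allI impI)
    fix v i assume "\<forall>j\<le>N. (\<Sum>i<k. v i * poly_eval t (\<Psi> $$ (pick I i, j))) = 0" "i < k"
    then show "v i = 0" using D0[rule_format, OF that, of v] by (simp add: dim_col less_Suc_eq_le)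
  qed
  obtain d where d: "\<forall>i<dim_row \<Psi>. \<forall>j\<le>N. homogeneous_in (zs s) (d i) (\<Psi> $$ (i, j))"
    using row_degrees by (rule exE)
  have D_polys: "D \<in> polys (zs s)"
    using DV pk entry_polys dim_col by (simp add: less_Suc_eq_le)
  have D_hom: "homogeneous_in (zs s) (\<Sum>i<k. d (pick I i)) D"
    using pk d dim_col by (intro DB[rule_format]) (simp add: less_Suc_eq_le)
  show "\<exists>t\<in>T. \<forall>v. (\<forall>j\<le>N. (\<Sum>i<k. v i * poly_eval t (\<Psi> $$ (pick I i, j))) = 0) \<longrightarrow> (\<forall>i<k. v i = 0)"
  proof -
    from nv obtain t where "t \<in> T" "poly_eval t D \<noteq> 0" by (rule not_vanishesE)
    with D0' show ?thesis by (intro bexI[of _ t])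
  qed
  have "\<exists>e\<in>E. poly_eval (F e) D \<noteq> 0"
  proof (rule ccontr)
    assume "\<not> ?thesis"
    then have "poly_eval (F e) D = 0" if "e \<in> E" for e using that by simp
    from image_denseD[OF dense D_polys D_hom this] nv show False by simp
  qed
  then show "\<exists>e\<in>E. \<forall>v. (\<forall>j\<le>N. (\<Sum>i<k. v i * poly_eval (F e) (\<Psi> $$ (pick I i, j))) = 0) \<longrightarrow> (\<forall>i<k. v i = 0)"
  proof
    fix e assume "e \<in> E" "poly_eval (F e) D \<noteq> 0"
    with D0' show ?thesis by (intro bexI[of _ e])
  qed
qed

text \<open>Too many independent rows would include \<open>N + 1\<close> that stay independent at
  some image point \<open>F e\<close> and form a square matrix there; but by \<open>rows\<close> the
  nonzero block of \<open>e\<close> is in its kernel.\<close>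

lemma row_independent_card_le:
  assumes dense: image_dense and I: "I \<subseteq> {..<dim_row \<Psi>}" "row_independent I"
  shows "card I \<le> N"
proof (rule ccontr)
  assume "\<not> card I \<le> N"
  then have "Suc N \<le> card I" by simp
  then obtain I' where I': "I' \<subseteq> I" "card I' = Suc N"
    using obtain_subset_with_card_n by metis
  have fin: "finite I" using I(1) finite_subset by blast
  have fin': "finite I'" by (rule finite_subset[OF I'(1) fin])
  have sub: "I' \<subseteq> {..<dim_row \<Psi>}" using I(1) I'(1) by blast
  from generic_row_independence(2)[OF dense sub independent_on_subset[OF I(2) I'(1) fin] I'(2)]
  obtain e where e: "e \<in> E" and
    ind: "\<forall>v. (\<forall>j\<le>N. (\<Sum>i<Suc N. v i * poly_eval (F e) (\<Psi> $$ (pick I' i, j))) = 0) \<longrightarrow> (\<forall>i<Suc N. v i = 0)"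
    by (rule bexE)
  note ind = ind[rule_format]
  define A where "A = mat (Suc N) (Suc N) (\<lambda>(i, j). poly_eval (F e) (\<Psi> $$ (pick I' i, j)))"
  let ?x = "vec (Suc N) (\<lambda>j. e (b, j))"
  have A: "A \<in> carrier_mat (Suc N) (Suc N)" by (simp add: A_def)
  have pk: "pick I' i < dim_row \<Psi>" if "i < Suc N" for i
    using pick_mem[OF fin', of i] that sub I'(2) by auto
  have "A *\<^sub>v ?x = 0\<^sub>v (Suc N)"
  proof (rule eq_vecI)
    fix i assume "i < dim_vec (0\<^sub>v (Suc N) :: 'k vec)"
    then have i: "i < Suc N" by simp
    then have "(A *\<^sub>v ?x) $ i = (\<Sum>j\<le>N. poly_eval (F e) (\<Psi> $$ (pick I' i, j)) * e (b, j))"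
      by (simp add: A_def scalar_prod_def atLeast0LessThan lessThan_Suc_atMost del: sum.lessThan_Suc)
    with rows[OF e pk[OF i]] i show "(A *\<^sub>v ?x) $ i = 0\<^sub>v (Suc N) $ i" by simp
  qed (simp add: A_def)
  moreover have "?x \<noteq> 0\<^sub>v (Suc N)"
    using block_nonzero[OF e] by (metis index_vec index_zero_vec(1) less_Suc_eq_le)
  ultimately have "det A = 0"
    by (subst det_0_iff_vec_prod_zero[OF A]) (auto intro!: exI[of _ ?x])
  then have "det A\<^sup>T = 0" using det_transpose[OF A] by simp
  moreover have AT: "A\<^sup>T \<in> carrier_mat (Suc N) (Suc N)" using A by simp
  ultimately obtain w where w: "w \<in> carrier_vec (Suc N)" "w \<noteq> 0\<^sub>v (Suc N)" "A\<^sup>T *\<^sub>v w = 0\<^sub>v (Suc N)"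
    using det_0_iff_vec_prod_zero[OF AT] by blast
  have "(\<Sum>i<Suc N. w $ i * poly_eval (F e) (\<Psi> $$ (pick I' i, j))) = 0" if j: "j \<le> N" for j
  proof -
    have "(A\<^sup>T *\<^sub>v w) $ j = (\<Sum>i<Suc N. A $$ (i, j) * w $ i)"
      using j w(1) by (simp add: scalar_prod_def atLeast0LessThan A_def del: sum.lessThan_Suc)
    also have "\<dots> = (\<Sum>i<Suc N. w $ i * poly_eval (F e) (\<Psi> $$ (pick I' i, j)))"
      by (rule sum.cong) (use j in \<open>auto simp: A_def\<close>)
    finally show ?thesis using w(3) j by simp
  qed
  then have "w $ i = 0" if "i < Suc N" for i using that by (intro ind[where v = "($) w"])
  with w(1,2) show False by (metis carrier_vecD eq_vecI index_zero_vec(1,2))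
qed

text \<open>Take \<open>j0\<close> with \<open>g j0\<close> not vanishing on \<open>T\<close>. The
  relations between coordinate \<open>j0\<close> and the others show that a kernel vector with entry
  0 at \<open>j0\<close> is zero wherever \<open>g j0\<close> is nonzero. So the \<open>N\<close>
  remaining columns are independent, and hence \<open>N\<close> rows are.\<close>

lemma inverse_half_independent_rows:
  assumes "inverse_half b N g"
  shows "\<exists>I\<subseteq>{..<dim_row \<Psi>}. card I = N \<and> row_independent I"
proof -
  from assms obtain d j0 where g: "\<And>j. j \<le> N \<Longrightarrow> g j \<in> polys (zs s) \<and> homogeneous_in (zs s) d (g j)"
    and j0: "j0 \<le> N" "\<not> vanishes T (g j0)" and pr: "proportional b N g"
    by (auto simp: inverse_half_def)
  \<comment> \<open>Enumerates \<open>0, ..., N\<close> without \<open>j0\<close>.\<close>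
  define sk where "sk l = (if l < j0 then l else Suc l)" for l
  have sk: "sk l \<le> N" "sk l \<noteq> j0" if "l < N" for l using that j0(1) by (auto simp: sk_def)
  have inj: "inj_on sk {..<N}" by (rule inj_onI) (auto simp: sk_def split: if_splits)
  have "sk ` {..<N} \<subseteq> {..N} - {j0}" using sk by auto
  moreover have "card ({..N} - {j0}) = N" using j0(1) by simp
  ultimately have bij: "sk ` {..<N} = {..N} - {j0}"
    using card_image[OF inj] by (intro card_subset_eq) auto
  have "independent_on T {..<N} {..<dim_row \<Psi>} (\<lambda>l i. \<Psi> $$ (i, sk l))"
    unfolding independent_on_def
  proof (intro allI impI ballI)
    fix a l assume a: "\<forall>i\<in>{..<dim_row \<Psi>}. vanishes T (\<Sum>l<N. a l * \<Psi> $$ (i, sk l))" and l: "l \<in> {..<N}"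
    have "poly_eval t (g j0) * poly_eval t (a l) = 0" if t: "t \<in> T" for t
    proof -
      \<comment> \<open>The coefficients \<open>a\<close> at \<open>t\<close> as a vector over all
        columns, with 0 at the omitted column.\<close>
      define v where "v j = (if j = j0 then 0 else poly_eval t (a (the_inv_into {..<N} sk j)))" for j
      \<comment> \<open>The relation \<open>g j0\<close> times coordinate \<open>sk l\<close> minus
        \<open>g (sk l)\<close> times coordinate \<open>j0\<close>, which holds on the graph by
        proportionality.\<close>
      define Q where "Q j = (if j = j0 then - g (sk l) else if j = sk l then g j0 else 0)" for j
      have v_sk: "v (sk l) = poly_eval t (a l)" if "l < N" for l
        using that sk(2)[OF that] the_inv_into_f_f[OF inj] by (simp add: v_def)
      have sum_v: "(\<Sum>j\<le>N. c j * v j) = (\<Sum>l<N. c (sk l) * poly_eval t (a l))" for c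
      proof -
        have "(\<Sum>j\<le>N. c j * v j) = (\<Sum>j\<in>sk ` {..<N}. c j * v j)"
          unfolding bij by (rule sum.mono_neutral_right) (auto simp: v_def)
        also have "\<dots> = (\<Sum>l<N. c (sk l) * poly_eval t (a l))"
          unfolding sum.reindex[OF inj] by (rule sum.cong) (auto simp: v_sk)
        finally show ?thesis .
      qed
      have sum_Q: "(\<Sum>j\<le>N. poly_eval t' (Q j) * c j) =
          poly_eval t' (g j0) * c (sk l) - poly_eval t' (g (sk l)) * c j0" for t' c
      proof -
        have "(\<Sum>j\<le>N. poly_eval t' (Q j) * c j) = (\<Sum>j\<in>{j0, sk l}. poly_eval t' (Q j) * c j)"
          by (rule sum.mono_neutral_right) (use j0(1) sk l in \<open>auto simp: Q_def\<close>)
        also have "\<dots> = poly_eval t' (g j0) * c (sk l) - poly_eval t' (g (sk l)) * c j0"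
          using sk(2)[of l] l by (simp add: Q_def poly_eval.hom_uminus)
        finally show ?thesis .
      qed
      have "(\<Sum>j\<le>N. poly_eval t (Q j) * v j) = 0"
      proof (rule relation[where d = d])
        fix i assume "i < dim_row \<Psi>"
        then have "poly_eval t (\<Sum>l<N. a l * \<Psi> $$ (i, sk l)) = 0"
          using a t by (auto simp: vanishes_def)
        then show "(\<Sum>j\<le>N. poly_eval t (\<Psi> $$ (i, j)) * v j) = 0"
          unfolding sum_v by (simp only: poly_eval.hom_sum poly_eval.hom_mult mult.commute)
      next
        fix e assume "e \<in> E"
        with pr j0(1) sk(1)[of l] l have "e (b, sk l) * poly_eval (F e) (g j0) = e (b, j0) * poly_eval (F e) (g (sk l))"
          by (auto simp: proportional_def)
        then show "(\<Sum>j\<le>N. poly_eval (F e) (Q j) * e (b, j)) = 0"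
          unfolding sum_Q by (simp add: mult.commute)
      next
        fix j assume "j \<le> N"
        then show "Q j \<in> polys (zs s) \<and> homogeneous_in (zs s) d (Q j)"
          using g[of "sk l"] g[OF j0(1)] sk(1)[of l] l by (auto simp: Q_def polys_uminus homogeneous_in_uminus)
      qed
      then show ?thesis unfolding sum_Q using v_sk[of l] l by (simp add: v_def)
    qed
    with irreducible_coneD[OF T_irr this] j0(2) show "vanishes T (a l)" by blast
  qed
  then obtain I where "I \<subseteq> {..<dim_row \<Psi>}" "card I = N" "row_independent I"
    by (rule independent_columns_rows[OF T_irr, where kc = sk and C = "{..<dim_col \<Psi>}"
        and M = "\<lambda>i j. \<Psi> $$ (i, j)", rotated]) (use sk in \<open>auto simp: dim_col less_Suc_eq_le\<close>)
  then show ?thesis by (intro exI[of _ I]) simp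
qed

text \<open>Cramer's rule in projective form: the block of \<open>e\<close> is killed by the chosen
  rows at \<open>F e\<close>, so it is proportional to their signed minors. These do not all vanish
  on \<open>T\<close>, since the rows are independent at some point of it.\<close>

lemma signed_minors_inverse_half:
  assumes dense: image_dense and I: "I \<subseteq> {..<dim_row \<Psi>}" "row_independent I" "card I = N"
  shows "inverse_half b N (signed_minor \<Psi> I)"
  unfolding inverse_half_def
proof (intro conjI)
  have fin: "finite I" using I(1) finite_subset by blast
  obtain d where d: "\<forall>i<dim_row \<Psi>. \<forall>j\<le>N. homogeneous_in (zs s) (d i) (\<Psi> $$ (i, j))"
    using row_degrees by (rule exE)
  have "signed_minor \<Psi> I j \<in> polys (zs s)"
    "homogeneous_in (zs s) (\<Sum>i<N. d (pick I i)) (signed_minor \<Psi> I j)" if "j \<le> N" for j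
    using signed_minor_polys[OF I(1,3) dim_col that entries]
      signed_minor_homogeneous[OF I(1,3) dim_col that, of "zs s" d] d dim_col by auto
  then show "\<exists>d. \<forall>j\<le>N. signed_minor \<Psi> I j \<in> polys (zs s) \<and> homogeneous_in (zs s) d (signed_minor \<Psi> I j)"
    by blast
  have map_dims: "I \<subseteq> {..<dim_row (map_mat (poly_eval t) \<Psi>)}" "dim_col (map_mat (poly_eval t) \<Psi>) = Suc N" for t
    using I(1) dim_col by auto
  have pk: "pick I i < dim_row \<Psi>" if "i < N" for i
    using pick_mem[OF fin, of i] that I(1,3) by auto
  from generic_row_independence(1)[OF dense I] obtain t where t: "t \<in> T" and
    ind: "\<forall>v. (\<forall>j\<le>N. (\<Sum>i<N. v i * poly_eval t (\<Psi> $$ (pick I i, j))) = 0) \<longrightarrow> (\<forall>i<N. v i = 0)"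
    by (rule bexE)
  note ind = ind[rule_format]
  have "\<exists>j\<le>N. signed_minor (map_mat (poly_eval t) \<Psi>) I j \<noteq> 0"
  proof (rule signed_minor_nonzero[OF map_dims(1) I(3) map_dims(2)])
    fix v i assume z: "\<And>j. j \<le> N \<Longrightarrow> (\<Sum>i<N. v i * map_mat (poly_eval t) \<Psi> $$ (pick I i, j)) = 0" and "i < N"
    show "v i = 0"
    proof (rule ind[where v = v, OF _ \<open>i < N\<close>])
      fix j assume j: "j \<le> N"
      with z[OF j] show "(\<Sum>i<N. v i * poly_eval t (\<Psi> $$ (pick I i, j))) = 0"
        using pk dim_col by simp
    qed
  qed
  then obtain j where j: "j \<le> N" "poly_eval t (signed_minor \<Psi> I j) \<noteq> 0"
    using poly_eval_signed_minor[OF I(1,3) dim_col, of _ t] by auto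
  with t show "\<exists>j\<le>N. \<not> vanishes T (signed_minor \<Psi> I j)"
    unfolding vanishes_def by blast
  show "proportional b N (signed_minor \<Psi> I)"
    unfolding proportional_def
  proof (intro ballI allI impI)
    fix e i j assume e: "e \<in> E" and ij: "i \<le> N" "j \<le> N"
    have "e (b, i) * signed_minor (map_mat (poly_eval (F e)) \<Psi>) I j =
        e (b, j) * signed_minor (map_mat (poly_eval (F e)) \<Psi>) I i"
    proof (rule signed_minor_proportional[OF map_dims(1) I(3) map_dims(2) _ ij])
      fix i' assume i': "i' \<in> I"
      then have "i' < dim_row \<Psi>" using I(1) by auto
      with rows[OF e this] show "(\<Sum>j\<le>N. map_mat (poly_eval (F e)) \<Psi> $$ (i', j) * e (b, j)) = 0"
        using dim_col by simp
    qed
    then show "e (b, i) * poly_eval (F e) (signed_minor \<Psi> I j) = e (b, j) * poly_eval (F e) (signed_minor \<Psi> I i)"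
      using ij by (simp add: poly_eval_signed_minor[OF I(1,3) dim_col])
  qed
qed

abbreviation rank :: nat where
  "rank \<equiv> rank_over_domain (coord_ring (zs s) Z) (reduce_mat (zs s) Z \<Psi>)"

lemmas rank_eq_iff = rank_over_coord_ring_eq_iff[OF irrZ entries]

lemma rank_image_dense:
  assumes "rank = N"
  shows image_dense
proof (rule ccontr)
  assume "\<not> image_dense"
  from image_dense_or_full_rank[OF this] obtain I where I: "I \<subseteq> {..<dim_row \<Psi>}" "card I = Suc N" "row_independent I"
    by (elim exE conjE)
  from assms have "\<forall>I\<subseteq>{..<dim_row \<Psi>}. row_independent I \<longrightarrow> card I \<le> N"
    unfolding rank_eq_iff by (rule conjunct2)
  from this[rule_format, OF I(1,3)] I(2) show False by simp
qed

lemma rank_inverse_half: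
  assumes image_dense "inverse_half b N g"
  shows "rank = N"
  unfolding rank_eq_iff
proof (intro conjI allI impI)
  from inverse_half_independent_rows[OF assms(2)]
  show "\<exists>I\<subseteq>{..<dim_row \<Psi>}. row_independent I \<and> card I = N" by (elim exE conjE) (intro exI conjI)
qed (rule row_independent_card_le[OF assms(1)])

lemma inverse_half_of_rank:
  assumes "rank = N"
  shows "\<exists>I\<subseteq>{..<dim_row \<Psi>}. card I = N \<and> inverse_half b N (signed_minor \<Psi> I)"
proof -
  from assms have "\<exists>I\<subseteq>{..<dim_row \<Psi>}. row_independent I \<and> card I = N"
    unfolding rank_eq_iff by (rule conjunct1)
  then obtain I where I: "I \<subseteq> {..<dim_row \<Psi>}" "row_independent I" "card I = N"
    by (elim exE conjE)
  with signed_minors_inverse_half[OF rank_image_dense[OF assms] I] show ?thesis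
    by (intro exI[of _ I]) simp
qed

end

section \<open>The two halves of the inverse\<close>

context product_map
begin

definition block_part :: "var set \<Rightarrow> 'k coord_vec \<Rightarrow> 'k coord_vec" where
  "block_part B e = (\<lambda>v. if v \<in> B then e v else 0)"

lemma sum_block_part:
  assumes "P \<in> X" "u \<in> P" "Q \<in> Y" "w \<in> Q"
  shows "(\<lambda>v. u v + w v) \<in> E" "block_part (xs n) (\<lambda>v. u v + w v) = u"
    "block_part (ys m) (\<lambda>v. u v + w v) = w"
proof -
  show "(\<lambda>v. u v + w v) \<in> E" using assms by (auto simp: sum_cone_def)
  have "u v = 0" if "v \<notin> xs n" for v using assms X_coord coord_vecs_zero that by blast
  moreover have "w v = 0" if "v \<notin> ys m" for v using assms Y_coord coord_vecs_zero that by blast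
  ultimately show "block_part (xs n) (\<lambda>v. u v + w v) = u" "block_part (ys m) (\<lambda>v. u v + w v) = w"
    by (auto simp: block_part_def fun_eq_iff xs_def ys_def)
qed

lemma E_points:
  assumes "e \<in> E"
  obtains P Q where "P \<in> X" "Q \<in> Y" "block_part (xs n) e \<in> P" "block_part (ys m) e \<in> Q"
proof -
  from assms obtain P u Q w where *: "P \<in> X" "u \<in> P" "Q \<in> Y" "w \<in> Q" and e: "e = (\<lambda>v. u v + w v)"
    by (auto simp: sum_cone_def)
  from sum_block_part(2,3)[OF *, folded e] * show thesis by (intro that[of P Q]) simp_all
qed

lemma block_part_sum:
  assumes "e \<in> E"
  shows "(\<lambda>v. block_part (xs n) e v + block_part (ys m) e v) = e"
proof -
  from assms obtain P u Q w where *: "P \<in> X" "u \<in> P" "Q \<in> Y" "w \<in> Q" and e: "e = (\<lambda>v. u v + w v)"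
    by (auto simp: sum_cone_def)
  from sum_block_part(2,3)[OF *, folded e] show ?thesis by (simp add: e)
qed

lemma
  assumes "e \<in> E"
  shows block_part_X: "block_part (xs n) e \<in> \<Union>X" and block_part_Y: "block_part (ys m) e \<in> \<Union>Y"
proof -
  obtain P Q where "P \<in> X" "Q \<in> Y" "block_part (xs n) e \<in> P" "block_part (ys m) e \<in> Q"
    by (rule E_points[OF assms])
  then show "block_part (xs n) e \<in> \<Union>X" "block_part (ys m) e \<in> \<Union>Y" by auto
qed

section \<open>Halves of an inverse as rational maps to the factors\<close>

lemma tuple_value_proportional:
  assumes B: "B = {b} \<times> {..N}" and pr: "proportional b N g" and e: "e \<in> E" "block_part B e \<in> coord_vecs B"
  obtains c where "tuple_value B g (F e) = (\<lambda>v. c * block_part B e v)"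
proof -
  from e(2) obtain v where "block_part B e v \<noteq> 0" by (auto simp: coord_vecs_def)
  then obtain j0 where j0: "j0 \<le> N" "e (b, j0) \<noteq> 0" by (auto simp: block_part_def B split: if_splits)
  define c where "c = poly_eval (F e) (g j0) / e (b, j0)"
  have "poly_eval (F e) (g j) = c * e (b, j)" if "j \<le> N" for j
    using pr e(1) j0 that unfolding proportional_def c_def
    by (simp add: field_simps)
  then have "tuple_value B g (F e) = (\<lambda>v. c * block_part B e v)"
    by (auto simp: tuple_value_def block_part_def B fun_eq_iff)
  then show thesis by (rule that)
qed

lemma poly_eval_tuple_value:
  assumes "q \<in> polys B"
  shows "poly_eval t (poly_subst (\<lambda>v. g (snd v)) q) = poly_eval (tuple_value B g t) q"
  unfolding poly_eval_subst by (rule poly_eval_cong[OF assms]) (simp add: tuple_value_def)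

text \<open>For an equation \<open>q\<close> of \<open>W\<close>, the composite
  \<open>q(g(z))\<close> is a form in \<open>z\<close>. At \<open>F e\<close> the tuple
  \<open>g\<close> is a multiple of the block of \<open>e\<close>, where \<open>q\<close> vanishes;
  so the composite vanishes on the image and, by density, on \<open>T\<close>.\<close>

lemma inverse_half_rational_map:
  assumes dense: image_dense and B: "B = {b} \<times> {..N}" and inv: "inverse_half b N g"
    and W: "proj_closed B W" and part: "\<And>e. e \<in> E \<Longrightarrow> block_part B e \<in> \<Union>W"
  shows "rational_map (zs s) Z B W g"
proof -
  from inv obtain d where g: "\<And>j. j \<le> N \<Longrightarrow> g j \<in> polys (zs s) \<and> homogeneous_in (zs s) d (g j)"
    and nv: "\<exists>j\<le>N. \<not> vanishes T (g j)" and pr: "proportional b N g"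
    by (auto simp: inverse_half_def)
  from W obtain G where G: "G \<subseteq> polys B" "\<And>p. p \<in> G \<Longrightarrow> \<exists>d. homogeneous_in B d p" "W = zero_locus B G"
    by (auto simp: proj_closed_def)
  have part_coord: "block_part B e \<in> coord_vecs B" if "e \<in> E" for e
    using part[OF that] proj_closed_subset[OF W] proj_space_memD(1) by blast
  have van: "poly_eval (tuple_value B g t) q = 0" if q: "q \<in> G" and t: "t \<in> T" for q t
  proof -
    from G(2)[OF q] obtain d' where d': "homogeneous_in B d' q" by blast
    have qB: "q \<in> polys B" using q G(1) by blast
    have "vanishes T (poly_subst (\<lambda>v. g (snd v)) q)"
    proof (rule image_denseD[OF dense])
      show "poly_subst (\<lambda>v. g (snd v)) q \<in> polys (zs s)"
        by (rule polys_subst[OF qB]) (use g in \<open>auto simp: B\<close>)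
      show "homogeneous_in (zs s) (d * d') (poly_subst (\<lambda>v. g (snd v)) q)"
        by (rule homogeneous_in_subst_forms[OF qB d']) (use g in \<open>auto simp: B\<close>)
      fix e assume e: "e \<in> E"
      obtain c where c: "tuple_value B g (F e) = (\<lambda>v. c * block_part B e v)"
        by (rule tuple_value_proportional[OF B pr e part_coord[OF e]])
      have "poly_eval (block_part B e) q = 0"
        using part[OF e] q by (auto simp: G(3) zero_locus_def)
      then show "poly_eval (F e) (poly_subst (\<lambda>v. g (snd v)) q) = 0"
        unfolding poly_eval_tuple_value[OF qB] c by (simp add: poly_eval_scale[OF qB d'])
    qed
    with t show ?thesis by (auto simp: vanishes_def poly_eval_tuple_value[OF qB])
  qed
  show ?thesis
    unfolding rational_map_def
  proof (intro conjI ballI impI)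
    show "\<exists>d. \<forall>v\<in>B. g (snd v) \<in> polys (zs s) \<and> homogeneous_in (zs s) d (g (snd v))"
      using g by (auto simp: B)
    from nv obtain j where "j \<le> N" "\<not> vanishes T (g j)" by blast
    then show "\<exists>v\<in>B. g (snd v) \<notin> vanishing_ideal (zs s) Z"
      by (intro bexI[of _ "(b, j)"]) (auto simp: B vanishing_ideal_eq)
    fix P t assume t: "P \<in> Z" "t \<in> P" "tuple_defined B g t"
    show "proj_point B (tuple_value B g t) \<in> W"
      unfolding G(3)
      by (subst proj_point_in_zero_locus[OF tuple_value_coord_vecs[OF t(3)] G(1,2)])
         (use van t in blast)+
  qed
qed

text \<open>The scalar in \<open>generic\<close> exists where \<open>f\<close>, \<open>g\<close> and
  a further form \<open>c\<close> do not vanish. Multiplied by \<open>f i0\<close> and the pullback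
  of \<open>c\<close>, the proportionality holds on all of \<open>E\<close>, and irreducibility
  cancels these factors. Where \<open>g\<close> is undefined both sides are 0.\<close>

lemma rational_map_inverse_half:
  assumes dense: image_dense and B: "B = {b} \<times> {..N}" and g: "rational_map (zs s) Z B W g"
    and c: "c \<in> polys (zs s)" "homogeneous_in (zs s) d c" "\<not> vanishes T c"
    and generic: "\<And>e. e \<in> E \<Longrightarrow> tuple_defined (zs s) f e \<Longrightarrow> poly_eval (F e) c \<noteq> 0 \<Longrightarrow>
      tuple_defined B g (F e) \<Longrightarrow> \<exists>a. tuple_value B g (F e) = (\<lambda>v. a * block_part B e v)"
  shows "inverse_half b N g"
  unfolding inverse_half_def
proof (intro conjI)
  from g obtain dg where "\<And>v. v \<in> B \<Longrightarrow> g (snd v) \<in> polys (zs s) \<and> homogeneous_in (zs s) dg (g (snd v))"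
    and nv: "\<exists>v\<in>B. g (snd v) \<notin> vanishing_ideal (zs s) Z" by (auto simp: rational_map_def)
  then have gB: "g j \<in> polys (zs s) \<and> homogeneous_in (zs s) dg (g j)" if "j \<le> N" for j
    using that by (force simp: B)
  then show "\<exists>d. \<forall>j\<le>N. g j \<in> polys (zs s) \<and> homogeneous_in (zs s) d (g j)" by blast
  show "\<exists>j\<le>N. \<not> vanishes T (g j)"
    using nv gB by (auto simp: B vanishing_ideal_eq)
  obtain i0 where i0: "i0 \<le> s" "\<not> vanishes E (f i0)" using f_nonzero by blast
  show "proportional b N g"
    unfolding proportional_def
  proof (intro ballI allI impI)
    fix e i j assume e: "e \<in> E" and ij: "i \<le> N" "j \<le> N"
    let ?r = "Var (b, i) * pull (g j) - Var (b, j) * pull (g i)"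
    have r: "poly_eval e ?r = e (b, i) * poly_eval (F e) (g j) - e (b, j) * poly_eval (F e) (g i)" for e
      using gB ij by (simp add: poly_eval.hom_minus poly_eval.hom_mult poly_eval_pull_z)
    have "poly_eval e (f i0 * pull c) * poly_eval e ?r = 0" if e: "e \<in> E" for e
    proof (cases "poly_eval e (f i0) = 0 \<or> poly_eval (F e) c = 0")
      case True
      then show ?thesis using c(1) by (auto simp: poly_eval.hom_mult poly_eval_pull_z)
    next
      case False
      then have "tuple_value (zs s) f e (Bz, i0) \<noteq> 0" using i0(1) by (simp add: tuple_value_def zs_def)
      then have def: "tuple_defined (zs s) f e" unfolding tuple_defined_def by blast
      have val: "poly_eval (F e) (g l) = tuple_value B g (F e) (b, l)" if "l \<le> N" for l
        using that by (simp add: tuple_value_def B)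
      show ?thesis
      proof (cases "tuple_defined B g (F e)")
        case True
        from generic[OF e def _ True] False obtain a where
          "tuple_value B g (F e) = (\<lambda>v. a * block_part B e v)" by blast
        then show ?thesis
          unfolding r using ij by (simp add: val block_part_def B)
      next
        case False
        then show ?thesis unfolding r using ij by (simp add: val tuple_defined_def)
      qed
    qed
    then have "vanishes E (f i0 * pull c) \<or> vanishes E ?r" by (rule irreducible_coneD[OF E_irr])
    moreover have "\<not> vanishes E (f i0 * pull c)"
      using E_irr i0(2) pull_not_vanishes[OF dense c] unfolding irreducible_cone_def by blast
    ultimately have "vanishes E ?r" by blast
    with e have "poly_eval e ?r = 0" unfolding vanishes_def by blast
    then show "e (b, i) * poly_eval (F e) (g j) = e (b, j) * poly_eval (F e) (g i)" unfolding r by simp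
  qed
qed

lemma proj_point_block:
  assumes "proj_point B (tuple_value B g t) = P" "u \<in> P"
  shows "\<exists>a. tuple_value B g t = (\<lambda>v. a * u v)"
proof -
  from assms obtain c where "c \<noteq> 0" "u = (\<lambda>v. c * tuple_value B g t v)"
    using mem_proj_point by blast
  then have "tuple_value B g t = (\<lambda>v. inverse c * u v)" by (auto simp: fun_eq_iff)
  then show ?thesis by blast
qed

text \<open>The identity that recovers one half is available where the other half is defined too. A
  component of the other half that does not vanish on \<open>T\<close> therefore serves as the form
  \<open>c\<close> in \<open>rational_map_inverse_half\<close>.\<close>

lemma inverse_pair_halves:
  assumes dense: image_dense and inv: "inverse_pair n m s X Y Z f g h"
  shows "inverse_half Bx n g" "inverse_half By m h"
proof -
  from inv have g: "rational_map (zs s) Z (xs n) X g" and h: "rational_map (zs s) Z (ys m) Y h"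
    by (auto simp: inverse_pair_def)
  have proj_back: "proj_point (xs n) (tuple_value (xs n) g (F e)) = P"
      "proj_point (ys m) (tuple_value (ys m) h (F e)) = Q"
    if e: "e \<in> E" and defs: "tuple_defined (zs s) f e" "tuple_defined (xs n) g (F e)" "tuple_defined (ys m) h (F e)"
      and PQ: "P \<in> X" "Q \<in> Y" "block_part (xs n) e \<in> P" "block_part (ys m) e \<in> Q" for e P Q
  proof -
    from inv have "\<forall>P\<in>X. \<forall>u\<in>P. \<forall>Q\<in>Y. \<forall>w\<in>Q. tuple_defined (zs s) f (\<lambda>v. u v + w v) \<longrightarrow>
          tuple_defined (xs n) g (F (\<lambda>v. u v + w v)) \<longrightarrow> tuple_defined (ys m) h (F (\<lambda>v. u v + w v)) \<longrightarrow>
          proj_point (xs n) (tuple_value (xs n) g (F (\<lambda>v. u v + w v))) = P \<and>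
          proj_point (ys m) (tuple_value (ys m) h (F (\<lambda>v. u v + w v))) = Q"
      unfolding inverse_pair_def Let_def by (elim conjE)
    from this[rule_format, OF PQ(1,3,2,4), unfolded block_part_sum[OF e], OF defs]
    show "proj_point (xs n) (tuple_value (xs n) g (F e)) = P"
      "proj_point (ys m) (tuple_value (ys m) h (F e)) = Q" by simp_all
  qed
  have forms: "\<exists>c d. c \<in> polys (zs s) \<and> homogeneous_in (zs s) d c \<and> \<not> vanishes T c \<and>
      (\<forall>t. poly_eval t c \<noteq> 0 \<longrightarrow> tuple_defined B g t)"
    if g: "rational_map (zs s) Z B W g" for B W g
  proof -
    from g obtain v d where v: "v \<in> B" "g (snd v) \<notin> vanishing_ideal (zs s) Z"
      "g (snd v) \<in> polys (zs s)" "homogeneous_in (zs s) d (g (snd v))"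
      unfolding rational_map_def by blast
    have "tuple_defined B g t" if "poly_eval t (g (snd v)) \<noteq> 0" for t
      using that v(1) unfolding tuple_defined_def by (intro exI[of _ v]) (simp add: tuple_value_def)
    moreover have "\<not> vanishes T (g (snd v))" using v(2,3) by (simp add: vanishing_ideal_eq)
    ultimately show ?thesis using v(3,4) by blast
  qed
  from forms[OF g] obtain cg dg where cg: "cg \<in> polys (zs s)" "homogeneous_in (zs s) dg cg" "\<not> vanishes T cg"
    "\<And>t. poly_eval t cg \<noteq> 0 \<Longrightarrow> tuple_defined (xs n) g t" by blast
  from forms[OF h] obtain ch dh where ch: "ch \<in> polys (zs s)" "homogeneous_in (zs s) dh ch" "\<not> vanishes T ch"
    "\<And>t. poly_eval t ch \<noteq> 0 \<Longrightarrow> tuple_defined (ys m) h t" by blast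
  show "inverse_half Bx n g"
  proof (rule rational_map_inverse_half[OF dense xs_def g ch(1-3)])
    fix e assume e: "e \<in> E" and defs: "tuple_defined (zs s) f e" "poly_eval (F e) ch \<noteq> 0" "tuple_defined (xs n) g (F e)"
    obtain P Q where PQ: "P \<in> X" "Q \<in> Y" "block_part (xs n) e \<in> P" "block_part (ys m) e \<in> Q"
      by (rule E_points[OF e])
    show "\<exists>a. tuple_value (xs n) g (F e) = (\<lambda>v. a * block_part (xs n) e v)"
      by (rule proj_point_block[OF proj_back(1)[OF e defs(1,3) ch(4)[OF defs(2)] PQ] PQ(3)])
  qed
  show "inverse_half By m h"
  proof (rule rational_map_inverse_half[OF dense ys_def h cg(1-3)])
    fix e assume e: "e \<in> E" and defs: "tuple_defined (zs s) f e" "poly_eval (F e) cg \<noteq> 0" "tuple_defined (ys m) h (F e)"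
    obtain P Q where PQ: "P \<in> X" "Q \<in> Y" "block_part (xs n) e \<in> P" "block_part (ys m) e \<in> Q"
      by (rule E_points[OF e])
    show "\<exists>a. tuple_value (ys m) h (F e) = (\<lambda>v. a * block_part (ys m) e v)"
      by (rule proj_point_block[OF proj_back(2)[OF e defs(1) cg(4)[OF defs(2)] defs(3) PQ] PQ(4)])
  qed
qed

lemma biproj_closed_product: "biproj_closed n m (X \<times> Y)"
proof -
  have "proj_closed (xs n) X" "proj_closed (ys m) Y"
    using irrX irrY by (simp_all add: irreducible_variety_def)
  then obtain G H where G: "G \<subseteq> polys (xs n)" "\<And>p. p \<in> G \<Longrightarrow> \<exists>d. homogeneous_in (xs n) d p"
      "X = zero_locus (xs n) G"
    and H: "H \<subseteq> polys (ys m)" "\<And>p. p \<in> H \<Longrightarrow> \<exists>d. homogeneous_in (ys m) d p"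
      "Y = zero_locus (ys m) H"
    unfolding proj_closed_def by blast
  have disj: "xs n \<inter> ys m = {}" by (auto simp: xs_def ys_def)
  have ev: "(\<forall>p\<in>G \<union> H. poly_eval (\<lambda>v. u v + w v) p = 0) \<longleftrightarrow>
      (\<forall>p\<in>G. poly_eval u p = 0) \<and> (\<forall>p\<in>H. poly_eval w p = 0)"
    if "u \<in> coord_vecs (xs n)" "w \<in> coord_vecs (ys m)" for u w
  proof -
    have "poly_eval (\<lambda>v. u v + w v) p = poly_eval u p" if "p \<in> G" for p
      using G(1) that disj coord_vecs_zero[OF \<open>w \<in> _\<close>]
      by (intro poly_eval_cong[of p "xs n"]) auto
    moreover have "poly_eval (\<lambda>v. u v + w v) p = poly_eval w p" if "p \<in> H" for p
      using H(1) that disj coord_vecs_zero[OF \<open>u \<in> _\<close>]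
      by (intro poly_eval_cong[of p "ys m"]) auto
    ultimately show ?thesis by auto
  qed
  have mem: "(P, Q) \<in> X \<times> Y \<longleftrightarrow> (\<forall>u\<in>P. \<forall>w\<in>Q. \<forall>p\<in>G \<union> H. poly_eval (\<lambda>v. u v + w v) p = 0)"
    if PQ: "P \<in> proj_space (xs n)" "Q \<in> proj_space (ys m)" for P Q
  proof -
    \<comment> \<open>Both classes are nonempty, so the joint condition on pairs separates into one
      on \<open>P\<close> and one on \<open>Q\<close>.\<close>
    from PQ obtain u0 w0 where "u0 \<in> P" "w0 \<in> Q" using proj_space_nonempty by metis
    have "(\<forall>u\<in>P. \<forall>w\<in>Q. \<forall>p\<in>G \<union> H. poly_eval (\<lambda>v. u v + w v) p = 0) \<longleftrightarrow>
        (\<forall>u\<in>P. \<forall>w\<in>Q. (\<forall>p\<in>G. poly_eval u p = 0) \<and> (\<forall>p\<in>H. poly_eval w p = 0))"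
      by (intro ball_cong refl ev proj_space_memD(1)[OF PQ(1)] proj_space_memD(1)[OF PQ(2)])
    also have "\<dots> \<longleftrightarrow> (\<forall>u\<in>P. \<forall>p\<in>G. poly_eval u p = 0) \<and> (\<forall>w\<in>Q. \<forall>p\<in>H. poly_eval w p = 0)"
      using \<open>u0 \<in> P\<close> \<open>w0 \<in> Q\<close> by blast
    finally show ?thesis using PQ by (simp add: G(3) H(3) zero_locus_def)
  qed
  show ?thesis
    unfolding biproj_closed_def
  proof (intro exI[of _ "G \<union> H"] conjI ballI)
    show "G \<union> H \<subseteq> polys (xs n \<union> ys m)"
      using G(1) H(1) polys_mono[of "xs n" "xs n \<union> ys m"] polys_mono[of "ys m" "xs n \<union> ys m"] by auto
    fix p assume "p \<in> G \<union> H"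
    then show "\<exists>d e. homogeneous_in (xs n) d p \<and> homogeneous_in (ys m) e p"
    proof
      assume p: "p \<in> G"
      then have "homogeneous_in (ys m) 0 p" using G(1) disj by (intro homogeneous_in_disjoint[of p "xs n"]) auto
      with G(2)[OF p] show ?thesis by blast
    next
      assume p: "p \<in> H"
      then have "homogeneous_in (xs n) 0 p" using H(1) disj by (intro homogeneous_in_disjoint[of p "ys m"]) auto
      with H(2)[OF p] show ?thesis by blast
    qed
  next
    show "X \<times> Y = {(P, Q) \<in> proj_space (xs n) \<times> proj_space (ys m).
        \<forall>u\<in>P. \<forall>w\<in>Q. \<forall>p\<in>G \<union> H. poly_eval (\<lambda>v. u v + w v) p = 0}"
    proof (rule Set.set_eqI)
      fix R :: "'k point \<times> 'k point"
      obtain P Q where R: "R = (P, Q)" by (cases R)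
      have "P \<in> proj_space (xs n) \<and> Q \<in> proj_space (ys m)" if "(P, Q) \<in> X \<times> Y"
        using that X_sub Y_sub by blast
      with mem[of P Q] show "R \<in> X \<times> Y \<longleftrightarrow> R \<in> {(P, Q) \<in> proj_space (xs n) \<times> proj_space (ys m).
          \<forall>u\<in>P. \<forall>w\<in>Q. \<forall>p\<in>G \<union> H. poly_eval (\<lambda>v. u v + w v) p = 0}"
        unfolding R mem_Collect_eq case_prod_conv mem_Sigma_iff by argo
    qed
  qed
qed

text \<open>The density of \<open>(g, h)\<close> and both composites rest on
  \<open>multiples\<close>: at the image of \<open>e = (u, w)\<close> the pair has the value
  \<open>(a u, c w)\<close>, so a bihomogeneous \<open>p\<close> is merely scaled there.
  Irreducibility of \<open>E\<close> and density of the image spread this to all points.\<close>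

lemma halves_inverse_pair:
  assumes dense: image_dense and g: "inverse_half Bx n g" and h: "inverse_half By m h"
  shows "inverse_pair n m s X Y Z f g h"
proof -
  let ?tg = "tuple_value (xs n) g" and ?th = "tuple_value (ys m) h"
  from g obtain dg where gB: "\<And>j. j \<le> n \<Longrightarrow> g j \<in> polys (zs s) \<and> homogeneous_in (zs s) dg (g j)"
    and g0: "\<exists>j\<le>n. \<not> vanishes T (g j)" and gp: "proportional Bx n g"
    by (auto simp: inverse_half_def)
  from h obtain dh where hB: "\<And>j. j \<le> m \<Longrightarrow> h j \<in> polys (zs s) \<and> homogeneous_in (zs s) dh (h j)"
    and h0: "\<exists>j\<le>m. \<not> vanishes T (h j)" and hp: "proportional By m h"
    by (auto simp: inverse_half_def)
  have closed: "proj_closed (xs n) X" "proj_closed (ys m) Y"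
    using irrX irrY by (auto simp: irreducible_variety_def)
  have rg: "rational_map (zs s) Z (xs n) X g"
    by (rule inverse_half_rational_map[OF dense xs_def g closed(1) block_part_X])
  have rh: "rational_map (zs s) Z (ys m) Y h"
    by (rule inverse_half_rational_map[OF dense ys_def h closed(2) block_part_Y])
  have disj: "xs n \<inter> ys m = {}" by (auto simp: xs_def ys_def)
  have multiples: "\<exists>a c. ?tg (F e) = (\<lambda>v. a * block_part (xs n) e v) \<and> ?th (F e) = (\<lambda>v. c * block_part (ys m) e v) \<and>
      (\<forall>p d d'. p \<in> polys (xs n \<union> ys m) \<longrightarrow> homogeneous_in (xs n) d p \<longrightarrow> homogeneous_in (ys m) d' p \<longrightarrow>
        poly_eval (\<lambda>v. ?tg (F e) v + ?th (F e) v) p = a ^ d * c ^ d' * poly_eval e p)" if e: "e \<in> E" for e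
  proof -
    obtain a where a: "?tg (F e) = (\<lambda>v. a * block_part (xs n) e v)"
      by (rule tuple_value_proportional[OF xs_def gp e X_coord[OF block_part_X[OF e]]])
    obtain c where c: "?th (F e) = (\<lambda>v. c * block_part (ys m) e v)"
      by (rule tuple_value_proportional[OF ys_def hp e Y_coord[OF block_part_Y[OF e]]])
    have "poly_eval (\<lambda>v. ?tg (F e) v + ?th (F e) v) p = a ^ d * c ^ d' * poly_eval e p"
      if p: "p \<in> polys (xs n \<union> ys m)" "homogeneous_in (xs n) d p" "homogeneous_in (ys m) d' p" for p d d'
    proof -
      have "poly_eval (\<lambda>v. ?tg (F e) v + ?th (F e) v) p = poly_eval (\<lambda>v. (if v \<in> xs n then a else c) * e v) p"
        by (rule poly_eval_cong[OF p(1)]) (use disj in \<open>auto simp: a c block_part_def\<close>)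
      then show ?thesis by (simp add: poly_eval_scale_two_blocks[OF p(1) disj p(2,3)])
    qed
    with a c show ?thesis by blast
  qed
  let ?S = "{(proj_point (xs n) (?tg t), proj_point (ys m) (?th t)) | t.
    t \<in> \<Union>Z \<and> tuple_defined (xs n) g t \<and> tuple_defined (ys m) h t}"
  have closure: "biproj_closure n m ?S = X \<times> Y"
  proof
    have "?S \<subseteq> X \<times> Y"
      using rg rh unfolding rational_map_def by blast
    then show "biproj_closure n m ?S \<subseteq> X \<times> Y"
      unfolding biproj_closure_def using biproj_closed_product by blast
    have "X \<times> Y \<subseteq> C" if C: "biproj_closed n m C" "?S \<subseteq> C" for C
    proof -
      from C(1) obtain G where G: "G \<subseteq> polys (xs n \<union> ys m)"
        "\<forall>p\<in>G. \<exists>d d'. homogeneous_in (xs n) d p \<and> homogeneous_in (ys m) d' p"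
        "C = {(P, Q) \<in> proj_space (xs n) \<times> proj_space (ys m).
                 \<forall>u\<in>P. \<forall>w\<in>Q. \<forall>p\<in>G. poly_eval (\<lambda>v. u v + w v) p = 0}"
        unfolding biproj_closed_def by blast
      \<comment> \<open>At points where the three factors \<open>f i0\<close>, \<open>g j\<close>
        and \<open>h l\<close> are nonzero, \<open>(a u, c w)\<close> represents a point of
        \<open>C\<close>, and \<open>p\<close> vanishes at \<open>e\<close> by scaling back. The
        product with these factors therefore vanishes on all of \<open>E\<close>.\<close>
      have van: "vanishes E p" if p: "p \<in> G" for p
      proof -
        from G(2) p obtain d d' where dd: "homogeneous_in (xs n) d p" "homogeneous_in (ys m) d' p" by blast
        have pV: "p \<in> polys (xs n \<union> ys m)" using p G(1) by blast
        obtain i0 where i0: "i0 \<le> s" "\<not> vanishes E (f i0)" using f_nonzero by blast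
        obtain j where j: "j \<le> n" "\<not> vanishes T (g j)" using g0 by blast
        obtain l where l: "l \<le> m" "\<not> vanishes T (h l)" using h0 by blast
        have "poly_eval e (f i0 * (pull (g j) * pull (h l))) * poly_eval e p = 0" if e: "e \<in> E" for e
        proof (cases "poly_eval e (f i0) = 0 \<or> poly_eval (F e) (g j) = 0 \<or> poly_eval (F e) (h l) = 0")
          case True
          then show ?thesis using gB[OF j(1)] hB[OF l(1)] by (auto simp: poly_eval.hom_mult poly_eval_pull_z)
        next
          case False
          then have nz: "F e (Bz, i0) \<noteq> 0" "?tg (F e) (Bx, j) \<noteq> 0" "?th (F e) (By, l) \<noteq> 0"
            using i0(1) j(1) l(1) by (auto simp: tuple_value_def zs_def xs_def ys_def)
          then have defs: "tuple_defined (zs s) f e" "tuple_defined (xs n) g (F e)" "tuple_defined (ys m) h (F e)"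
            unfolding tuple_defined_def by blast+
          have "(proj_point (xs n) (?tg (F e)), proj_point (ys m) (?th (F e))) \<in> C"
            using C(2) F_in_T(1)[OF e defs(1)] defs by blast
          then have zero: "poly_eval (\<lambda>v. ?tg (F e) v + ?th (F e) v) p = 0"
            using p proj_point_self[OF tuple_value_coord_vecs[OF defs(2)]]
              proj_point_self[OF tuple_value_coord_vecs[OF defs(3)]]
            unfolding G(3) by simp
          from multiples[OF e] obtain a c where a: "?tg (F e) = (\<lambda>v. a * block_part (xs n) e v)"
            and c: "?th (F e) = (\<lambda>v. c * block_part (ys m) e v)"
            and sc: "poly_eval (\<lambda>v. ?tg (F e) v + ?th (F e) v) p = a ^ d * c ^ d' * poly_eval e p"
            using pV dd by blast
          have "a \<noteq> 0" "c \<noteq> 0" using nz(2,3) unfolding a c by auto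
          with zero sc have "poly_eval e p = 0" by simp
          then show ?thesis by simp
        qed
        then have "vanishes E (f i0 * (pull (g j) * pull (h l))) \<or> vanishes E p"
          by (rule irreducible_coneD[OF E_irr])
        moreover have "\<not> vanishes E (pull (g j))" "\<not> vanishes E (pull (h l))"
          using gB[OF j(1)] hB[OF l(1)] pull_not_vanishes[OF dense _ _ j(2)] pull_not_vanishes[OF dense _ _ l(2)]
          by blast+
        then have "\<not> vanishes E (f i0 * (pull (g j) * pull (h l)))"
          using E_irr i0(2) unfolding irreducible_cone_def by blast
        ultimately show ?thesis by blast
      qed
      show "X \<times> Y \<subseteq> C"
      proof (rule subrelI)
        fix P Q assume PQ: "(P, Q) \<in> X \<times> Y"
        have "poly_eval (\<lambda>v. u v + w v) p = 0" if "u \<in> P" "w \<in> Q" "p \<in> G" for u w p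
          using van[OF that(3)] PQ that sum_block_part(1)[of P u Q w] by (auto simp: vanishes_def)
        with PQ X_sub Y_sub show "(P, Q) \<in> C" unfolding G(3) by auto
      qed
    qed
    then show "X \<times> Y \<subseteq> biproj_closure n m ?S" unfolding biproj_closure_def by blast
  qed
  have left_inverse: "proj_point (xs n) (?tg (F e)) = P \<and> proj_point (ys m) (?th (F e)) = Q"
    if "P \<in> X" "u \<in> P" "Q \<in> Y" "w \<in> Q" and e: "e = (\<lambda>v. u v + w v)"
      and defs: "tuple_defined (xs n) g (F e)" "tuple_defined (ys m) h (F e)" for P Q u w e
  proof -
    note uw = sum_block_part[OF that(1-4), folded e]
    from multiples[OF uw(1)] obtain a c where ac: "?tg (F e) = (\<lambda>v. a * u v)" "?th (F e) = (\<lambda>v. c * w v)"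
      unfolding uw(2,3) by blast
    have PQ: "u \<in> coord_vecs (xs n)" "P = proj_point (xs n) u" "w \<in> coord_vecs (ys m)" "Q = proj_point (ys m) w"
      using proj_space_memD X_sub Y_sub that(1-4) by blast+
    have "proj_point (xs n) u = proj_point (xs n) (?tg (F e))"
      by (rule proj_point_eqI[OF PQ(1) tuple_value_coord_vecs[OF defs(1)]]) (simp add: ac)
    moreover have "proj_point (ys m) w = proj_point (ys m) (?th (F e))"
      by (rule proj_point_eqI[OF PQ(3) tuple_value_coord_vecs[OF defs(2)]]) (simp add: ac)
    ultimately show ?thesis using PQ by simp
  qed
  have right_inverse: "proj_point (zs s) (F (\<lambda>v. ?tg t v + ?th t v)) = R"
    if R: "R \<in> Z" "t \<in> R" and def: "tuple_defined (zs s) f (\<lambda>v. ?tg t v + ?th t v)" for R t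
  proof -
    \<comment> \<open>Replaces \<open>x\<close> by \<open>g\<close> and \<open>y\<close> by
      \<open>h\<close>; the resulting forms in \<open>z\<close> are the components of the composite
      \<open>f(g, h)\<close>.\<close>
    let ?\<sigma> = "\<lambda>v. if v \<in> xs n then g (snd v) else h (snd v)"
    obtain d d' where fh: "\<And>i. i \<le> s \<Longrightarrow> homogeneous_in (xs n) d (f i)" "\<And>i. i \<le> s \<Longrightarrow> homogeneous_in (ys m) d' (f i)"
      using f_homogeneous by blast
    define k where "k i = poly_subst ?\<sigma> (f i)" for i
    have k_polys: "k i \<in> polys (zs s)" if "i \<le> s" for i
      unfolding k_def
      by (rule polys_subst[OF f_polys[OF that]]) (use gB hB in \<open>auto simp: xs_def ys_def\<close>)
    have k_hom: "homogeneous_in (zs s) (dg * d + dh * d') (k i)" if "i \<le> s" for i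
      unfolding k_def
      by (rule homogeneous_in_subst_two_blocks[OF f_polys[OF that] disj fh[OF that]])
         (use gB hB in \<open>auto simp: xs_def ys_def\<close>)
    have k_eval: "poly_eval t (k i) = poly_eval (\<lambda>v. ?tg t v + ?th t v) (f i)" if "i \<le> s" for i t
      unfolding k_def poly_eval_subst
      by (rule poly_eval_cong[OF f_polys[OF that]]) (use disj in \<open>auto simp: tuple_value_def\<close>)
    \<comment> \<open>These 2 by 2 minors compare the composite with the identity. At an image point
      the composite is a multiple of \<open>F e\<close>, so they vanish there, and density carries
      this to \<open>T\<close>.\<close>
    have van: "vanishes T (Var (Bz, i) * k j - Var (Bz, j) * k i)" if ij: "i \<le> s" "j \<le> s" for i j
    proof (rule image_denseD[OF dense])
      show "Var (Bz, i) * k j - Var (Bz, j) * k i \<in> polys (zs s)"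
        using ij k_polys by (intro polys_diff polys_mult polys_Var) (auto simp: zs_def)
      show "homogeneous_in (zs s) (1 + (dg * d + dh * d')) (Var (Bz, i) * k j - Var (Bz, j) * k i)"
        using ij homogeneous_in_mult[OF homogeneous_in_Var k_hom, of j "(Bz, i)"]
          homogeneous_in_mult[OF homogeneous_in_Var k_hom, of i "(Bz, j)"]
        by (intro homogeneous_in_diff) (auto simp: zs_def)
      fix e assume e: "e \<in> E"
      from multiples[OF e] obtain a c where
        sc: "\<forall>p d d'. p \<in> polys (xs n \<union> ys m) \<longrightarrow> homogeneous_in (xs n) d p \<longrightarrow> homogeneous_in (ys m) d' p \<longrightarrow>
          poly_eval (\<lambda>v. ?tg (F e) v + ?th (F e) v) p = a ^ d * c ^ d' * poly_eval e p" by blast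
      have "poly_eval (F e) (k l) = a ^ d * c ^ d' * poly_eval e (f l)" if "l \<le> s" for l
        unfolding k_eval[OF that] using sc f_polys[OF that] fh[OF that] by blast
      then show "poly_eval (F e) (Var (Bz, i) * k j - Var (Bz, j) * k i) = 0"
        using ij by (simp add: poly_eval.hom_minus poly_eval.hom_mult tuple_value_def zs_def)
    qed
    have t: "t \<in> T" "t \<in> coord_vecs (zs s)" "R = proj_point (zs s) t"
      using R Z_coord proj_space_memD(2) Z_sub by blast+
    have "proj_point (zs s) t = proj_point (zs s) (F (\<lambda>v. ?tg t v + ?th t v))"
    proof (rule proj_point_eqI[OF t(2) tuple_value_coord_vecs[OF def]])
      fix v v' assume "v \<in> zs s" "v' \<in> zs s"
      then obtain i j where ij: "v = (Bz, i)" "v' = (Bz, j)" "i \<le> s" "j \<le> s" by (auto simp: zs_def)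
      from van[OF ij(3,4)] t(1) have "t (Bz, i) * poly_eval t (k j) = t (Bz, j) * poly_eval t (k i)"
        by (auto simp: vanishes_def poly_eval.hom_minus poly_eval.hom_mult)
      then show "t v * F (\<lambda>v. ?tg t v + ?th t v) v' = t v' * F (\<lambda>v. ?tg t v + ?th t v) v"
        using ij by (simp add: k_eval tuple_value_def zs_def)
    qed
    with t(3) show ?thesis by simp
  qed
  show ?thesis
    unfolding inverse_pair_def Let_def
  proof (intro conjI ballI impI)
    fix P u Q w assume "P \<in> X" "u \<in> P" "Q \<in> Y" "w \<in> Q"
      "tuple_defined (xs n) g (F (\<lambda>v. u v + w v))" "tuple_defined (ys m) h (F (\<lambda>v. u v + w v))"
    from left_inverse[OF this(1-4) refl this(5,6)]
    show "proj_point (xs n) (?tg (F (\<lambda>v. u v + w v))) = P" "proj_point (ys m) (?th (F (\<lambda>v. u v + w v))) = Q"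
      by simp_all
  next
    fix R t assume "R \<in> Z" "t \<in> R" "tuple_defined (zs s) f (\<lambda>v. ?tg t v + ?th t v)"
    then show "proj_point (zs s) (F (\<lambda>v. ?tg t v + ?th t v)) = R" by (rule right_inverse)
  qed (rule rg rh closure)+
qed

text \<open>A relation with coefficients in \<open>k[z]\<close> lies in the ideal of the generators;
  evaluating there at \<open>x = v\<close>, \<open>z = t\<close> (for the block \<open>x\<close>) shows that it depends
  on the rows at \<open>t\<close>, without any comparison of degrees.\<close>

lemma partial_dual_of_generators:
  assumes bN: "b = Bx \<and> N = n \<and> \<alpha> = 1 \<and> \<beta> = 0 \<or> b = By \<and> N = m \<and> \<alpha> = 0 \<and> \<beta> = 1"
    and gen: "minimal_form_generators (xs n \<union> ys m \<union> zs s) (zs s) (rees_ideal_part n m s X Y f \<alpha> \<beta>) (set ps)"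
    and cm: "coefficient_matrix b N (zs s) ps \<Psi>"
  shows "partial_dual n m s X Y Z f b N \<Psi>"
proof -
  let ?V = "xs n \<union> ys m \<union> zs s" and ?J = "rees_ideal_part n m s X Y f \<alpha> \<beta>"
  let ?S = "{p \<in> polys ?V. (\<exists>a b c. homogeneous_in (xs n) a p \<and> homogeneous_in (ys m) b p \<and> homogeneous_in (zs s) c p) \<and>
    poly_subst (\<lambda>v. if v \<in> zs s then f (snd v) else Var v) p \<in> product_ideal n m X Y}"
  have dims: "dim_row \<Psi> = length ps" "dim_col \<Psi> = Suc N" and entries: "elements_mat \<Psi> \<subseteq> polys (zs s)"
    and ps: "\<And>i. i < length ps \<Longrightarrow> ps ! i = (\<Sum>j\<le>N. \<Psi> $$ (i, j) * Var (b, j))"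
    using cm by (auto simp: coefficient_matrix_def)
  have entry: "\<Psi> $$ (i, j) \<in> polys (zs s)" if "i < length ps" "j \<le> N" for i j
    using elements_mat_subsetD[OF entries] that dims by simp
  have bz: "(b, j) \<notin> zs s" for j using bN by (auto simp: zs_def)
  have bV: "(b, j) \<in> ?V" if "j \<le> N" for j using bN that by (auto simp: xs_def ys_def)
  have zV: "polys (zs s) \<subseteq> polys ?V" by (rule polys_mono) auto
  have S_sub: "?S \<subseteq> polys ?V" by blast
  have rees: "rees_ideal n m s X Y f = Idl\<^bsub>poly_ring ?V\<^esub> ?S" by (simp add: rees_ideal_def)
  \<comment> \<open>The condition modulo the product ideal becomes vanishing on the graph.\<close>
  have S_iff: "p \<in> ?S \<longleftrightarrow> p \<in> polys ?V \<and>
      (\<exists>a b c. homogeneous_in (xs n) a p \<and> homogeneous_in (ys m) b p \<and> homogeneous_in (zs s) c p) \<and>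
      (\<forall>e\<in>E. poly_eval (graph_point e) p = 0)" for p
  proof -
    have "pull p \<in> polys (xs n \<union> ys m)" if "p \<in> polys ?V"
      unfolding pull_def by (rule polys_subst[OF that]) (auto simp: zs_def intro: f_polys polys_Var)
    then show ?thesis
      by (auto simp: mem_product_ideal_iff[OF X_sub Y_sub] vanishes_def poly_eval_pull simp flip: pull_def)
  qed
  have J_graph: "p \<in> polys ?V" "e \<in> E \<Longrightarrow> poly_eval (graph_point e) p = 0" if "p \<in> ?J" for p e
  proof -
    have "p \<in> Idl\<^bsub>poly_ring ?V\<^esub> ?S" using that by (simp add: rees_ideal_part_def rees)
    note * = genideal_vanishes[OF this S_sub, where T = "graph_point ` E"]
    show "p \<in> polys ?V" by (rule *(1)) (use S_iff in auto)
    show "poly_eval (graph_point e) p = 0" if "e \<in> E"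
      by (rule *(2)) (use S_iff that in auto)
  qed
  have eval_row: "poly_eval \<tau> (\<Sum>j\<le>N. Q j * Var (b, j)) = (\<Sum>j\<le>N. poly_eval t (Q j) * v j)"
    if "\<And>j. j \<le> N \<Longrightarrow> Q j \<in> polys (zs s)" "\<And>z. z \<in> zs s \<Longrightarrow> \<tau> z = t z" "\<And>j. j \<le> N \<Longrightarrow> \<tau> (b, j) = v j" for Q \<tau> t v
  proof -
    have "poly_eval \<tau> (Q j) = poly_eval t (Q j)" if "j \<le> N" for j
      by (rule poly_eval_cong) (use that \<open>\<And>j. j \<le> N \<Longrightarrow> Q j \<in> _\<close> \<open>\<And>z. z \<in> zs s \<Longrightarrow> _\<close> in auto)
    with that(3) show ?thesis by (simp add: poly_eval.hom_sum poly_eval.hom_mult)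
  qed
  have psJ: "ps ! i \<in> ?J" "\<exists>d. homogeneous_in (zs s) d (ps ! i)" if "i < length ps" for i
    using gen that nth_mem[OF that] unfolding minimal_form_generators_def by blast+
  have idl: "Idl\<^bsub>poly_ring ?V\<^esub> (set ps) = Idl\<^bsub>poly_ring ?V\<^esub> ?J"
    using gen by (simp add: minimal_form_generators_def)
  show ?thesis
  proof
    show "dim_col \<Psi> = Suc N" by (rule dims)
    show "elements_mat \<Psi> \<subseteq> polys (zs s)" by (rule entries)
    show "\<exists>j\<le>N. e (b, j) \<noteq> 0" if e: "e \<in> E" for e
    proof -
      from bN show ?thesis
      proof
        assume *: "b = Bx \<and> N = n \<and> \<alpha> = 1 \<and> \<beta> = 0"
        obtain v where "block_part (xs n) e v \<noteq> 0"
          using X_coord[OF block_part_X[OF e]] by (auto simp: coord_vecs_def)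
        with * show ?thesis by (auto simp: block_part_def xs_def split: if_splits)
      next
        assume *: "b = By \<and> N = m \<and> \<alpha> = 0 \<and> \<beta> = 1"
        obtain v where "block_part (ys m) e v \<noteq> 0"
          using Y_coord[OF block_part_Y[OF e]] by (auto simp: coord_vecs_def)
        with * show ?thesis by (auto simp: block_part_def ys_def split: if_splits)
      qed
    qed
    show "\<exists>d. \<forall>j\<le>N. homogeneous_in (zs s) d (\<Psi> $$ (i, j))" if i: "i < dim_row \<Psi>" for i
    proof -
      from i dims psJ(2) obtain d where d: "homogeneous_in (zs s) d (ps ! i)" by auto
      have "homogeneous_in (zs s) d (\<Psi> $$ (i, j))" if j: "j \<le> N" for j
      proof -
        \<comment> \<open>Sets coordinate \<open>j\<close> of the block to 1 and all other variables
          except \<open>z\<close> to 0. This extracts the entry at \<open>(i, j)\<close> from the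
          generator and preserves the degree in \<open>z\<close>.\<close>
        let ?\<sigma> = "\<lambda>v. if v \<in> zs s then Var v else if v = (b, j) then 1 else 0 :: 'k mpoly"
        have \<sigma>b: "poly_subst ?\<sigma> (Var (b, l)) = (if l = j then 1 else 0)" for l
          using bz by (simp add: poly_subst_def Var_def Const_def)
        have \<sigma>z: "poly_subst ?\<sigma> q = q" if "q \<in> polys (zs s)" for q
          using poly_subst_cong[OF that, of ?\<sigma> Var] by (simp add: poly_subst_Var)
        have "poly_subst ?\<sigma> (ps ! i) = (\<Sum>l\<le>N. poly_subst ?\<sigma> (\<Psi> $$ (i, l)) * (if l = j then 1 else 0))"
          using ps i dims by (simp only: poly_subst.hom_sum poly_subst.hom_mult \<sigma>b)
        also have "\<dots> = (\<Sum>l\<le>N. \<Psi> $$ (i, l) * (if l = j then 1 else 0))"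
          using i dims by (intro sum.cong refl) (simp add: \<sigma>z entry)
        also have "\<dots> = \<Psi> $$ (i, j)"
          using j by (simp add: if_distrib[of "\<lambda>x. _ * x"] sum.delta cong: if_cong)
        finally have "\<Psi> $$ (i, j) = poly_subst ?\<sigma> (ps ! i)" by simp
        moreover have "homogeneous_in (zs s) d (poly_subst ?\<sigma> (ps ! i))"
        proof (rule homogeneous_in_subst_keep[OF d])
          show "homogeneous_in (zs s) (if v \<in> zs s then 1 else 0) (?\<sigma> v)" for v
            using homogeneous_in_Var[of "zs s" v] by (cases "v \<in> zs s") simp_all
        qed
        ultimately show ?thesis by simp
      qed
      then show ?thesis by blast
    qed
    show "(\<Sum>j\<le>N. poly_eval (F e) (\<Psi> $$ (i, j)) * e (b, j)) = 0" if e: "e \<in> E" and i: "i < dim_row \<Psi>" for e i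
    proof -
      have "poly_eval (graph_point e) (ps ! i) = 0" using J_graph(2)[OF psJ(1) e] i dims by simp
      then show ?thesis
        using i dims entry ps eval_row[of "\<lambda>j. \<Psi> $$ (i, j)" "graph_point e" "F e" "\<lambda>j. e (b, j)"] bz
        by (simp add: graph_point_def)
    qed
    fix Q d t v
    assume Q: "\<And>j. j \<le> N \<Longrightarrow> Q j \<in> polys (zs s) \<and> homogeneous_in (zs s) d (Q j)"
      and QE: "\<And>e. e \<in> E \<Longrightarrow> (\<Sum>j\<le>N. poly_eval (F e) (Q j) * e (b, j)) = 0"
      and ker: "\<And>i. i < dim_row \<Psi> \<Longrightarrow> (\<Sum>j\<le>N. poly_eval t (\<Psi> $$ (i, j)) * v j) = 0"
    let ?p = "\<Sum>j\<le>N. Q j * Var (b, j)"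
    have pV: "?p \<in> polys ?V"
      using Q zV bV by (intro polys_sum polys_mult polys_Var) auto
    have hom: "homogeneous_in B (k + l) ?p"
      if "\<And>j. j \<le> N \<Longrightarrow> homogeneous_in B k (Q j)" "\<And>j. j \<le> N \<Longrightarrow> homogeneous_in B l (Var (b, j) :: 'k mpoly)" for B k l
      using that by (intro homogeneous_in_sum homogeneous_in_mult) auto
    have hz: "homogeneous_in (zs s) (d + 0) ?p"
    proof (rule hom)
      show "homogeneous_in (zs s) 0 (Var (b, j) :: 'k mpoly)" for j
        using homogeneous_in_Var[of "zs s" "(b, j)"] bz by simp
    qed (use Q in blast)
    have Q0: "homogeneous_in (xs n) 0 (Q j)" "homogeneous_in (ys m) 0 (Q j)" if "j \<le> N" for j
      using Q[OF that] by (auto intro!: homogeneous_in_disjoint[of _ "zs s"] simp: xs_def ys_def zs_def)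
    have hx: "homogeneous_in (xs n) (0 + \<alpha>) ?p"
    proof (rule hom[OF Q0(1)])
      show "homogeneous_in (xs n) \<alpha> (Var (b, j) :: 'k mpoly)" if "j \<le> N" for j
        using homogeneous_in_Var[of "xs n" "(b, j)"] bN that by (auto simp: xs_def)
    qed
    have hy: "homogeneous_in (ys m) (0 + \<beta>) ?p"
    proof (rule hom[OF Q0(2)])
      show "homogeneous_in (ys m) \<beta> (Var (b, j) :: 'k mpoly)" if "j \<le> N" for j
        using homogeneous_in_Var[of "ys m" "(b, j)"] bN that by (auto simp: ys_def)
    qed
    have "poly_eval (graph_point e) ?p = 0" if "e \<in> E" for e
      using eval_row[of Q "graph_point e" "F e" "\<lambda>j. e (b, j)"] Q QE[OF that] bz
      by (simp add: graph_point_def)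
    then have "?p \<in> ?S"
      unfolding S_iff using pV hx hy hz by blast
    then have "?p \<in> rees_ideal n m s X Y f" unfolding rees by (rule mem_genideal[OF S_sub])
    then have "?p \<in> ?J" using hx hy by (simp add: rees_ideal_part_def)
    then have pI: "?p \<in> Idl\<^bsub>poly_ring ?V\<^esub> (set ps)"
      unfolding idl by (rule mem_genideal[rotated]) (use J_graph(1) in blast)
    \<comment> \<open>The point with \<open>z = t\<close> and the block \<open>b\<close> equal to
      \<open>v\<close>. The other block receives values of \<open>v\<close> as well; the generators
      and \<open>?p\<close> contain only \<open>z\<close> and the block \<open>b\<close>.\<close>
    let ?\<tau> = "\<lambda>z. if z \<in> zs s then t z else v (snd z)"
    have "poly_eval ?\<tau> ?p = 0"
    proof (rule genideal_vanishes(2)[OF pI, of "{?\<tau>}"])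
      show "set ps \<subseteq> polys ?V" using J_graph(1) psJ(1) by (auto simp: in_set_conv_nth)
      fix q t' assume "q \<in> set ps" and t': "t' \<in> {?\<tau>}"
      then obtain i where i: "i < length ps" "q = ps ! i" by (auto simp: in_set_conv_nth)
      have "poly_eval ?\<tau> (\<Sum>j\<le>N. \<Psi> $$ (i, j) * Var (b, j)) = (\<Sum>j\<le>N. poly_eval t (\<Psi> $$ (i, j)) * v j)"
        by (rule eval_row) (use entry i bz in auto)
      with ker i dims ps t' show "poly_eval t' q = 0" by simp
    qed simp
    moreover have "poly_eval ?\<tau> ?p = (\<Sum>j\<le>N. poly_eval t (Q j) * v j)"
      by (rule eval_row) (use Q bz in auto)
    ultimately show "(\<Sum>j\<le>N. poly_eval t (Q j) * v j) = 0" by simp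
  qed
qed

end

theorem theorem2:
  fixes n m s :: nat
    and X Y Z :: "'k::alg_closed_field point set"
    and f :: "nat \<Rightarrow> 'k mpoly"
    and \<Psi>x \<Psi>y :: "'k mpoly mat"
  assumes "irreducible_variety (xs n) X" and "nondegenerate (xs n) X"
    and "irreducible_variety (ys m) Y" and "nondegenerate (ys m) Y"
    and "irreducible_variety (zs s) Z" and "nondegenerate (zs s) Z"
    and "product_rational_map n m s X Y Z f"
    and "x_partial_jacobian_dual n m s X Y f \<Psi>x"
    and "y_partial_jacobian_dual n m s X Y f \<Psi>y"
  shows "(birational n m s X Y Z f \<longleftrightarrow>
            rank_over_domain (coord_ring (zs s) Z) (reduce_mat (zs s) Z \<Psi>x) = n \<and>
            rank_over_domain (coord_ring (zs s) Z) (reduce_mat (zs s) Z \<Psi>y) = m) \<and>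
         (birational n m s X Y Z f \<longrightarrow>
            (\<exists>I J. I \<subseteq> {..<dim_row \<Psi>x} \<and> card I = n \<and>
                   J \<subseteq> {..<dim_row \<Psi>y} \<and> card J = m \<and>
                   inverse_pair n m s X Y Z f (signed_minor \<Psi>x I) (signed_minor \<Psi>y J)))"
proof -
  interpret product_map n m s X Y Z f
    by unfold_locales (fact assms)+
  from assms(8) obtain px where
    "minimal_form_generators (xs n \<union> ys m \<union> zs s) (zs s) (rees_ideal_part n m s X Y f 1 0) (set px)"
    "coefficient_matrix Bx n (zs s) px \<Psi>x"
    unfolding x_partial_jacobian_dual_def by blast
  then interpret x: partial_dual n m s X Y Z f Bx n \<Psi>x
    by (intro partial_dual_of_generators[of Bx n 1 0 px]) auto
  from assms(9) obtain py where
    "minimal_form_generators (xs n \<union> ys m \<union> zs s) (zs s) (rees_ideal_part n m s X Y f 0 1) (set py)"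
    "coefficient_matrix By m (zs s) py \<Psi>y"
    unfolding y_partial_jacobian_dual_def by blast
  then interpret y: partial_dual n m s X Y Z f By m \<Psi>y
    by (intro partial_dual_of_generators[of By m 0 1 py]) auto
  have ranks: "x.rank = n \<and> y.rank = m" if "birational n m s X Y Z f"
  proof -
    from that have dense: image_dense by (simp add: birational_def dominant_iff)
    from that obtain g h where "inverse_pair n m s X Y Z f g h" by (auto simp: birational_def)
    from inverse_pair_halves[OF dense this] show ?thesis
      using x.rank_inverse_half[OF dense] y.rank_inverse_half[OF dense] by blast
  qed
  have minors: "\<exists>I J. I \<subseteq> {..<dim_row \<Psi>x} \<and> card I = n \<and> J \<subseteq> {..<dim_row \<Psi>y} \<and> card J = m \<and>
      inverse_pair n m s X Y Z f (signed_minor \<Psi>x I) (signed_minor \<Psi>y J)" if r: "x.rank = n \<and> y.rank = m"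
  proof -
    from r x.inverse_half_of_rank obtain I where I: "I \<subseteq> {..<dim_row \<Psi>x}" "card I = n"
      "inverse_half Bx n (signed_minor \<Psi>x I)" by auto
    from r y.inverse_half_of_rank obtain J where J: "J \<subseteq> {..<dim_row \<Psi>y}" "card J = m"
      "inverse_half By m (signed_minor \<Psi>y J)" by auto
    from r x.rank_image_dense have image_dense by simp
    from halves_inverse_pair[OF this I(3) J(3)] I J show ?thesis by blast
  qed
  \<comment> \<open>The pair of minors is itself the inverse that birationality asks for.\<close>
  have "birational n m s X Y Z f" if r: "x.rank = n \<and> y.rank = m"
    using minors[OF r] r x.rank_image_dense by (auto simp: birational_def dominant_iff)
  with ranks minors show ?thesis by blast
qed

end
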